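(* Let $m\in\mathbb{N}$. For $n\in\mathbb{N}$ let $\Delta_n$ be the (rescaled) combinatorial Laplacian on the discrete torus $\mathbb{T}^m_n=(\mathbb{Z}/n\mathbb{Z})^m$, and let $\Delta$ be the Laplace–Beltrami operator on the torus $\mathbb{T}^m=(\mathbb{S}^1)^m$, where $\mathbb{S}^1\subset\mathbb{R}^2$ is the circle of radius $1$. Then the sequence $\log\det\Delta_n$ admits a regularized limit as $n\to\infty$, and this regularized limit equals the logarithm of the zeta-regularized determinant of $\Delta$: $$\log\det\nolimits_\zeta\Delta=\operatorname*{LIM}_{n\to\infty}\log\det\Delta_n .$$
   Context: Combinatorial Laplacian: for $f:\mathbb{Z}/n\mathbb{Z}\to\mathbb{R}$ put $(\mathscr{L}_nf)([k])=\frac{n^2}{4\pi^2}\big((f([k])-f([k-1]))+(f([k])-f([k+1]))\big)$; $\Delta_n$ is the sum over the $m$ factors of $\mathbb{T}^m_n=(\mathbb{Z}/n\mathbb{Z})^m$ of the operators $\mathscr{L}_n$ acting in the respective factor. Its spectrum, with multiplicities, is the multiset $\{\frac{n^2}{\pi^2}\sum_{i=1}^m\sin^2(\frac{\pi k_i}{n}) : k_i\in\{0,\dots,n-1\}\}$. Discrete determinant: $\det\Delta_n$ is the product of the non-zero eigenvalues of $\Delta_n$ counted with multiplicity. Zeta-determinant: $\zeta(s,\Delta)=\sum_{\lambda\in\mathrm{Spec}\,\Delta\setminus\{0\}}m(\lambda)\lambda^{-s}$ for $\mathrm{Re}(s)>m/2$, where $m(\lambda)$ is the multiplicity of $\lambda$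 and $\Delta$ is the non-negative Laplacian; it extends meromorphically to $\mathbb{C}$, regular at $s=0$, and $\log\det_\zeta\Delta:=-\frac{d}{ds}\big|_{s=0}\zeta(s,\Delta)$. Regularized limit: suppose that, as $x\to\infty$, $$f(x)=\sum_{j=1}^{N-1}\sum_{k=0}^{M_j}a_{jk}x^{\alpha_j}\log^k(x)+\sum_{k=0}^{M_0}a_{0k}\log^k(x)+o(x^{\alpha_N}\log^{M_N}(x))$$ for some $N\in\mathbb{N}$, $M_j\in\mathbb{N}_0$, and exponents $\alpha_j\in\mathbb{C}$, with $\alpha_j\neq0$ for $j\geq1$, with $(\mathrm{Re}(\alpha_j))_{j\ge1}$ monotonously decreasing and $\mathrm{Re}(\alpha_N)<0$. Then $\operatorname*{LIM}_{x\to\infty}f(x):=a_{00}$. The same definition applies to sequences indexed by $n\in\mathbb{N}$, $n\to\infty$. *)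

theory Defs
  imports
    "HOL-Complex_Analysis.Complex_Analysis"
    "HOL-Library.Function_Algebras"
    "HOL-Library.Landau_Symbols"
    "HOL-Number_Theory.Cong"
begin

section \<open>Eigenvalues and multiplicities of operators on function spaces\<close>

text \<open>
  Function types are only abelian groups in the library, so the vector space structure
  needed for the dimension of an eigenspace is supplied here.
\<close>

definition scale_fun :: "real \<Rightarrow> ('a \<Rightarrow> real) \<Rightarrow> 'a \<Rightarrow> real" where
  "scale_fun c f = (\<lambda>x. c * f x)"

global_interpretation fun_vs: vector_space "scale_fun :: real \<Rightarrow> ('a \<Rightarrow> real) \<Rightarrow> 'a \<Rightarrow> real"
  by unfold_locales (simp_all add: scale_fun_def fun_eq_iff algebra_simps)

definition eigenspace ::
    "('a \<Rightarrow> real) set \<Rightarrow> (('a \<Rightarrow> real) \<Rightarrow> 'a \<Rightarrow> real) \<Rightarrow> real \<Rightarrow> ('a \<Rightarrow> real) set" where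
  "eigenspace V A \<mu> = {f \<in> V. A f = scale_fun \<mu> f}"

definition eigenvalues ::
    "('a \<Rightarrow> real) set \<Rightarrow> (('a \<Rightarrow> real) \<Rightarrow> 'a \<Rightarrow> real) \<Rightarrow> real set" where
  "eigenvalues V A = {\<mu>. \<exists>f \<in> eigenspace V A \<mu>. \<exists>x. f x \<noteq> 0}"

definition multiplicity_ev ::
    "('a \<Rightarrow> real) set \<Rightarrow> (('a \<Rightarrow> real) \<Rightarrow> 'a \<Rightarrow> real) \<Rightarrow> real \<Rightarrow> nat" where
  "multiplicity_ev V A \<mu> = fun_vs.dim (eigenspace V A \<mu>)"

definition det_nonzero ::
    "('a \<Rightarrow> real) set \<Rightarrow> (('a \<Rightarrow> real) \<Rightarrow> 'a \<Rightarrow> real) \<Rightarrow> real" where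
  "det_nonzero V A = (\<Prod>\<mu> \<in> eigenvalues V A - {0}. \<mu> ^ multiplicity_ev V A \<mu>)"

definition spectral_zeta ::
    "('a \<Rightarrow> real) set \<Rightarrow> (('a \<Rightarrow> real) \<Rightarrow> 'a \<Rightarrow> real) \<Rightarrow> complex \<Rightarrow> complex" where
  "spectral_zeta V A s =
     (\<Sum>\<^sub>\<infinity>\<mu> \<in> eigenvalues V A - {0}.
        of_nat (multiplicity_ev V A \<mu>) * complex_of_real \<mu> powr (- s))"


section \<open>The discrete torus\<close>

text \<open>
  A function on $(\mathbb{Z}/n\mathbb{Z})^m$ is a function on $\mathbb{Z}^m$ that depends only on
  the residues modulo $n$ of the coordinates; \<open>m\<close> is the cardinality of the index type
  \<^typ>\<open>'m\<close>.
\<close>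

definition discrete_torus_functions :: "nat \<Rightarrow> (('m \<Rightarrow> int) \<Rightarrow> real) set" where
  "discrete_torus_functions n =
     {f. \<forall>x y. (\<forall>i. [x i = y i] (mod int n)) \<longrightarrow> f x = f y}"

definition discrete_circle_laplacian :: "nat \<Rightarrow> (int \<Rightarrow> real) \<Rightarrow> int \<Rightarrow> real" where
  "discrete_circle_laplacian n f k =
     (real n)\<^sup>2 / (4 * pi\<^sup>2) * ((f k - f (k - 1)) + (f k - f (k + 1)))"

definition discrete_laplacian ::
    "nat \<Rightarrow> (('m::finite \<Rightarrow> int) \<Rightarrow> real) \<Rightarrow> ('m \<Rightarrow> int) \<Rightarrow> real" where
  "discrete_laplacian n f x =
     (\<Sum>i\<in>UNIV. discrete_circle_laplacian n (\<lambda>k. f (x(i := k))) (x i))"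

definition det_discrete_laplacian :: "'m::finite itself \<Rightarrow> nat \<Rightarrow> real" where
  "det_discrete_laplacian _ n =
     det_nonzero (discrete_torus_functions n :: (('m \<Rightarrow> int) \<Rightarrow> real) set)
       (discrete_laplacian n)"


section \<open>The torus and its Laplace--Beltrami operator\<close>

definition torus :: "(complex ^ 'm::finite) set" where
  "torus = {z. \<forall>i. cmod (z $ i) = 1}"

definition rotate_factor :: "'m \<Rightarrow> real \<Rightarrow> complex ^ 'm::finite \<Rightarrow> complex ^ 'm" where
  "rotate_factor i t z = (\<chi> j. if j = i then cis t * z $ j else z $ j)"

text \<open>
  Differentiation along the unit speed vector field $\partial/\partial\theta_i$ tangent to the
  \<open>i\<close>-th circle factor. These vector fields form a global orthonormal commuting frame of the
  torus, so that the non-negative Laplace--Beltrami operator is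
  $-\sum_i \partial^2/\partial\theta_i^2$.
\<close>

definition angular_deriv ::
    "'m \<Rightarrow> (complex ^ 'm::finite \<Rightarrow> real) \<Rightarrow> complex ^ 'm \<Rightarrow> real" where
  "angular_deriv i f z = deriv (\<lambda>t. f (rotate_factor i t z)) 0"

primrec Ck_torus :: "nat \<Rightarrow> (complex ^ 'm::finite \<Rightarrow> real) \<Rightarrow> bool" where
  "Ck_torus 0 f \<longleftrightarrow> continuous_on torus f"
| "Ck_torus (Suc k) f \<longleftrightarrow>
     continuous_on torus f \<and>
     (\<forall>i. (\<forall>z\<in>torus. (\<lambda>t::real. f (rotate_factor i t z)) differentiable (at 0)) \<and>
          Ck_torus k (angular_deriv i f))"

text \<open>
  Functions on the torus are extended by zero to the ambient space, so that equality of functions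
  on the torus is equality in HOL; \<^const>\<open>angular_deriv\<close> respects this convention.
\<close>

definition smooth_torus_functions :: "(complex ^ 'm::finite \<Rightarrow> real) set" where
  "smooth_torus_functions = {f. (\<forall>z. z \<notin> torus \<longrightarrow> f z = 0) \<and> (\<forall>k. Ck_torus k f)}"

definition laplace_beltrami ::
    "(complex ^ 'm::finite \<Rightarrow> real) \<Rightarrow> complex ^ 'm \<Rightarrow> real" where
  "laplace_beltrami f z = - (\<Sum>i\<in>UNIV. angular_deriv i (angular_deriv i f) z)"

definition torus_zeta :: "'m::finite itself \<Rightarrow> complex \<Rightarrow> complex" where
  "torus_zeta _ s =
     spectral_zeta (smooth_torus_functions :: (complex ^ 'm \<Rightarrow> real) set) laplace_beltrami s"

definition torus_zeta_continuation :: "'m::finite itself \<Rightarrow> (complex \<Rightarrow> complex) \<Rightarrow> bool" where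
  "torus_zeta_continuation T Z \<longleftrightarrow>
     Z meromorphic_on UNIV \<and> Z analytic_on {0} \<and>
     (\<forall>s. Re s > real CARD('m) / 2 \<longrightarrow> Z s = torus_zeta T s)"

text \<open>
  Two continuations agree near \<open>0\<close> by the identity theorem, so the value below does not depend
  on the choice made.
\<close>

definition log_det_zeta_torus :: "'m::finite itself \<Rightarrow> complex" where
  "log_det_zeta_torus T = - deriv (SOME Z. torus_zeta_continuation T Z) 0"


section \<open>Regularized limits\<close>

text \<open>
  \<open>f\<close> has an asymptotic expansion of the required form with \<open>a\<^sub>0\<^sub>0 = L\<close>. The coefficients
  and exponents are complex, and \<open>\<alpha> 0\<close> plays no role.
\<close>

definition has_regularized_limit :: "(nat \<Rightarrow> complex) \<Rightarrow> complex \<Rightarrow> bool" where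
  "has_regularized_limit f L \<longleftrightarrow>
     (\<exists>(N::nat) (M :: nat \<Rightarrow> nat) (\<alpha> :: nat \<Rightarrow> complex) (a :: nat \<Rightarrow> nat \<Rightarrow> complex).
        N \<ge> 1 \<and>
        (\<forall>j\<in>{1..N}. \<alpha> j \<noteq> 0) \<and>
        (\<forall>i\<in>{1..N}. \<forall>j\<in>{1..N}. i \<le> j \<longrightarrow> Re (\<alpha> j) \<le> Re (\<alpha> i)) \<and>
        Re (\<alpha> N) < 0 \<and>
        (\<lambda>n. f n
            - ((\<Sum>j = 1..<N. \<Sum>k = 0..M j.
                  a j k * of_nat n powr \<alpha> j * of_real (ln (real n)) ^ k)
               + (\<Sum>k = 0..M 0. a 0 k * of_real (ln (real n)) ^ k)))
          \<in> o(\<lambda>n. of_nat n powr \<alpha> N * of_real (ln (real n)) ^ M N) \<and>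
        L = a 0 0)"

end

(*
  Let theta_n and theta be the heat traces of the discrete and of the continuous circle; the heat
  traces of the tori are their m-th powers.  Since
    ln x + gamma = int_0^1 (1 - e^(-x t)) dt/t - int_1^oo e^(-x t) dt/t,
  the logarithm of the discrete determinant is an integral of theta_n^m.  Subtracting the same
  expression for the infinite lattice, whose heat trace per n sites is n w(n^2 t / (4 pi^2)), removes
  everything that grows: by scaling, that expression equals n^m (const + ln (n^2 / (4 pi^2))).  What
  remains converges, with error O(1/n), to an integral of theta^m with its small-time singularity
  (pi/t)^(m/2) subtracted.  The Mellin transform of theta^m continues the spectral zeta function, and
  its derivative at 0 is the same integral.

  No Poisson summation is used.  The difference of theta_n and n w is an aliasing error, which is
  beyond all orders for small t, and theta differs from theta_n, as sqrt (pi/t) does from n w, by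
  O(n^-2 t^-2); letting n grow with 1/t gives theta(t) = sqrt (pi/t) + O(t^p) for every p.
*)
theory Submission
  imports Defs "HOL-Probability.Probability" "HOL-Real_Asymp.Real_Asymp"
begin

section \<open>The spectrum of the discrete torus\<close>

text \<open>The limit under the integral is obstructed at small t: the Gaussian comparison loses
  powers of 1/t, more of them as m grows, and is not uniform in n. It is used where n is large
  against a power of 1/t; elsewhere the aliasing error and theta - sqrt (pi/t) are negligible
  separately. The constants match as follows. Each of the n^m - 1 non-zero eigenvalues brings one
  Euler constant; n^m of them join the growing term, and the one left over meets the derivative of
  1/Gamma at 1. The lattice is subtracted on both sides of the cut t = 1, but (pi/t)^(m/2) is
  subtracted from theta^m only below it. The integral of (pi/t)^(m/2) dt/t over t >= 1, which is 2
  pi^(m/2) / m, is therefore left over; it is minus the value at s = 0 of the pole term pi^(m/2) /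
  (s - m/2). All growing terms carry the factor n^m with m >= 1, so neither the lattice constant nor
  ln (4 pi^2) touches the regularized limit. Multiplicities are dimensions of eigenspaces, so both
  spectra require completeness of the Fourier system and not only eigenfunctions.\<close>

lemma sum_scale_fun_apply:
  "(\<Sum>k\<in>F. scale_fun (u k) (e k)) x = (\<Sum>k\<in>F. u k * e k x)"
  by (induction F rule: infinite_finite_induct) (auto simp: scale_fun_def)

text \<open>Independence is demanded of the indexed family, not of its range: equal members at
  different indices are thereby excluded, and the dimension of an eigenspace counts indices. Only
  finite linear combinations occur, so the lemma serves the finite grid and the infinite lattice of
  frequencies alike.\<close>

lemma spectrum_of_independent_system:
  fixes e :: "'k \<Rightarrow> 'a \<Rightarrow> real" and lam :: "'k \<Rightarrow> real"
  assumes eigen: "\<And>k. k \<in> K \<Longrightarrow> e k \<in> eigenspace V A (lam k)"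
    and indep: "\<And>F u. finite F \<Longrightarrow> F \<subseteq> K \<Longrightarrow> \<forall>x. (\<Sum>k\<in>F. u k * e k x) = 0 \<Longrightarrow> \<forall>k\<in>F. u k = 0"
    and fin: "\<And>\<mu>. finite {k \<in> K. lam k = \<mu>}"
    and span: "\<And>\<mu> f. f \<in> eigenspace V A \<mu> \<Longrightarrow> 
        \<exists>u. \<forall>x. f x = (\<Sum>k\<in>{k \<in> K. lam k = \<mu>}. u k * e k x)"
  shows "eigenvalues V A = lam ` K"
    and "multiplicity_ev V A \<mu> = card {k \<in> K. lam k = \<mu>}"
proof -
  have nz: "\<exists>x. e k x \<noteq> 0" if "k \<in> K" for k
    using indep[of "{k}" "\<lambda>_. 1"] that by auto
  show "eigenvalues V A = lam ` K"
  proof (intro equalityI subsetI)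
    fix \<mu> assume "\<mu> \<in> eigenvalues V A"
    then obtain f x where f: "f \<in> eigenspace V A \<mu>" "f x \<noteq> 0"
      by (auto simp: eigenvalues_def)
    then have "{k \<in> K. lam k = \<mu>} \<noteq> {}"
      using span[OF f(1)] by (metis (no_types, lifting) sum.empty)
    then show "\<mu> \<in> lam ` K" by auto
  next
    fix \<mu> assume "\<mu> \<in> lam ` K"
    then obtain k where k: "k \<in> K" "\<mu> = lam k" by auto
    then show "\<mu> \<in> eigenvalues V A"
      using eigen[OF k(1)] nz[OF k(1)] unfolding eigenvalues_def mem_Collect_eq by (intro bexI) simp_all
  qed
  let ?S = "{k \<in> K. lam k = \<mu>}"
  have inj: "inj_on e K"
  proof (rule inj_onI, rule ccontr)
    fix k l assume kl: "k \<in> K" "l \<in> K" "e k = e l" "k \<noteq> l"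
    have "(\<Sum>j\<in>{k,l}. (if j = k then 1 else -1) * e j x) = 0" for x
      using kl(4) fun_cong[OF kl(3), of x] by simp
    with indep[of "{k,l}" "\<lambda>j. if j = k then 1 else -1"] kl(1,2) show False by simp
  qed
  then have injS: "inj_on e ?S" by (rule inj_on_subset) auto
  have "fun_vs.independent (e ` ?S)"
  proof -
    have "u v = 0" if "(\<Sum>v\<in>e ` ?S. scale_fun (u v) v) = 0" "v \<in> e ` ?S" for u v
    proof -
      from that(2) obtain k where k: "k \<in> ?S" "v = e k" by auto
      have "(\<Sum>k\<in>?S. u (e k) * e k x) = 0" for x
        using fun_cong[OF that(1), of x] 
        by (subst (asm) sum.reindex[OF injS]) (simp add: sum_scale_fun_apply o_def)
      with indep[of ?S "\<lambda>k. u (e k)"] fin have "\<forall>k\<in>?S. u (e k) = 0" by auto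
      then show ?thesis using k by auto
    qed
    then show ?thesis
      using fun_vs.dependent_finite[OF finite_imageI[OF fin[of \<mu>], of e]] by meson
  qed
  moreover have "fun_vs.span (e ` ?S) = fun_vs.span (eigenspace V A \<mu>)"
  proof (rule antisym)
    show "fun_vs.span (e ` ?S) \<subseteq> fun_vs.span (eigenspace V A \<mu>)"
      using eigen by (intro fun_vs.span_mono) auto
    have "eigenspace V A \<mu> \<subseteq> fun_vs.span (e ` ?S)"
    proof
      fix f assume "f \<in> eigenspace V A \<mu>"
      from span[OF this] obtain u where "\<And>x. f x = (\<Sum>k\<in>?S. u k * e k x)" by auto
      then have "f = (\<Sum>k\<in>?S. scale_fun (u k) (e k))"
        by (auto simp: fun_eq_iff sum_scale_fun_apply)
      moreover have "(\<Sum>k\<in>?S. scale_fun (u k) (e k)) \<in> fun_vs.span (e ` ?S)"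
        by (rule fun_vs.span_sum, rule fun_vs.span_scale, rule fun_vs.span_base) auto
      ultimately show "f \<in> fun_vs.span (e ` ?S)" by (simp only:)
    qed
    then show "fun_vs.span (eigenspace V A \<mu>) \<subseteq> fun_vs.span (e ` ?S)"
      by (intro fun_vs.span_minimal fun_vs.subspace_span)
  qed
  ultimately show "multiplicity_ev V A \<mu> = card ?S"
    unfolding multiplicity_ev_def card_image[OF injS, symmetric] by (intro fun_vs.dim_eq_card) simp_all
qed

text \<open>
  The functions \<open>cas (k \<cdot> x)\<close>, with \<open>k\<close> running over all frequencies, form a real orthogonal
  eigenbasis; no frequency has to be paired with its negative.
\<close>

definition cas :: "real \<Rightarrow> real" where "cas x = cos x + sin x"

text \<open>Over full periods the sine of the sum totals zero, so the difference of the frequencies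
  alone decides orthogonality.\<close>

lemma cas_mult: "cas a * cas b = cos (a - b) + sin (a + b)"
  by (simp add: cas_def cos_diff sin_add algebra_simps)

definition int_dot :: "('m::finite \<Rightarrow> int) \<Rightarrow> ('m \<Rightarrow> int) \<Rightarrow> int" where
  "int_dot k x = (\<Sum>i\<in>UNIV. k i * x i)"

definition grid :: "nat \<Rightarrow> ('m \<Rightarrow> int) set" where
  "grid n = (\<Pi>\<^sub>E i\<in>UNIV. {0..<int n})"

lemma finite_grid [simp]: "finite (grid n :: ('m::finite \<Rightarrow> int) set)"
  by (simp add: grid_def finite_PiE)

lemma sum_cis_residues:
  assumes "n > 0"
  shows "(\<Sum>j\<in>{0..<int n}. cis (2 * pi * real_of_int (k * j) / n)) = (if int n dvd k then of_nat n else 0)"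
proof -
  define z where "z = cis (2 * pi * real_of_int k / n)"
  have "(\<Sum>j\<in>{0..<int n}. cis (2 * pi * real_of_int (k * j) / n)) = (\<Sum>j<n. z ^ j)"
  proof (rule sum.reindex_bij_witness[of _ int nat])
    fix j assume "j \<in> {0..<int n}"
    then have "real (nat j) = real_of_int j" by simp
    then show "z ^ nat j = cis (2 * pi * real_of_int (k * j) / n)"
      unfolding z_def Complex.DeMoivre by (simp add: mult_ac)
  qed auto
  moreover have "z ^ n = 1"
  proof -
    have "z ^ n = cis (2 * pi * of_int k)"
      unfolding z_def Complex.DeMoivre using assms by simp
    then show ?thesis by (simp add: cis_multiple_2pi)
  qed
  moreover have "z = 1 \<longleftrightarrow> int n dvd k"
  proof
    assume "z = 1"
    then have "cos (2 * pi * real_of_int k / n) = 1" by (auto simp: z_def complex_eq_iff)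
    then obtain l where "2 * pi * real_of_int k / n = real_of_int l * 2 * pi"
      by (auto simp: cos_one_2pi_int)
    then have "real_of_int k = real_of_int (l * int n)" using assms by (simp add: field_simps)
    then have "k = l * int n" by linarith
    then show "int n dvd k" by simp
  next
    assume "int n dvd k"
    then obtain l where "k = int n * l" by auto
    then have "z = cis (2 * pi * of_int l)" using assms by (simp add: z_def mult.assoc)
    also have "\<dots> = 1" by (rule cis_multiple_2pi) simp
    finally show "z = 1" .
  qed
  ultimately show ?thesis
    by (auto simp: geometric_sum)
qed

lemma prod_cis: "finite I \<Longrightarrow> (\<Prod>i\<in>I. cis (f i)) = cis (\<Sum>i\<in>I. f i)"
  by (induction I rule: finite_induct) (auto simp: cis_mult)

lemma sum_cis_grid:
  fixes k :: "'m::finite \<Rightarrow> int"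
  assumes "n > 0"
  shows "(\<Sum>x\<in>grid n. cis (2 * pi * real_of_int (int_dot k x) / n)) 
         = (if \<forall>i. int n dvd k i then of_nat n ^ CARD('m) else 0)"
proof -
  have "(\<Sum>x\<in>grid n. cis (2 * pi * real_of_int (int_dot k x) / n))
      = (\<Sum>x\<in>grid n. \<Prod>i\<in>UNIV. cis (2 * pi * real_of_int (k i * x i) / n))"
    unfolding int_dot_def by (simp add: prod_cis sum_divide_distrib sum_distrib_left)
  also have "\<dots> = (\<Prod>i\<in>UNIV. \<Sum>j\<in>{0..<int n}. cis (2 * pi * real_of_int (k i * j) / n))"
    unfolding grid_def by (subst prod_sum_PiE) auto
  also have "\<dots> = (\<Prod>i\<in>UNIV. if int n dvd k i then of_nat n else 0)"
    by (simp only: sum_cis_residues[OF assms])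
  also have "\<dots> = (if \<forall>i. int n dvd k i then of_nat n ^ CARD('m) else 0)"
    by (auto)
  finally show ?thesis .
qed

text \<open>The kernel of the discrete Hartley transform. It is real and symmetric in frequency and
  position, so the transform is its own inverse up to the factor
  \<open>real n ^ CARD('m)\<close>.\<close>

definition hartley :: "nat \<Rightarrow> ('m::finite \<Rightarrow> int) \<Rightarrow> ('m \<Rightarrow> int) \<Rightarrow> real" where
  "hartley n k x = cas (2 * pi * real_of_int (int_dot k x) / n)"

definition disc_eigenvalue :: "nat \<Rightarrow> ('m::finite \<Rightarrow> int) \<Rightarrow> real" where
  "disc_eigenvalue n k = (\<Sum>i\<in>UNIV. (real n)\<^sup>2 / pi\<^sup>2 * (sin (pi * real_of_int (k i) / n))\<^sup>2)"

lemma int_dot_commute: "int_dot k x = int_dot x k"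
  by (simp add: int_dot_def mult.commute)

lemma int_dot_diff_left: "int_dot (\<lambda>i. k i - l i) x = int_dot k x - int_dot l x"
  by (simp add: int_dot_def left_diff_distrib sum_subtractf)

lemma int_dot_add_left: "int_dot (\<lambda>i. k i + l i) x = int_dot k x + int_dot l x"
  by (simp add: int_dot_def distrib_right sum.distrib)

lemma int_dot_upd: "int_dot k (x(i := j)) = int_dot k x + k i * (j - x i)"
proof -
  have "int_dot k (x(i := j)) - int_dot k x = (\<Sum>l\<in>UNIV. if l = i then k i * (j - x i) else 0)"
    unfolding int_dot_def sum_subtractf[symmetric] by (intro sum.cong) (auto simp: algebra_simps)
  then show ?thesis by simp
qed

lemma hartley_commute: "hartley n k x = hartley n x k"
  by (simp add: hartley_def int_dot_commute)

text \<open>Formulated modulo \<open>n\<close> for arbitrary integer vectors, because in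
  \<open>hartley_expansion\<close> one of the two arguments is a point that may lie outside the
  grid.\<close>

lemma hartley_orthogonal:
  fixes k l :: "'m::finite \<Rightarrow> int"
  assumes "n > 0"
  shows "(\<Sum>x\<in>grid n. hartley n k x * hartley n l x) = 
     (if \<forall>i. [k i = l i] (mod int n) then real n ^ CARD('m) else 0)"
proof -
  define W where "W k x = cis (2 * pi * real_of_int (int_dot k x) / n)" for k x :: "'m \<Rightarrow> int"
  have "hartley n k x * hartley n l x = Re (W (\<lambda>i. k i - l i) x) + Im (W (\<lambda>i. k i + l i) x)" for x
    by (simp add: hartley_def cas_mult W_def int_dot_diff_left int_dot_add_left diff_divide_distrib add_divide_distrib
        right_diff_distrib distrib_left)
  then have "(\<Sum>x\<in>grid n. hartley n k x * hartley n l x)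
      = Re (\<Sum>x\<in>grid n. W (\<lambda>i. k i - l i) x) + Im (\<Sum>x\<in>grid n. W (\<lambda>i. k i + l i) x)"
    by (simp add: sum.distrib)
  \<comment> \<open>The total of the sine parts is the imaginary part of a real number in either
    case of \<open>sum_cis_grid\<close>.\<close>
  moreover have "Im (of_nat n ^ CARD('m)) = 0"
    by (simp flip: of_nat_power)
  moreover have "Re (of_nat n ^ CARD('m)) = real n ^ CARD('m)"
    by (simp flip: of_nat_power)
  ultimately show ?thesis
    unfolding W_def sum_cis_grid[OF assms] by (simp add: cong_iff_dvd_diff)
qed

lemma grid_cong_iff:
  assumes "k \<in> grid n" "l \<in> grid n"
  shows "(\<forall>i. [k i = l i] (mod int n)) \<longleftrightarrow> k = l"
proof
  assume *: "\<forall>i. [k i = l i] (mod int n)"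
  have "k i = l i" for i
  proof -
    have "k i \<in> {0..<int n}" "l i \<in> {0..<int n}" 
      using assms by (auto simp: grid_def PiE_iff)
    with *[rule_format, of i] show ?thesis by (simp add: cong_def)
  qed
  then show "k = l" by auto
qed auto

lemma hartley_orthogonal_grid:
  fixes k l :: "'m::finite \<Rightarrow> int"
  assumes "n > 0" "k \<in> grid n" "l \<in> grid n"
  shows "(\<Sum>x\<in>grid n. hartley n k x * hartley n l x) = (if k = l then real n ^ CARD('m) else 0)"
  using hartley_orthogonal[OF assms(1), of k l] grid_cong_iff[OF assms(2,3)] by simp

lemma hartley_independent:
  fixes u :: "('m::finite \<Rightarrow> int) \<Rightarrow> real"
  assumes "n > 0" "F \<subseteq> grid n" "\<And>x. (\<Sum>k\<in>F. u k * hartley n k x) = 0" "l \<in> F"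
  shows "u l = 0"
proof -
  have finF: "finite F" using assms(2) finite_subset finite_grid by blast
  have "0 = (\<Sum>x\<in>grid n. (\<Sum>k\<in>F. u k * hartley n k x) * hartley n l x)"
    using assms(3) by simp
  also have "\<dots> = (\<Sum>k\<in>F. u k * (\<Sum>x\<in>grid n. hartley n k x * hartley n l x))"
    by (simp add: sum_distrib_left sum_distrib_right mult.assoc sum.swap[of _ F])
  also have "\<dots> = (\<Sum>k\<in>F. if k = l then u k * real n ^ CARD('m) else 0)"
    using assms by (intro sum.cong refl) (auto simp: hartley_orthogonal_grid subset_iff)
  also have "\<dots> = u l * real n ^ CARD('m)" using finF assms(4) by simp
  finally show ?thesis using assms(1) by simp
qed

text \<open>Completeness is orthogonality with the roles of frequency and position exchanged, which
  the symmetry of the kernel permits.\<close>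

lemma hartley_expansion:
  fixes f :: "('m::finite \<Rightarrow> int) \<Rightarrow> real"
  assumes "n > 0" "f \<in> discrete_torus_functions n"
  shows "f x = (\<Sum>k\<in>grid n. ((\<Sum>y\<in>grid n. f y * hartley n k y) / real n ^ CARD('m)) * hartley n k x)"
proof -
  define x' where "x' = (\<lambda>i. x i mod int n)"
  have x': "x' \<in> grid n" using assms(1) by (auto simp: x'_def grid_def)
  have xx': "[y i = x i] (mod int n) \<longleftrightarrow> [y i = x' i] (mod int n)" for y i
    by (simp add: x'_def cong_def)
  have fx: "f x = f x'" 
    using assms(2) by (auto simp: discrete_torus_functions_def x'_def cong_def)
  have "(\<Sum>k\<in>grid n. (\<Sum>y\<in>grid n. f y * hartley n k y) * hartley n k x)
     = (\<Sum>y\<in>grid n. f y * (\<Sum>k\<in>grid n. hartley n y k * hartley n x k))"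
    unfolding sum_distrib_left sum_distrib_right
    by (subst sum.swap) (intro sum.cong refl, simp add: mult_ac hartley_commute)
  also have "\<dots> = (\<Sum>y\<in>grid n. if y = x' then f y * real n ^ CARD('m) else 0)"
    using assms x' by (intro sum.cong refl) (auto simp: hartley_orthogonal xx' grid_cong_iff)
  also have "\<dots> = f x * real n ^ CARD('m)" using x' fx by simp
  finally show ?thesis using assms(1) 
    by (simp add: field_simps flip: sum_divide_distrib sum_distrib_left)
qed

lemma hartley_in_torus_functions:
  assumes "n > 0" shows "hartley n k \<in> discrete_torus_functions n"
  unfolding discrete_torus_functions_def
proof safe
  fix x y :: "'a \<Rightarrow> int"
  assume "\<forall>i. [x i = y i] (mod int n)"
  then have "int n dvd x i - y i" for i by (simp add: cong_iff_dvd_diff)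
  then have "int n dvd int_dot (\<lambda>i. x i - y i) k" unfolding int_dot_def
    by (intro dvd_sum) (auto intro: dvd_mult2)
  then obtain d where "int_dot x k - int_dot y k = int n * d" by (auto simp: int_dot_diff_left)
  then have "int_dot k x = int_dot k y + int n * d" by (simp add: int_dot_commute)
  then have *: "2 * pi * real_of_int (int_dot k x) / n = 2 * pi * real_of_int (int_dot k y) / n + 2 * pi * of_int d"
    using assms by (simp add: field_simps)
  show "hartley n k x = hartley n k y"
    unfolding hartley_def * cas_def by (simp add: cos_add sin_add)
qed

lemma hartley_eigenfunction:
  assumes "n > 0"
  shows "discrete_laplacian n (hartley n k) x = disc_eigenvalue n k * hartley n k x"
proof -
  have "discrete_circle_laplacian n (\<lambda>j. hartley n k (x(i := j))) (x i)
     = (real n)\<^sup>2 / pi\<^sup>2 * (sin (pi * real_of_int (k i) / n))\<^sup>2 * hartley n k x" for i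
  proof -
    define a where "a = 2 * pi * real_of_int (int_dot k x) / n"
    define b where "b = pi * real_of_int (k i) / n"
    have b2: "2 * b = 2 * pi * real_of_int (k i) / n" by (simp add: b_def)
    have 1: "hartley n k x = cas a" "hartley n k (x(i := x i - 1)) = cas (a - 2 * b)" 
        "hartley n k (x(i := x i + 1)) = cas (a + 2 * b)"
      unfolding b2
      by (simp_all add: hartley_def int_dot_upd a_def diff_divide_distrib add_divide_distrib
        right_diff_distrib distrib_left)
    have "(cas a - cas (a - 2 * b)) + (cas a - cas (a + 2 * b)) = cas a * (2 - 2 * cos (2 * b))"
      by (simp add: cas_def cos_add sin_add cos_diff sin_diff algebra_simps)
    also have "\<dots> = 4 * (sin b)\<^sup>2 * cas a" by (simp add: cos_double_sin)
    finally show ?thesis unfolding discrete_circle_laplacian_def 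
      by (simp add: 1 b_def [symmetric])
  qed
  then show ?thesis
    by (simp add: discrete_laplacian_def disc_eigenvalue_def sum_distrib_right)
qed

lemma discrete_laplacian_sum:
  "discrete_laplacian n (\<lambda>x. \<Sum>k\<in>F. a k * h k x) x = (\<Sum>k\<in>F. a k * discrete_laplacian n (h k) x)"
proof -
  have *: "discrete_circle_laplacian n (\<lambda>j. \<Sum>k\<in>F. a k * g k j) y 
      = (\<Sum>k\<in>F. a k * discrete_circle_laplacian n (g k) y)" for g :: "'b \<Rightarrow> int \<Rightarrow> real" and y
    unfolding discrete_circle_laplacian_def sum_subtractf[symmetric] sum.distrib[symmetric] sum_distrib_left
    by (intro sum.cong refl) (simp add: algebra_simps)
  show ?thesis unfolding discrete_laplacian_def * sum_distrib_left by (rule sum.swap)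
qed

lemma det_nonzero_eq_prod:
  fixes lam :: "'k \<Rightarrow> real"
  assumes "finite K" "eigenvalues V A = lam ` K" "\<And>\<mu>. multiplicity_ev V A \<mu> = card {k \<in> K. lam k = \<mu>}"
  shows "det_nonzero V A = (\<Prod>k\<in>{k\<in>K. lam k \<noteq> 0}. lam k)"
proof -
  have "det_nonzero V A = (\<Prod>\<mu>\<in>lam ` {k\<in>K. lam k \<noteq> 0}. \<Prod>k\<in>{k \<in> {k\<in>K. lam k \<noteq> 0}. lam k = \<mu>}. lam k)"
    unfolding det_nonzero_def assms
    by (intro prod.cong) (auto intro!: arg_cong2[where f = power] arg_cong[where f = card])
  also have "\<dots> = (\<Prod>k\<in>{k\<in>K. lam k \<noteq> 0}. lam k)"
    using assms(1) by (intro prod.image_gen[symmetric]) auto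
  finally show ?thesis .
qed

lemma disc_eigenvalue_pos:
  fixes k :: "'m::finite \<Rightarrow> int"
  assumes "n > 0" "k \<in> grid n" "k \<noteq> (\<lambda>_. 0)"
  shows "disc_eigenvalue n k > 0"
proof -
  from assms(3) obtain i where i: "k i \<noteq> 0" by auto
  have "k i \<in> {0..<int n}" using assms(2) by (auto simp: grid_def PiE_iff)
  with i have "0 < real_of_int (k i)" "real_of_int (k i) < n" by auto
  then have "0 < pi * real_of_int (k i) / n" "pi * real_of_int (k i) / n < pi" using assms(1)
    by (auto simp: field_simps)
  then have "sin (pi * real_of_int (k i) / n) > 0" by (rule sin_gt_zero)
  then show ?thesis unfolding disc_eigenvalue_def using assms(1)
    by (intro sum_pos2[of _ i]) auto
qed

theorem det_discrete_laplacian_eq: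
  assumes "n > 0"
  shows "det_discrete_laplacian TYPE('m::finite) n = 
         (\<Prod>k\<in>grid n - {\<lambda>_. 0}. disc_eigenvalue n (k :: 'm \<Rightarrow> int))"
proof -
  let ?V = "discrete_torus_functions n :: (('m \<Rightarrow> int) \<Rightarrow> real) set"
  let ?A = "discrete_laplacian n :: (('m \<Rightarrow> int) \<Rightarrow> real) \<Rightarrow> _"
  have span: "\<exists>u. \<forall>x. f x = (\<Sum>k\<in>{k \<in> grid n. disc_eigenvalue n k = \<mu>}. u k * hartley n k x)"
    if f: "f \<in> eigenspace ?V ?A \<mu>" for \<mu> f
  proof -
    from f have fV: "f \<in> ?V" and Af: "?A f = scale_fun \<mu> f" by (auto simp: eigenspace_def)
    define u where "u k = (\<Sum>y\<in>grid n. f y * hartley n k y) / real n ^ CARD('m)" for k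
    have fu: "f = (\<lambda>x. \<Sum>k\<in>grid n. u k * hartley n k x)"
      unfolding u_def by (rule ext) (rule hartley_expansion[OF assms fV])
    \<comment> \<open>The operator applied to the expansion of \<open>f\<close>, minus \<mu> times
      the expansion. Independence then leaves only frequencies with eigenvalue \<mu>.\<close>
    have "(\<Sum>k\<in>grid n. u k * (disc_eigenvalue n k - \<mu>) * hartley n k x) = 0" for x
    proof -
      have "?A f x = (\<Sum>k\<in>grid n. u k * (disc_eigenvalue n k * hartley n k x))"
        by (subst fu, subst discrete_laplacian_sum) (simp add: hartley_eigenfunction assms)
      moreover have "?A f x = \<mu> * (\<Sum>k\<in>grid n. u k * hartley n k x)"
        using fun_cong[OF Af, of x] fun_cong[OF fu, of x] by (simp add: scale_fun_def)
      ultimately show ?thesis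
        by (simp add: algebra_simps sum_subtractf sum_distrib_left)
    qed
    from hartley_independent[OF assms order.refl this]
    have u0: "u k = 0 \<or> disc_eigenvalue n k = \<mu>" if "k \<in> grid n" for k using that by fastforce
    have "f x = (\<Sum>k\<in>{k \<in> grid n. disc_eigenvalue n k = \<mu>}. u k * hartley n k x)" for x
      unfolding fun_cong[OF fu, of x] using u0 by (intro sum.mono_neutral_right) auto
    then show ?thesis by blast
  qed
  have eig: "hartley n k \<in> eigenspace ?V ?A (disc_eigenvalue n k)" if "k \<in> grid n" for k
    by (simp add: eigenspace_def hartley_in_torus_functions assms hartley_eigenfunction scale_fun_def fun_eq_iff)
  have indep: "\<forall>k\<in>F. u k = 0" if "finite F" "F \<subseteq> grid n" "\<forall>x. (\<Sum>k\<in>F. u k * hartley n k x) = 0"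
    for F and u :: "('m \<Rightarrow> int) \<Rightarrow> real"
    using hartley_independent[OF assms that(2)] that(3) by blast
  have fin: "finite {k :: 'm \<Rightarrow> int. k \<in> grid n \<and> disc_eigenvalue n k = \<mu>}" for \<mu> by simp
  note spec = spectrum_of_independent_system[where e = "hartley n :: ('m \<Rightarrow> int) \<Rightarrow> _" and K = "grid n :: ('m \<Rightarrow> int) set"
    and lam = "disc_eigenvalue n :: ('m \<Rightarrow> int) \<Rightarrow> _" and V = ?V and A = ?A, OF eig indep fin span]
    have sys1: "eigenvalues ?V ?A = disc_eigenvalue n ` (grid n :: ('m \<Rightarrow> int) set)"
    by (rule spec(1))
  have sys2: "multiplicity_ev ?V ?A \<mu> = card {k :: 'm \<Rightarrow> int. k \<in> grid n \<and> disc_eigenvalue n k = \<mu>}" for \<mu>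
    by (rule spec(2))
  have "{k \<in> grid n. disc_eigenvalue n k \<noteq> 0} = grid n - {\<lambda>_::'m. 0}"
    using disc_eigenvalue_pos[OF assms] by (force simp: disc_eigenvalue_def)
  with det_nonzero_eq_prod[OF _ sys1 sys2] show ?thesis
    by (simp add: det_discrete_laplacian_def)
qed

section \<open>The spectrum of the torus\<close>

definition torus_char :: "('m::finite \<Rightarrow> int) \<Rightarrow> complex ^ 'm \<Rightarrow> complex" where
  "torus_char k z = (\<Prod>i\<in>UNIV. vec_nth z i powi k i)"

text \<open>With free coefficients for cosine and sine, an angular derivative only turns the pair
  \<open>(a, b)\<close> and scales it by \<open>k i\<close>, so smoothness of every order follows by
  induction within the family. The value 0 off the torus follows the convention of
  \<open>smooth_torus_functions\<close>.\<close>

definition torus_trig :: "real \<Rightarrow> real \<Rightarrow> ('m::finite \<Rightarrow> int) \<Rightarrow> complex ^ 'm \<Rightarrow> real" where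
  "torus_trig a b k z = (if z \<in> torus then a * Re (torus_char k z) + b * Im (torus_char k z) else 0)"

lemma torus_nth: "z \<in> torus \<Longrightarrow> cmod (vec_nth z i) = 1"
  by (simp add: torus_def)

lemma torus_nth_nz: "z \<in> torus \<Longrightarrow> vec_nth z i \<noteq> 0"
  using torus_nth[of z i] by auto

lemma rotate_factor_in_torus [simp]: "rotate_factor i t z \<in> torus \<longleftrightarrow> z \<in> torus"
  by (auto simp: torus_def rotate_factor_def norm_mult split: if_splits)

lemma torus_char_rotate: "torus_char k (rotate_factor i t z) = cis (k i * t) * torus_char k z"
proof -
  have "torus_char k (rotate_factor i t z) = 
      (\<Prod>j\<in>UNIV. (if j = i then cis t powi k i else 1) * vec_nth z j powi k j)"
    unfolding torus_char_def rotate_factor_def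
    by (intro prod.cong refl) (auto simp: power_int_mult_distrib)
  then show ?thesis
    by (simp add: prod.distrib torus_char_def cis_power_int)
qed

lemma torus_trig_rotate:
  "torus_trig a b k (rotate_factor i t z) = 
    torus_trig (a * cos (k i * t) + b * sin (k i * t)) (b * cos (k i * t) - a * sin (k i * t)) k z"
  by (simp add: torus_trig_def torus_char_rotate algebra_simps)

lemma torus_trig_deriv:
  "((\<lambda>t. torus_trig a b k (rotate_factor i t z)) has_real_derivative torus_trig (k i * b) (- (k i * a)) k z) (at 0)"
  unfolding torus_trig_rotate unfolding torus_trig_def
  by (cases "z \<in> torus") (auto intro!: derivative_eq_intros simp: algebra_simps)

lemma angular_deriv_torus_trig:
  "angular_deriv i (torus_trig a b k) = torus_trig (k i * b) (- (k i * a)) k"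
  unfolding angular_deriv_def by (rule ext) (rule DERIV_imp_deriv[OF torus_trig_deriv])

lemma continuous_on_torus_char: "continuous_on torus (torus_char k)"
  unfolding torus_char_def
  by (intro continuous_intros) (auto simp: torus_nth_nz)

lemma continuous_on_torus_trig: "continuous_on torus (torus_trig a b k)"
proof -
  have "continuous_on torus (\<lambda>z. a * Re (torus_char k z) + b * Im (torus_char k z))"
    by (intro continuous_intros continuous_on_torus_char)
  then show ?thesis
    by (rule continuous_on_cong[THEN iffD1, rotated -1]) (auto simp: torus_trig_def)
qed

lemma Ck_torus_trig: "Ck_torus j (torus_trig a b k)"
proof (induction j arbitrary: a b)
  case (Suc j)
  have "(\<lambda>t. torus_trig a b k (rotate_factor i t z)) differentiable (at 0)" for i z
    using torus_trig_deriv real_differentiable_def by blast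
  then show ?case using Suc by (simp add: continuous_on_torus_trig angular_deriv_torus_trig)
qed (simp add: continuous_on_torus_trig)

lemma torus_trig_smooth: "torus_trig a b k \<in> smooth_torus_functions"
  by (simp add: smooth_torus_functions_def Ck_torus_trig) (simp add: torus_trig_def)

definition int_normsq :: "('m::finite \<Rightarrow> int) \<Rightarrow> int" where
  "int_normsq k = (\<Sum>i\<in>UNIV. (k i)\<^sup>2)"

lemma torus_trig_scale: "torus_trig (c * a) (c * b) k z = c * torus_trig a b k z"
  by (simp add: torus_trig_def algebra_simps)

lemma laplace_beltrami_torus_trig:
  "laplace_beltrami (torus_trig a b k) z = int_normsq k * torus_trig a b k z"
proof -
  have "torus_trig (- ((k i)\<^sup>2 * a)) (- ((k i)\<^sup>2 * b)) k z = - (k i)\<^sup>2 * torus_trig a b k z" for i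
    using torus_trig_scale[of "- (k i)\<^sup>2"] by simp
  then show ?thesis
    unfolding laplace_beltrami_def angular_deriv_torus_trig int_normsq_def
    by (simp add: sum_distrib_right sum_negf power2_eq_square mult.assoc)
qed

lemma torus_char_mult: "z \<in> torus \<Longrightarrow> torus_char k z * torus_char l z = torus_char (\<lambda>i. k i + l i) z"
  by (simp add: torus_char_def power_int_add torus_nth_nz prod.distrib)

lemma norm_torus_char: "z \<in> torus \<Longrightarrow> cmod (torus_char k z) = 1"
  by (simp add: torus_char_def prod_norm [symmetric] norm_power_int torus_nth)

lemma torus_char_uminus: "z \<in> torus \<Longrightarrow> torus_char (\<lambda>i. - k i) z = cnj (torus_char k z)"
proof -
  assume z: "z \<in> torus"
  have "torus_char (\<lambda>i. - k i) z * torus_char k z = 1"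
    using z by (simp add: torus_char_mult) (simp add: torus_char_def)
  moreover have "cnj (torus_char k z) * torus_char k z = 1"
    using norm_torus_char[OF z, of k] complex_norm_square[of "torus_char k z"] by (simp add: mult.commute)
  ultimately have "torus_char (\<lambda>i. - k i) z * torus_char k z = cnj (torus_char k z) * torus_char k z"
    by simp
  moreover have "torus_char k z \<noteq> 0" using norm_torus_char[OF z, of k] by auto
  ultimately show ?thesis by simp
qed

lemma torus_char_minus: "z \<in> torus \<Longrightarrow> torus_char k z * cnj (torus_char l z) = torus_char (\<lambda>i. k i - l i) z"
  using torus_char_mult[of z k "\<lambda>i. - l i"] by (simp add: torus_char_uminus)

definition torus_cas :: "('m::finite \<Rightarrow> int) \<Rightarrow> complex ^ 'm \<Rightarrow> real" where
  "torus_cas = torus_trig 1 1"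

lemma torus_cas_mult:
  "torus_cas k z * torus_cas l z = torus_trig 1 0 (\<lambda>i. k i - l i) z + torus_trig 0 1 (\<lambda>i. k i + l i) z"
proof (cases "z \<in> torus")
  case True
  show ?thesis
    unfolding torus_cas_def torus_trig_def torus_char_minus[OF True, symmetric] torus_char_mult[OF True, symmetric]
    using True by (simp add: algebra_simps)
qed (simp add: torus_cas_def torus_trig_def)

text \<open>The cas functions of \<open>k\<close> and \<open>- k\<close> together span the cosine
  and the sine of frequency \<open>k\<close>, so one function per frequency suffices.\<close>

lemma torus_trig_cas:
  "torus_trig a b k z = (a + b) / 2 * torus_cas k z + (a - b) / 2 * torus_cas (\<lambda>i. - k i) z"
proof (cases "z \<in> torus")
  case True
  then show ?thesis
    by (simp add: torus_cas_def torus_trig_def torus_char_uminus field_simps)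
qed (simp add: torus_cas_def torus_trig_def)

section \<open>Integration over the torus in angle coordinates\<close>

definition torus_param :: "('m::finite \<Rightarrow> real) \<Rightarrow> complex ^ 'm" where
  "torus_param x = (\<chi> i. cis (x i))"

text \<open>A density instead of a restricted space keeps the whole line as the underlying space, so
  the product measure lives on the Borel sets of the function space.\<close>

definition circle_measure :: "real measure" where
  "circle_measure = density lborel (\<lambda>x. ennreal (indicator {0..2*pi} x))"

definition angle_measure :: "('m::finite \<Rightarrow> real) measure" where
  "angle_measure = Pi\<^sub>M UNIV (\<lambda>_. circle_measure)"

definition torus_integral :: "(complex ^ 'm::finite \<Rightarrow> real) \<Rightarrow> real" where
  "torus_integral f = (\<integral>x. f (torus_param x) \<partial>angle_measure)"

lemma torus_param_in_torus [simp]: "torus_param x \<in> torus"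
  by (simp add: torus_param_def torus_def)

lemma torus_param_surj:
  assumes "z \<in> torus" obtains x where "z = torus_param x" "\<And>i. x i \<in> {0..<2*pi}"
proof
  have "vec_nth z i = cis (Arg2pi (vec_nth z i))" for i
    using Arg2pi_eq[of "vec_nth z i"] torus_nth[OF assms, of i] by (simp add: cis_conv_exp)
  then show "z = torus_param (\<lambda>i. Arg2pi (vec_nth z i))"
    by (simp add: torus_param_def vec_eq_iff)
qed (use Arg2pi_ge_0 Arg2pi_lt_2pi in auto)

lemma sets_circle_measure [measurable_cong, simp]: "sets circle_measure = sets borel"
  by (simp add: circle_measure_def)

lemma space_circle_measure [simp]: "space circle_measure = UNIV"
  by (simp add: circle_measure_def)

lemma emeasure_circle_measure: "A \<in> sets borel \<Longrightarrow> emeasure circle_measure A = emeasure lborel (A \<inter> {0..2*pi})"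
  unfolding circle_measure_def
  by (subst emeasure_density) (auto simp: indicator_inter_arith nn_integral_indicator[symmetric] simp del: nn_integral_indicator
      intro!: nn_integral_cong split: split_indicator)

interpretation circle: finite_measure circle_measure
  by standard (simp add: emeasure_circle_measure)

interpretation angle: product_sigma_finite "\<lambda>_. circle_measure"
  by standard

lemma sets_angle_measure [measurable_cong, simp]: "sets (angle_measure :: ('m::finite \<Rightarrow> real) measure) = sets borel"
  unfolding angle_measure_def using sets_PiM_equal_borel[where 'a = 'm and 'b = real] 
  by (subst sets_PiM_cong[OF refl sets_circle_measure]) simp_all

lemma emeasure_angle_box: 
  "(\<And>i. A i \<in> sets borel) \<Longrightarrow> 
    emeasure angle_measure (Pi\<^sub>E UNIV A :: ('m::finite \<Rightarrow> real) set) = (\<Prod>i\<in>UNIV. emeasure lborel (A i \<inter> {0..2*pi}))"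
  unfolding angle_measure_def by (subst angle.emeasure_PiM) (auto simp: emeasure_circle_measure)

lemma space_angle_measure [simp]: "space (angle_measure :: ('m::finite \<Rightarrow> real) measure) = UNIV"
  using sets_eq_imp_space_eq[OF sets_angle_measure] by simp

interpretation angle_fin: finite_measure "angle_measure :: ('m::finite \<Rightarrow> real) measure"
proof
  have "emeasure (angle_measure :: ('m \<Rightarrow> real) measure) UNIV = (\<Prod>i\<in>(UNIV::'m set). ennreal (2 * pi))"
    using emeasure_angle_box[of "\<lambda>_. UNIV"] by (simp add: PiE_UNIV_domain)
  also have "\<dots> \<noteq> \<infinity>" by (simp add: ennreal_power flip: ennreal_mult)
  finally show "emeasure (angle_measure :: ('m \<Rightarrow> real) measure) (space angle_measure) \<noteq> \<infinity>" by simp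
qed

lemma compact_torus: "compact (torus :: (complex ^ 'm::finite) set)"
  unfolding compact_eq_bounded_closed
proof
  have "norm z \<le> real CARD('m)" if "z \<in> torus" for z :: "complex ^ 'm"
    unfolding norm_vec_def using L2_set_le_sum[of UNIV "\<lambda>i. norm (vec_nth z i)"] torus_nth[OF that] by simp
  then show "bounded (torus :: (complex ^ 'm) set)" by (auto simp: bounded_iff)
  have eq: "torus = (\<Inter>i. {z :: complex ^ 'm. cmod (vec_nth z i) = 1})" by (auto simp: torus_def)
  show "closed (torus :: (complex ^ 'm) set)"
    unfolding eq by (intro closed_INT ballI closed_Collect_eq continuous_intros)
qed

lemma continuous_torus_param: "continuous_on UNIV (torus_param :: ('m::finite \<Rightarrow> real) \<Rightarrow> _)"
  unfolding torus_param_def by (intro continuous_on_vec_lambda continuous_intros continuous_on_cis continuous_on_product_coordinates)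

lemma continuous_comp_param:
  "continuous_on torus f \<Longrightarrow> continuous_on UNIV (\<lambda>x. f (torus_param x))"
  by (rule continuous_on_compose2[OF _ continuous_torus_param]) auto

lemma integrable_torus:
  fixes f :: "complex ^ 'm::finite \<Rightarrow> real"
  assumes "continuous_on torus f"
  shows "integrable angle_measure (\<lambda>x. f (torus_param x))"
proof -
  have "compact (f ` torus)" using assms compact_torus by (rule compact_continuous_image)
  then obtain B where B: "\<And>z. z \<in> torus \<Longrightarrow> \<bar>f z\<bar> \<le> B"
    using compact_imp_bounded[of "f ` torus"] unfolding bounded_iff by auto
  have "(\<lambda>x. f (torus_param x)) \<in> borel_measurable borel"
    by (rule borel_measurable_continuous_onI[OF continuous_comp_param[OF assms]])
  then have "(\<lambda>x. f (torus_param x)) \<in> borel_measurable angle_measure"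
    by (simp cong: measurable_cong_sets)
  then show ?thesis
    by (rule angle_fin.integrable_const_bound[rotated, where B = B]) (auto simp: B)
qed


lemma torus_integral_add:
  "continuous_on torus f \<Longrightarrow> continuous_on torus g \<Longrightarrow> 
    torus_integral (\<lambda>z. f z + g z) = torus_integral f + torus_integral g"
  unfolding torus_integral_def by (intro Bochner_Integration.integral_add integrable_torus)

lemma torus_integral_cmult: "torus_integral (\<lambda>z. c * f z) = c * torus_integral f"
  by (simp add: torus_integral_def)

lemma torus_integral_sum:
  "(\<And>k. k \<in> F \<Longrightarrow> continuous_on torus (f k)) \<Longrightarrow> 
    torus_integral (\<lambda>z. \<Sum>k\<in>F. f k z) = (\<Sum>k\<in>F. torus_integral (f k))"
  unfolding torus_integral_def by (intro Bochner_Integration.integral_sum integrable_torus)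

lemma rotate_factor_param: "rotate_factor i t (torus_param x) = torus_param (x(i := x i + t))"
  by (simp add: rotate_factor_def torus_param_def vec_eq_iff cis_mult add.commute)

text \<open>Integrating over the angle \<open>i\<close> first, by Fubini, gives the difference of
  \<open>f\<close> at the angles 2 pi and 0, which are the same point. Both integration by parts and
  the orthogonality of the characters rest on this.\<close>

lemma torus_integral_deriv_0:
  fixes f h :: "complex ^ 'm::finite \<Rightarrow> real"
  assumes "continuous_on torus h"
    and deriv: "\<And>z. z \<in> torus \<Longrightarrow> ((\<lambda>t. f (rotate_factor i t z)) has_real_derivative h z) (at 0)"
  shows "torus_integral h = 0"
proof -
  have UN: "insert i (UNIV - {i}) = UNIV" by auto
  have inner: "(\<integral>y. h (torus_param (x(i := y))) \<partial>circle_measure) = 0" for x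
  proof -
    have der: "((\<lambda>y. f (torus_param (x(i := y)))) has_real_derivative h (torus_param (x(i := y)))) (at y)" for y
    proof -
      have "((\<lambda>t. f (torus_param (x(i := y + t)))) has_real_derivative h (torus_param (x(i := y)))) (at 0)"
        using deriv[of "torus_param (x(i := y))"] by (simp add: rotate_factor_param)
      then show ?thesis
        using DERIV_shift[of "\<lambda>y. f (torus_param (x(i := y)))" _ 0 y] by (simp add: add.commute)
    qed
    have upd: "continuous_on UNIV (\<lambda>y. x(i := y))"
    proof (rule continuous_on_coordinatewise_then_product)
      show "continuous_on UNIV (\<lambda>y. (x(i := y)) j)" for j by (cases "j = i") auto
    qed
    have cont: "continuous_on UNIV (\<lambda>y. h (torus_param (x(i := y))))"
      by (rule continuous_on_compose2[OF continuous_comp_param[OF assms(1)] upd]) auto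
    have "(\<integral>y. h (torus_param (x(i := y))) \<partial>circle_measure) 
        = (\<integral>y. indicator {0..2*pi} y *\<^sub>R h (torus_param (x(i := y))) \<partial>lborel)"
      unfolding circle_measure_def
      using borel_measurable_continuous_onI[OF cont]
      by (intro integral_density) auto
    also have "\<dots> = (\<integral>y. h (torus_param (x(i := y))) * indicator {0..2*pi} y \<partial>lborel)"
      by (simp add: mult.commute)
    also have "\<dots> = f (torus_param (x(i := 2*pi))) - f (torus_param (x(i := 0)))"
      using cont by (intro integral_FTC_Icc_real der) (auto simp: continuous_on_eq_continuous_at)
    also have "torus_param (x(i := 2*pi)) = torus_param (x(i := 0))"
      by (auto simp: torus_param_def vec_eq_iff complex_eq_iff)
    finally show ?thesis by (simp only: diff_self)
  qed
  have "torus_integral h = (\<integral>x. (\<integral>y. h (torus_param (x(i := y))) \<partial>circle_measure) \<partial>Pi\<^sub>M (UNIV - {i}) (\<lambda>_. circle_measure))"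
    unfolding torus_integral_def angle_measure_def
    using angle.product_integral_insert[of "UNIV - {i}" i "\<lambda>x. h (torus_param x)"] integrable_torus[OF assms(1)]
    unfolding UN angle_measure_def by simp
  then show ?thesis by (simp add: inner)
qed

section \<open>Symmetry of the Laplace-Beltrami operator and orthogonality of its
  eigenfunctions\<close>

definition torus_inner :: "(complex ^ 'm::finite \<Rightarrow> real) \<Rightarrow> (complex ^ 'm \<Rightarrow> real) \<Rightarrow> real" where
  "torus_inner f g = torus_integral (\<lambda>z. f z * g z)"

lemma torus_inner_by_parts:
  assumes "continuous_on torus f" "continuous_on torus f'" "continuous_on torus g" "continuous_on torus g'"
    and "\<And>z. z \<in> torus \<Longrightarrow> ((\<lambda>t. f (rotate_factor i t z)) has_real_derivative f' z) (at 0)"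
    and "\<And>z. z \<in> torus \<Longrightarrow> ((\<lambda>t. g (rotate_factor i t z)) has_real_derivative g' z) (at 0)"
  shows "torus_inner f' g = - torus_inner f g'"
proof -
  have rot0: "rotate_factor i 0 z = z" for z :: "complex ^ 'a"
    by (simp add: rotate_factor_def vec_eq_iff)
  have "torus_integral (\<lambda>z. f' z * g z + f z * g' z) = 0"
    by (rule torus_integral_deriv_0[of _ "\<lambda>z. f z * g z" i])
       (use assms in \<open>auto intro!: continuous_intros derivative_eq_intros simp: rot0\<close>)
  then show ?thesis
    unfolding torus_inner_def using assms by (subst (asm) torus_integral_add) (auto intro!: continuous_intros)
qed

lemma smooth_imp_continuous: "f \<in> smooth_torus_functions \<Longrightarrow> continuous_on torus f"
  by (auto simp: smooth_torus_functions_def dest: spec[of _ 0])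

lemma smooth_angular_deriv:
  assumes "f \<in> smooth_torus_functions" 
  shows "angular_deriv i f \<in> smooth_torus_functions"
    and "z \<in> torus \<Longrightarrow> ((\<lambda>t. f (rotate_factor i t z)) has_real_derivative angular_deriv i f z) (at 0)"
proof -
  have C: "Ck_torus (Suc k) f" for k using assms by (auto simp: smooth_torus_functions_def)
  have "angular_deriv i f z = 0" if "z \<notin> torus" for z
    using assms that by (simp add: angular_deriv_def smooth_torus_functions_def)
  with C show "angular_deriv i f \<in> smooth_torus_functions" by (auto simp: smooth_torus_functions_def)
  show "((\<lambda>t. f (rotate_factor i t z)) has_real_derivative angular_deriv i f z) (at 0)" if "z \<in> torus"
    using C[of 0] that unfolding angular_deriv_def by (auto simp: DERIV_deriv_iff_real_differentiable)
qed

lemma laplace_beltrami_symmetric: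
  assumes f: "f \<in> smooth_torus_functions" and g: "g \<in> smooth_torus_functions"
  shows "torus_inner (laplace_beltrami f) g = torus_inner f (laplace_beltrami g)"
proof -
  note S = smooth_angular_deriv smooth_imp_continuous
  note cf = smooth_imp_continuous[OF f] and cg = smooth_imp_continuous[OF g]
  have twice: "torus_inner (angular_deriv i (angular_deriv i f)) g = torus_inner f (angular_deriv i (angular_deriv i g))" for i
  proof -
    have "torus_inner (angular_deriv i (angular_deriv i f)) g = - torus_inner (angular_deriv i f) (angular_deriv i g)"
      by (rule torus_inner_by_parts[of _ _ _ _ i]) (intro S f g; assumption)+
    also have "\<dots> = torus_inner f (angular_deriv i (angular_deriv i g))"
      by (subst torus_inner_by_parts[of f _ _ "angular_deriv i (angular_deriv i g)" i]) (simp | intro S f g; assumption)+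
    finally show ?thesis .
  qed
  have cont: "continuous_on torus (angular_deriv i (angular_deriv i h))" if "h \<in> smooth_torus_functions" for h and i :: 'a
    by (intro S that)
  have "torus_inner (laplace_beltrami f) g = torus_integral (\<lambda>z. - 1 * (\<Sum>i\<in>UNIV. angular_deriv i (angular_deriv i f) z * g z))"
    unfolding torus_inner_def laplace_beltrami_def by (simp add: sum_distrib_right)
  also have "\<dots> = - 1 * (\<Sum>i\<in>UNIV. torus_inner (angular_deriv i (angular_deriv i f)) g)"
    unfolding torus_inner_def torus_integral_cmult
    by (subst torus_integral_sum) (auto intro!: continuous_on_mult cont cf cg f g)
  also have "\<dots> = - 1 * (\<Sum>i\<in>UNIV. torus_inner f (angular_deriv i (angular_deriv i g)))"
    by (simp only: twice)
  also have "\<dots> = torus_integral (\<lambda>z. - 1 * (\<Sum>i\<in>UNIV. f z * angular_deriv i (angular_deriv i g) z))"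
    unfolding torus_inner_def torus_integral_cmult
    by (subst torus_integral_sum) (auto intro!: continuous_on_mult cont cf cg f g)
  also have "\<dots> = torus_inner f (laplace_beltrami g)"
    unfolding torus_inner_def laplace_beltrami_def by (simp add: sum_distrib_left sum_negf)
  finally show ?thesis .
qed

lemma torus_integral_trig: 
  fixes k :: "'m::finite \<Rightarrow> int"
  shows "torus_integral (torus_trig a b k) = 
    (if k = (\<lambda>_. 0) then a * measure (angle_measure :: ('m \<Rightarrow> real) measure) UNIV else 0)"
proof (cases "k = (\<lambda>_. 0)")
  case True
  then have "torus_trig a b k (torus_param x) = a" for x by (simp add: torus_trig_def torus_char_def)
  then show ?thesis using True by (simp add: torus_integral_def)
next
  case False
  then obtain i where i: "k i \<noteq> 0" by auto
  \<comment> \<open>Since \<open>k i\<close> is non-zero, the function is itself an angular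
    derivative; the coefficients of its primitive are divided by \<open>k i\<close>.\<close>
  have "torus_integral (torus_trig a b k) = 0"
    by (rule torus_integral_deriv_0[OF continuous_on_torus_trig, of "torus_trig (- b / k i) (a / k i) k" i])
       (use torus_trig_deriv[of "- b / k i" "a / k i" k i] i in simp)
  then show ?thesis using False by simp
qed

lemma torus_inner_cas:
  fixes k l :: "'m::finite \<Rightarrow> int"
  shows "torus_inner (torus_cas k) (torus_cas l) = (if k = l then measure (angle_measure :: ('m \<Rightarrow> real) measure) UNIV else 0)"
  unfolding torus_inner_def torus_cas_mult
  by (subst torus_integral_add[OF continuous_on_torus_trig continuous_on_torus_trig]) 
     (auto simp: torus_integral_trig fun_eq_iff)

lemma measure_angle_pos: "measure (angle_measure :: ('m::finite \<Rightarrow> real) measure) UNIV > 0"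
proof -
  have "emeasure (angle_measure :: ('m \<Rightarrow> real) measure) UNIV = (\<Prod>i\<in>(UNIV::'m set). ennreal (2 * pi))"
    using emeasure_angle_box[of "\<lambda>_. UNIV"] by (simp add: PiE_UNIV_domain)
  then have "emeasure (angle_measure :: ('m \<Rightarrow> real) measure) UNIV \<noteq> 0" by simp
  then show ?thesis by (simp add: angle_fin.emeasure_eq_measure zero_less_measure_iff)
qed

text \<open>The square vanishes almost everywhere; a non-zero value would, by continuity, persist on
  an open box of angles, which has positive measure.\<close>

lemma torus_inner_self_eq_0:
  fixes f :: "complex ^ 'm::finite \<Rightarrow> real"
  assumes cont: "continuous_on torus f" and "torus_inner f f = 0" and z: "z \<in> torus"
  shows "f z = 0"
proof (rule ccontr)
  assume nz: "f z \<noteq> 0"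
  have "integrable angle_measure (\<lambda>x. f (torus_param x) * f (torus_param x))"
    by (rule integrable_torus[of "\<lambda>z. f z * f z"]) (intro continuous_intros cont)
  then have AE: "AE x in angle_measure. f (torus_param x) * f (torus_param x) = 0"
    using assms(2) unfolding torus_inner_def torus_integral_def
    by (subst (asm) integral_nonneg_eq_0_iff_AE) auto
  obtain x where x: "z = torus_param x" "\<And>i. x i \<in> {0..<2*pi}" using torus_param_surj[OF z] by blast
  define U where "U = {y. f (torus_param y) \<noteq> 0}"
  have "open U" unfolding U_def
    by (intro open_Collect_neq continuous_comp_param cont continuous_on_const)
  moreover have "x \<in> U" using nz x by (simp add: U_def)
  ultimately obtain X where X: "x \<in> (\<Pi>\<^sub>E i\<in>UNIV. X i)" "\<And>i. open (X i)" "(\<Pi>\<^sub>E i\<in>UNIV. X i) \<subseteq> U"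
    using product_topology_open_contains_basis[of "\<lambda>_. euclidean" UNIV U x] by (auto simp: open_fun_def)
  have pos: "emeasure lborel (X i \<inter> {0..2*pi}) \<noteq> 0" for i
  proof -
    have "x i \<in> X i" using X(1) by auto
    then obtain e where e: "e > 0" "\<And>y. dist y (x i) < e \<Longrightarrow> y \<in> X i" 
      using X(2)[of i] unfolding open_dist by blast
    \<comment> \<open>The interval extends from \<open>x i\<close> to the right: as
      \<open>x i < 2 * pi\<close>, it stays within the period that carries the measure and has
      positive length.\<close>
    define d where "d = min (x i + e / 2) (2 * pi)"
    have "{x i..d} \<subseteq> X i \<inter> {0..2*pi}" using e x(2)[of i] by (auto simp: dist_real_def d_def intro!: e(2))
    then have "emeasure lborel {x i..d} \<le> emeasure lborel (X i \<inter> {0..2*pi})"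
      using X(2)[of i] by (intro emeasure_mono) auto
    moreover have "x i < d" using e x(2)[of i] by (auto simp: d_def)
    ultimately show ?thesis by auto
  qed
  have "emeasure angle_measure (\<Pi>\<^sub>E i\<in>UNIV. X i) \<noteq> 0"
    using pos X(2) by (subst emeasure_angle_box) auto
  moreover have "(\<Pi>\<^sub>E i\<in>UNIV. X i) \<in> null_sets angle_measure"
  proof -
    have "AE y in angle_measure. y \<notin> U" using AE by (simp add: U_def)
    then have "U \<in> null_sets angle_measure"
      using \<open>open U\<close> by (subst AE_iff_null_sets) auto
    moreover have "(\<Pi>\<^sub>E i\<in>UNIV. X i) \<in> sets angle_measure"
      unfolding angle_measure_def using X(2) by (intro sets_PiM_I_finite) auto
    ultimately show ?thesis using X(3) by (metis null_sets_subset)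
  qed
  ultimately show False by auto
qed

section \<open>Completeness of the Fourier system by polynomial approximation\<close>

abbreviation cas_span :: "(complex ^ 'm::finite \<Rightarrow> real) set" where
  "cas_span \<equiv> fun_vs.span (range torus_cas)"

lemma torus_trig_in_span: "torus_trig a b k \<in> cas_span"
proof -
  have "torus_trig a b k = scale_fun ((a + b) / 2) (torus_cas k) + scale_fun ((a - b) / 2) (torus_cas (\<lambda>i. - k i))"
    by (auto simp: fun_eq_iff scale_fun_def torus_trig_cas)
  moreover have "\<dots> \<in> cas_span"
    by (intro fun_vs.span_add fun_vs.span_scale fun_vs.span_base rangeI)
  ultimately show ?thesis by simp
qed

text \<open>Products of generators lie in the span by \<open>torus_cas_mult\<close>; extending one
  factor at a time from the generators to the span shows that the span is an algebra.\<close>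

lemma cas_span_mult:
  assumes "f \<in> cas_span" "g \<in> cas_span"
  shows "(\<lambda>z. f z * g z) \<in> cas_span"
proof -
  have cc: "(\<lambda>z. torus_cas k z * torus_cas l z) \<in> cas_span" for k l :: "'a \<Rightarrow> int"
  proof -
    have "(\<lambda>z. torus_cas k z * torus_cas l z) = torus_trig 1 0 (\<lambda>i. k i - l i) + torus_trig 0 1 (\<lambda>i. k i + l i)"
      by (auto simp: fun_eq_iff torus_cas_mult)
    then show ?thesis by (simp add: fun_vs.span_add torus_trig_in_span)
  qed
  have sub: "fun_vs.subspace {f. (\<lambda>z. f z * g z) \<in> cas_span}" for g :: "complex ^ 'a \<Rightarrow> real"
  proof (rule fun_vs.subspaceI)
    show "0 \<in> {f. (\<lambda>z. f z * g z) \<in> cas_span}"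
      using fun_vs.span_zero[of "range torus_cas"] by (simp add: zero_fun_def)
  next
    fix x y assume "x \<in> {f. (\<lambda>z. f z * g z) \<in> cas_span}" "y \<in> {f. (\<lambda>z. f z * g z) \<in> cas_span}"
    then have "(\<lambda>z. x z * g z) + (\<lambda>z. y z * g z) \<in> cas_span"
      unfolding mem_Collect_eq by (rule fun_vs.span_add)
    moreover have "(\<lambda>z. x z * g z) + (\<lambda>z. y z * g z) = (\<lambda>z. (x + y) z * g z)"
      by (simp add: fun_eq_iff distrib_right)
    ultimately show "x + y \<in> {f. (\<lambda>z. f z * g z) \<in> cas_span}" by (simp only: mem_Collect_eq)
  next
    fix c x assume "x \<in> {f. (\<lambda>z. f z * g z) \<in> cas_span}"
    then have "scale_fun c (\<lambda>z. x z * g z) \<in> cas_span"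
      unfolding mem_Collect_eq by (rule fun_vs.span_scale)
    moreover have "scale_fun c (\<lambda>z. x z * g z) = (\<lambda>z. scale_fun c x z * g z)"
      by (simp add: fun_eq_iff scale_fun_def mult.assoc)
    ultimately show "scale_fun c x \<in> {f. (\<lambda>z. f z * g z) \<in> cas_span}" by (simp only: mem_Collect_eq)
  qed
  have one: "(\<lambda>z. torus_cas k z * g z) \<in> cas_span" if "g \<in> cas_span" for g and k :: "'a \<Rightarrow> int"
  proof -
    have "g \<in> {f. (\<lambda>z. f z * torus_cas k z) \<in> cas_span}"
      by (rule subsetD[OF fun_vs.span_minimal[OF _ sub[of "torus_cas k"]] that]) (use cc in auto)
    then show ?thesis by (simp add: mult.commute)
  qed
  have "f \<in> {f. (\<lambda>z. f z * g z) \<in> cas_span}"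
    by (rule subsetD[OF fun_vs.span_minimal[OF _ sub[of g]] assms(1)]) (use one[OF assms(2)] in auto)
  then show ?thesis by simp
qed

text \<open>The real and imaginary parts of the coordinates are trigonometric functions of unit
  frequency. Linear maps are combinations of these, and the span is closed under products.\<close>

lemma poly_in_cas_span:
  fixes p :: "complex ^ 'm::finite \<Rightarrow> real"
  assumes "real_polynomial_function p"
  shows "(\<lambda>z. if z \<in> torus then p z else 0) \<in> cas_span"
  using assms
proof (induction p rule: real_polynomial_function.induct)
  case (linear f)
  have coord: "(\<lambda>z. if z \<in> torus then z \<bullet> b else 0) \<in> cas_span" if b: "b \<in> Basis" for b :: "complex ^ 'm"
  proof -
    from b obtain i c where ic: "b = axis i c" "c \<in> Basis" by (auto simp: Basis_vec_def)
    define e where "e = (\<lambda>j. if j = i then 1 else (0::int))"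
    have "torus_char e z = vec_nth z i" for z :: "complex ^ 'm"
      unfolding torus_char_def e_def by (simp add: if_distrib[of "\<lambda>k. _ powi k"] prod.delta cong: if_cong)
    then have "torus_trig 1 0 e z = (if z \<in> torus then z \<bullet> axis i 1 else 0)"
      "torus_trig 0 1 e z = (if z \<in> torus then z \<bullet> axis i \<i> else 0)" for z
      by (auto simp: torus_trig_def inner_axis inner_complex_def)
    then have "(\<lambda>z. if z \<in> torus then z \<bullet> b else 0) = torus_trig 1 0 e \<or>
        (\<lambda>z. if z \<in> torus then z \<bullet> b else 0) = torus_trig 0 1 e"
      using ic by (auto simp: Basis_complex_def fun_eq_iff)
    then show ?thesis by (elim disjE) (simp_all only: torus_trig_in_span)
  qed
  have fz: "f z = (\<Sum>b\<in>Basis. f b * (z \<bullet> b))" for z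
  proof -
    have "f z = f (\<Sum>b\<in>Basis. (z \<bullet> b) *\<^sub>R b)" by (simp only: euclidean_representation)
    also have "\<dots> = (\<Sum>b\<in>Basis. f ((z \<bullet> b) *\<^sub>R b))"
      by (rule linear_sum[OF bounded_linear.linear[OF linear]])
    also have "\<dots> = (\<Sum>b\<in>Basis. f b * (z \<bullet> b))"
      by (simp only: linear_cmul[OF bounded_linear.linear[OF linear]] real_scaleR_def mult.commute)
    finally show ?thesis .
  qed
  have "(\<lambda>z. if z \<in> torus then f z else 0) = (\<Sum>b\<in>Basis. scale_fun (f b) (\<lambda>z. if z \<in> torus then z \<bullet> b else 0))"
  proof (rule ext)
    fix z show "(if z \<in> torus then f z else 0) = (\<Sum>b\<in>Basis. scale_fun (f b) (\<lambda>z. if z \<in> torus then z \<bullet> b else 0)) z"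
      unfolding sum_scale_fun_apply using fz[of z] by (cases "z \<in> torus") auto
  qed
  moreover have "\<dots> \<in> cas_span"
    by (rule fun_vs.span_sum, rule fun_vs.span_scale, rule coord)
  ultimately show ?case by simp
next
  case (const c)
  have "(\<lambda>z. if z \<in> torus then c else 0) = torus_trig c 0 (\<lambda>_. 0)"
    by (auto simp: torus_trig_def torus_char_def fun_eq_iff)
  then show ?case by (metis torus_trig_in_span)
next
  case (add f g)
  have "(\<lambda>z. if z \<in> torus then f z + g z else 0) = (\<lambda>z. if z \<in> torus then f z else 0) + (\<lambda>z. if z \<in> torus then g z else 0)"
    by (auto simp: fun_eq_iff)
  then show ?case using add by (simp add: fun_vs.span_add)
next
  case (mult f g)
  have "(\<lambda>z. if z \<in> torus then f z * g z else 0) = (\<lambda>z. (if z \<in> torus then f z else 0) * (if z \<in> torus then g z else 0))"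
    by (auto simp: fun_eq_iff)
  then show ?case using cas_span_mult[OF mult.IH] by simp
qed

lemma torus_inner_span_0:
  assumes f: "continuous_on torus f" "\<And>k. torus_inner f (torus_cas k) = 0" and g: "g \<in> cas_span"
  shows "continuous_on torus g \<and> torus_inner f g = 0"
proof -
  have "fun_vs.subspace {g. continuous_on torus g \<and> torus_inner f g = 0}"
  proof (rule fun_vs.subspaceI)
    have "continuous_on torus (\<lambda>_::complex ^ 'a. 0::real)" by (rule continuous_on_const)
    then show "0 \<in> {g. continuous_on torus g \<and> torus_inner f g = 0}"
      by (simp add: torus_inner_def torus_integral_def zero_fun_def)
  next
    fix x y assume "x \<in> {g. continuous_on torus g \<and> torus_inner f g = 0}" "y \<in> {g. continuous_on torus g \<and> torus_inner f g = 0}"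
    then show "x + y \<in> {g. continuous_on torus g \<and> torus_inner f g = 0}"
      using torus_integral_add[of "\<lambda>z. f z * x z" "\<lambda>z. f z * y z"] f(1)
      by (auto simp: plus_fun_def torus_inner_def distrib_left intro!: continuous_intros)
  next
    fix c x assume "x \<in> {g. continuous_on torus g \<and> torus_inner f g = 0}"
    then show "scale_fun c x \<in> {g. continuous_on torus g \<and> torus_inner f g = 0}"
      using torus_integral_cmult[of c "\<lambda>z. f z * x z"]
      by (auto simp: scale_fun_def torus_inner_def mult_ac intro!: continuous_intros)
  qed
  moreover have "range torus_cas \<subseteq> {g. continuous_on torus g \<and> torus_inner f g = 0}"
    using f(2) by (auto simp: torus_cas_def continuous_on_torus_trig)
  ultimately show ?thesis using fun_vs.span_minimal g by blast
qed

text \<open>Stone-Weierstrass gives \<open>g\<close> in the span within \<open>e\<close> of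
  \<open>f\<close> on the torus. As \<open>f\<close> is orthogonal to \<open>g\<close>, its inner
  product with itself equals that with \<open>f - g\<close>, which is at most \<open>e\<close> times
  the integral of |f|.\<close>

lemma torus_fourier_unique:
  assumes f: "continuous_on torus f" "\<And>k. torus_inner f (torus_cas k) = 0" and z: "z \<in> torus"
  shows "f z = 0"
proof (rule torus_inner_self_eq_0[OF f(1) _ z])
  let ?I = "torus_integral (\<lambda>z. \<bar>f z\<bar>)"
  have I: "?I \<ge> 0" unfolding torus_integral_def by (rule integral_nonneg_AE) auto
  have "\<bar>torus_inner f f\<bar> \<le> e * ?I" if e: "e > 0" for e
  proof -
    obtain p where p: "real_polynomial_function p" "\<And>x. x \<in> torus \<Longrightarrow> \<bar>f x - p x\<bar> < e"
      using Stone_Weierstrass_real_polynomial_function[OF compact_torus f(1) e] by blast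
    define g where "g = (\<lambda>z. if z \<in> torus then p z else 0)"
    have g: "continuous_on torus g" "torus_inner f g = 0"
      using torus_inner_span_0[OF f poly_in_cas_span[OF p(1)]] by (auto simp: g_def)
    have "torus_inner f f = torus_inner f g + torus_integral (\<lambda>z. f z * (f z - g z))"
      unfolding torus_inner_def
      by (subst torus_integral_add[symmetric]) (auto simp: algebra_simps intro!: continuous_intros g f)
    then have "\<bar>torus_inner f f\<bar> = \<bar>torus_integral (\<lambda>z. f z * (f z - g z))\<bar>" using g by simp
    also have "\<dots> \<le> torus_integral (\<lambda>z. e * \<bar>f z\<bar>)"
      unfolding torus_integral_def real_norm_def[symmetric]
    proof (rule order_trans[OF integral_norm_bound integral_mono])
      show "integrable angle_measure (\<lambda>x. norm (f (torus_param x) * (f (torus_param x) - g (torus_param x))))"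
        by (rule integrable_torus[of "\<lambda>z. norm (f z * (f z - g z))"]) (intro continuous_intros g f)
      show "integrable angle_measure (\<lambda>x. e * norm (f (torus_param x)))"
        by (rule integrable_torus[of "\<lambda>z. e * norm (f z)"]) (intro continuous_intros g f)
      fix x :: "'a \<Rightarrow> real"
      have "\<bar>f (torus_param x) - g (torus_param x)\<bar> \<le> e" using p(2)[of "torus_param x"] by (simp add: g_def)
      then show "norm (f (torus_param x) * (f (torus_param x) - g (torus_param x))) \<le> e * norm (f (torus_param x))"
        unfolding norm_mult by (subst mult.commute) (auto intro!: mult_right_mono)
    qed
    also have "\<dots> = e * ?I" by (rule torus_integral_cmult)
    finally show ?thesis .
  qed
  then have *: "\<bar>torus_inner f f\<bar> \<le> e * ?I" if "e > 0" for e using that by blast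
  have "\<bar>torus_inner f f\<bar> \<le> 0 + e" if "e > 0" for e
  proof -
    \<comment> \<open>The summand 1 in the denominator covers the case that the integral is
      0.\<close>
    have "\<bar>torus_inner f f\<bar> \<le> e / (?I + 1) * ?I" using that I by (intro *) simp
    also have "\<dots> \<le> e" using that I by (simp add: field_simps)
    finally show ?thesis by simp
  qed
  then show "torus_inner f f = 0" using field_le_epsilon[of "\<bar>torus_inner f f\<bar>" 0] by auto
qed


section \<open>The spectrum of the torus and the lattice form of its zeta function\<close>

lemma finite_int_normsq: "finite {k :: 'm::finite \<Rightarrow> int. real_of_int (int_normsq k) = \<mu>}"
proof (rule finite_subset)
  let ?N = "\<lceil>\<bar>\<mu>\<bar>\<rceil>"
  show "{k :: 'm \<Rightarrow> int. real_of_int (int_normsq k) = \<mu>} \<subseteq> (\<Pi>\<^sub>E i\<in>UNIV. {-?N..?N})"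
  proof
    fix k :: "'m \<Rightarrow> int" assume "k \<in> {k. real_of_int (int_normsq k) = \<mu>}"
    then have k: "real_of_int (int_normsq k) = \<mu>" by simp
    have "\<bar>k i\<bar> \<le> ?N" for i
    proof -
      have "\<bar>k i\<bar> \<le> (k i)\<^sup>2" using self_le_power[of "\<bar>k i\<bar>" 2] by (cases "k i = 0") auto
      also have "\<dots> \<le> int_normsq k" unfolding int_normsq_def by (rule member_le_sum) auto
      also have "\<dots> \<le> ?N" using k by linarith
      finally show ?thesis .
    qed
    then show "k \<in> (\<Pi>\<^sub>E i\<in>UNIV. {-?N..?N})" by (force simp: abs_le_iff)
  qed
  show "finite (\<Pi>\<^sub>E i\<in>(UNIV::'m set). {-?N..?N})" by (rule finite_PiE) auto
qed

lemma continuous_on_torus_cas: "continuous_on torus (torus_cas k)"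
  unfolding torus_cas_def by (rule continuous_on_torus_trig)

lemma torus_inner_sum_cas:
  fixes u :: "('m::finite \<Rightarrow> int) \<Rightarrow> real"
  assumes "finite F"
  shows "torus_inner (\<lambda>z. \<Sum>k\<in>F. u k * torus_cas k z) (torus_cas l) = 
    (if l \<in> F then u l * measure (angle_measure :: ('m \<Rightarrow> real) measure) UNIV else 0)"
proof -
  have "torus_inner (\<lambda>z. \<Sum>k\<in>F. u k * torus_cas k z) (torus_cas l) = (\<Sum>k\<in>F. u k * torus_inner (torus_cas k) (torus_cas l))"
    unfolding torus_inner_def sum_distrib_right mult.assoc
    by (subst torus_integral_sum) (auto simp: torus_integral_cmult intro!: continuous_intros continuous_on_torus_cas)
  also have "\<dots> = (\<Sum>k\<in>F. if k = l then u k * measure (angle_measure :: ('m \<Rightarrow> real) measure) UNIV else 0)"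
    by (intro sum.cong refl) (simp add: torus_inner_cas)
  finally show ?thesis using assms by simp
qed

lemma torus_spectrum:
  fixes T :: "'m::finite itself"
  defines "V \<equiv> smooth_torus_functions :: (complex ^ 'm \<Rightarrow> real) set"
  shows "eigenvalues V laplace_beltrami = (\<lambda>k :: 'm \<Rightarrow> int. real_of_int (int_normsq k)) ` UNIV"
    and "multiplicity_ev V laplace_beltrami \<mu> = card {k :: 'm \<Rightarrow> int. k \<in> UNIV \<and> real_of_int (int_normsq k) = \<mu>}"
proof -
  let ?vol = "measure (angle_measure :: ('m \<Rightarrow> real) measure) UNIV"
  have eig: "torus_cas k \<in> eigenspace V laplace_beltrami (real_of_int (int_normsq k))" if "k \<in> UNIV" for k :: "'m \<Rightarrow> int"
    unfolding eigenspace_def V_def torus_cas_def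
    by (auto simp: torus_trig_smooth laplace_beltrami_torus_trig scale_fun_def fun_eq_iff)
  have indep: "\<forall>k\<in>F. u k = 0" if F: "finite F" "F \<subseteq> UNIV" and eq: "\<forall>z. (\<Sum>k\<in>F. u k * torus_cas k z) = 0"
    for F and u :: "('m \<Rightarrow> int) \<Rightarrow> real"
  proof
    fix l assume "l \<in> F"
    then have "u l * ?vol = torus_inner (\<lambda>z. \<Sum>k\<in>F. u k * torus_cas k z) (torus_cas l)"
      using torus_inner_sum_cas[OF F(1), of u l] by simp
    also have "\<dots> = 0" using eq by (simp add: torus_inner_def torus_integral_def)
    finally show "u l = 0" using measure_angle_pos[where 'm = 'm] by simp
  qed
  have fin: "finite {k :: 'm \<Rightarrow> int. k \<in> UNIV \<and> real_of_int (int_normsq k) = \<mu>}" for \<mu>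
    using finite_int_normsq by simp
  have span: "\<exists>u. \<forall>z. f z = (\<Sum>k\<in>{k :: 'm \<Rightarrow> int. k \<in> UNIV \<and> real_of_int (int_normsq k) = \<mu>}. u k * torus_cas k z)"
    if f: "f \<in> eigenspace V laplace_beltrami \<mu>" for \<mu> f
  proof -
    let ?S = "{k :: 'm \<Rightarrow> int. k \<in> UNIV \<and> real_of_int (int_normsq k) = \<mu>}"
    from f have fV: "f \<in> smooth_torus_functions" and Lf: "laplace_beltrami f = scale_fun \<mu> f"
      by (auto simp: eigenspace_def V_def)
    note cf = smooth_imp_continuous[OF fV]
    have ortho: "torus_inner f (torus_cas l) = 0" if l: "real_of_int (int_normsq l) \<noteq> \<mu>" for l
    proof -
      have "\<mu> * torus_inner f (torus_cas l) = torus_inner (laplace_beltrami f) (torus_cas l)"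
        unfolding torus_inner_def Lf scale_fun_def mult.assoc torus_integral_cmult ..
      also have "\<dots> = torus_inner f (laplace_beltrami (torus_cas l))"
        by (rule laplace_beltrami_symmetric[OF fV]) (simp add: torus_cas_def torus_trig_smooth)
      also have "laplace_beltrami (torus_cas l) = (\<lambda>z. real_of_int (int_normsq l) * torus_cas l z)"
        by (auto simp: torus_cas_def laplace_beltrami_torus_trig)
      also have "torus_inner f \<dots> = int_normsq l * torus_inner f (torus_cas l)"
        unfolding torus_inner_def torus_integral_cmult[symmetric] by (simp add: mult_ac)
      finally show ?thesis using l by simp
    qed
    define u where "u k = torus_inner f (torus_cas k) / ?vol" for k
    \<comment> \<open>The finite Fourier sum of \<open>f\<close> over the frequencies with
      eigenvalue \<mu>. By \<open>ortho\<close> all other coefficients of \<open>f\<close> vanish,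
      so \<open>f\<close> and \<open>s\<close> have the same coefficients.\<close>
    define s where "s = (\<lambda>z. \<Sum>k\<in>?S. u k * torus_cas k z)"
    have cs: "continuous_on torus s" unfolding s_def by (intro continuous_intros continuous_on_torus_cas)
    have sl: "torus_inner s (torus_cas l) = torus_inner f (torus_cas l)" for l
      unfolding s_def torus_inner_sum_cas[OF fin] using measure_angle_pos[where 'm = 'm] ortho[of l]
      by (auto simp: u_def)
    have "f z - s z = 0" if "z \<in> torus" for z
    proof (rule torus_fourier_unique[OF _ _ that])
      show "continuous_on torus (\<lambda>z. f z - s z)" by (intro continuous_intros cf cs)
      fix l
      have "torus_inner f (torus_cas l) = torus_inner (\<lambda>z. f z - s z) (torus_cas l) + torus_inner s (torus_cas l)"
        unfolding torus_inner_def
        by (subst torus_integral_add[symmetric]) (auto intro!: continuous_intros cf cs continuous_on_torus_cas simp: algebra_simps)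
      then show "torus_inner (\<lambda>z. f z - s z) (torus_cas l) = 0" using sl by simp
    qed
    moreover have "f z = s z" if "z \<notin> torus" for z
      using fV that by (simp add: s_def smooth_torus_functions_def torus_cas_def torus_trig_def)
    ultimately have "f z = s z" for z by (cases "z \<in> torus") auto
    then show ?thesis unfolding s_def by blast
  qed
  note spec = spectrum_of_independent_system[where e = "torus_cas :: ('m \<Rightarrow> int) \<Rightarrow> _" and K = "UNIV :: ('m \<Rightarrow> int) set"
    and lam = "\<lambda>k :: 'm \<Rightarrow> int. real_of_int (int_normsq k)" and V = V and A = laplace_beltrami, OF eig indep fin span]
  show "eigenvalues V laplace_beltrami = (\<lambda>k :: 'm \<Rightarrow> int. real_of_int (int_normsq k)) ` UNIV"
    by (rule spec(1))
  show "multiplicity_ev V laplace_beltrami \<mu> = card {k :: 'm \<Rightarrow> int. k \<in> UNIV \<and> real_of_int (int_normsq k) = \<mu>}"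
    by (rule spec(2))
qed

lemma int_normsq_eq_0_iff [simp]: "int_normsq k = 0 \<longleftrightarrow> k = (\<lambda>_. 0)"
  by (auto simp: int_normsq_def sum_nonneg_eq_0_iff fun_eq_iff)

lemma int_normsq_0 [simp]: "int_normsq (\<lambda>_. 0) = 0"
  by simp

lemma int_normsq_nonneg [simp]: "int_normsq k \<ge> 0"
  by (simp add: int_normsq_def sum_nonneg)

text \<open>The spectral zeta function runs over distinct eigenvalues, and the multiplicity counts
  the lattice points on a sphere. Regrouping the lattice sum by spheres uses its summability, which
  \<open>epstein_zeta_mellin\<close> provides.\<close>

theorem torus_zeta_eq_infsum:
  assumes "(\<lambda>k :: 'm::finite \<Rightarrow> int. complex_of_real (int_normsq k) powr (- s)) summable_on (- {\<lambda>_. 0})"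
  shows "torus_zeta TYPE('m) s = (\<Sum>\<^sub>\<infinity>k\<in>- {\<lambda>_::'m. 0}. complex_of_real (int_normsq k) powr (- s))"
proof -
  let ?lam = "\<lambda>k :: 'm \<Rightarrow> int. real_of_int (int_normsq k)"
  let ?A = "range ?lam - {0}" and ?B = "\<lambda>\<mu>. {k :: 'm \<Rightarrow> int. ?lam k = \<mu>}"
  have bij: "bij_betw snd (Sigma ?A ?B) (- {\<lambda>_. 0})"
    by (rule bij_betw_byWitness[where f' = "\<lambda>k. (?lam k, k)"]) auto
  have sm: "(\<lambda>p. complex_of_real (int_normsq (snd p)) powr (- s)) summable_on Sigma ?A ?B"
    using assms summable_on_reindex_bij_betw[OF bij, of "\<lambda>k. complex_of_real (int_normsq k) powr (- s)"] by simp
  have "torus_zeta TYPE('m) s = (\<Sum>\<^sub>\<infinity>\<mu>\<in>?A. of_nat (card (?B \<mu>)) * complex_of_real \<mu> powr (- s))"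
    unfolding torus_zeta_def spectral_zeta_def torus_spectrum by simp
  also have "\<dots> = (\<Sum>\<^sub>\<infinity>\<mu>\<in>?A. \<Sum>\<^sub>\<infinity>k\<in>?B \<mu>. complex_of_real (int_normsq (snd (\<mu>, k))) powr (- s))"
  proof (rule infsum_cong)
    fix \<mu>
    have "(\<Sum>\<^sub>\<infinity>k\<in>?B \<mu>. complex_of_real (?lam k) powr (- s)) = (\<Sum>k\<in>?B \<mu>. complex_of_real \<mu> powr (- s))"
      unfolding infsum_finite[OF finite_int_normsq] by (rule sum.cong) auto
    then show "of_nat (card (?B \<mu>)) * complex_of_real \<mu> powr (- s) = (\<Sum>\<^sub>\<infinity>k\<in>?B \<mu>. complex_of_real (?lam (snd (\<mu>, k))) powr (- s))"
      by (simp only: snd_conv sum_constant)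
  qed
  also have "\<dots> = (\<Sum>\<^sub>\<infinity>p\<in>Sigma ?A ?B. complex_of_real (int_normsq (snd p)) powr (- s))"
    by (rule infsum_Sigma_banach[OF sm])
  also have "\<dots> = (\<Sum>\<^sub>\<infinity>k\<in>- {\<lambda>_::'m. 0}. complex_of_real (int_normsq k) powr (- s))"
    using infsum_reindex_bij_betw[OF bij, of "\<lambda>k. complex_of_real (int_normsq k) powr (- s)"] by simp
  finally show ?thesis .
qed

section \<open>Aliasing for the discrete heat trace\<close>

definition disc_theta :: "nat \<Rightarrow> real \<Rightarrow> real" where
  "disc_theta n t = (\<Sum>k\<in>{0..<int n}. exp (- t * ((real n)\<^sup>2 / pi\<^sup>2 * (sin (pi * real_of_int k / n))\<^sup>2)))"

text \<open>
  \<open>walk_return u\<close> is $e^{-2u} I_0(2u)$, the probability that the simple random walk on $\mathbb{Z}$ in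
  continuous time is at its starting point at time \<open>u\<close>.
\<close>

definition walk_return :: "real \<Rightarrow> real" where
  "walk_return u = integral {-1/2..1/2} (\<lambda>y. exp (- u * (2 - 2 * cos (2 * pi * y))))"

lemma two_cos_power: "(2 * cos x) ^ N = (\<Sum>p\<le>N. real (N choose p) * cos (real_of_int (2 * int p - int N) * x))"
proof -
  have "complex_of_real ((2 * cos x) ^ N) = (cis x + cis (- x)) ^ N"
    by (simp add: complex_eq_iff flip: of_real_power)
  also have "\<dots> = (\<Sum>p\<le>N. of_nat (N choose p) * cis x ^ p * cis (- x) ^ (N - p))"
    by (rule binomial_ring)
  also have "\<dots> = (\<Sum>p\<le>N. of_nat (N choose p) * cis (real_of_int (2 * int p - int N) * x))"
    by (intro sum.cong refl) (simp add: Complex.DeMoivre cis_mult mult.assoc algebra_simps of_nat_diff)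
  finally have "Re (complex_of_real ((2 * cos x) ^ N)) = Re (\<Sum>p\<le>N. of_nat (N choose p) * cis (real_of_int (2 * int p - int N) * x))"
    by simp
  then show ?thesis by simp
qed

text \<open>The expansion of \<open>two_cos_power\<close> at an imaginary argument. It evaluates in
  closed form the weighted sum over frequencies that bounds the aliased part.\<close>

lemma two_cosh_power:
  fixes a :: real
  shows "(2 * cosh a) ^ N = (\<Sum>p\<le>N. real (N choose p) * cosh (real_of_int (2 * int p - int N) * a))"
proof -
  have E: "(exp a + exp (- a)) ^ N = (\<Sum>p\<le>N. real (N choose p) * exp (real_of_int (2 * int p - int N) * a))" for a :: real
    unfolding binomial_ring
  proof (intro sum.cong refl)
    fix p assume "p \<in> {..N}"
    then have "exp a ^ p * exp (- a) ^ (N - p) = exp (real_of_int (2 * int p - int N) * a)"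
      by (simp add: exp_of_nat_mult[symmetric] exp_add[symmetric] of_nat_diff algebra_simps)
    then show "real (N choose p) * exp a ^ p * exp (- a) ^ (N - p) = real (N choose p) * exp (real_of_int (2 * int p - int N) * a)"
      by (simp add: mult.assoc)
  qed
  have "2 * cosh a = exp a + exp (- a)" by (simp add: cosh_def)
  then have "(2 * cosh a) ^ N = ((exp a + exp (- a)) ^ N + (exp (- a) + exp (- (- a))) ^ N) / 2"
    by (simp add: add.commute)
  also have "\<dots> = (\<Sum>p\<le>N. real (N choose p) * cosh (real_of_int (2 * int p - int N) * a))"
    unfolding E by (simp add: cosh_def sum.distrib[symmetric] sum_divide_distrib distrib_left add_divide_distrib)
  finally show ?thesis .
qed

lemma avg_cos:
  assumes "n > 0"
  shows "(\<Sum>k\<in>{0..<int n}. cos (real_of_int j * (2 * pi * real_of_int k / n))) / n = (if int n dvd j then 1 else 0)"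
proof -
  have "(\<Sum>k\<in>{0..<int n}. cos (real_of_int j * (2 * pi * real_of_int k / n)))
     = Re (\<Sum>k\<in>{0..<int n}. cis (2 * pi * real_of_int (j * k) / n))"
    by (simp add: mult_ac)
  then show ?thesis unfolding sum_cis_residues[OF assms] using assms by simp
qed

lemma integral_cos_multiple:
  "((\<lambda>y. cos (real_of_int j * (2 * pi * y))) has_integral (if j = 0 then 1 else 0)) {-1/2..1/2}"
proof (cases "j = 0")
  case True
  then show ?thesis using has_integral_const_real[of "1::real" "-1/2" "1/2"] by simp
next
  case False
  define F where "F y = sin (real_of_int j * (2 * pi * y)) / (real_of_int j * (2 * pi))" for y
  have "((\<lambda>y. cos (real_of_int j * (2 * pi * y))) has_integral (F (1/2) - F (-1/2))) {-1/2..1/2}"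
  proof (rule fundamental_theorem_of_calculus)
    fix y :: real
    show "(F has_vector_derivative cos (real_of_int j * (2 * pi * y))) (at y within {-1/2..1/2})"
      unfolding F_def has_real_derivative_iff_has_vector_derivative[symmetric]
      using False by (auto intro!: derivative_eq_intros simp: field_simps)
  qed simp
  moreover have "sin (real_of_int j * pi) = 0" by (simp add: sin_zero_iff_int2)
  then have "F (1/2) - F (-1/2) = 0" by (simp add: F_def)
  ultimately show ?thesis using False by simp
qed

text \<open>A Chernoff bound: \<open>N choose p\<close> counts the walks of \<open>N\<close> steps
  that end at \<open>2 * p - N\<close>, and those that end at a non-zero multiple of
  \<open>n\<close> are estimated by an exponential moment. The parameter \<open>a\<close> stays
  open, to be chosen according to the time.\<close>

lemma alias_cos_power:
  fixes a :: real and n :: nat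
  assumes n: "n > 0" and a: "a > 0"
  defines "av \<equiv> \<lambda>N. (\<Sum>k\<in>{0..<int n}. (2 * cos (2 * pi * real_of_int k / n)) ^ N) / n"
    and "ig \<equiv> \<lambda>N. integral {-1/2..1/2} (\<lambda>y. (2 * cos (2 * pi * y)) ^ N)"
  shows "0 \<le> av N - ig N" "(av N - ig N) * (cosh (a * n) - 1) \<le> (2 * cosh a) ^ N - 2 ^ N"
proof -
  define d where "d p = 2 * int p - int N" for p
  have av: "av N = (\<Sum>p\<le>N. real (N choose p) * (if int n dvd d p then 1 else 0))"
  proof -
    have "av N = (\<Sum>k\<in>{0..<int n}. \<Sum>p\<le>N. real (N choose p) * cos (real_of_int (d p) * (2 * pi * real_of_int k / n))) / n"
      unfolding av_def two_cos_power d_def ..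
    also have "\<dots> = (\<Sum>p\<le>N. real (N choose p) * ((\<Sum>k\<in>{0..<int n}. cos (real_of_int (d p) * (2 * pi * real_of_int k / n))) / n))"
      by (subst sum.swap) (simp add: sum_distrib_left sum_divide_distrib)
    finally show ?thesis unfolding avg_cos[OF n] .
  qed
  have ig: "ig N = (\<Sum>p\<le>N. real (N choose p) * (if d p = 0 then 1 else 0))"
    unfolding ig_def two_cos_power d_def[symmetric]
    by (intro integral_unique has_integral_sum has_integral_mult_right integral_cos_multiple) simp
  have diff: "av N - ig N = (\<Sum>p\<le>N. real (N choose p) * (if int n dvd d p \<and> d p \<noteq> 0 then 1 else 0))"
    unfolding av ig sum_subtractf[symmetric] by (intro sum.cong) auto
  show "0 \<le> av N - ig N" unfolding diff by (intro sum_nonneg) auto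
  have "(av N - ig N) * (cosh (a * n) - 1) \<le> (\<Sum>p\<le>N. real (N choose p) * (cosh (real_of_int (d p) * a) - 1))"
    unfolding diff sum_distrib_right
  proof (intro sum_mono)
    fix p assume "p \<in> {..N}"
    have "(if int n dvd d p \<and> d p \<noteq> 0 then 1 else 0) * (cosh (a * n) - 1) \<le> cosh (real_of_int (d p) * a) - 1"
    proof (cases "int n dvd d p \<and> d p \<noteq> 0")
      case True
      then have "int n \<le> \<bar>d p\<bar>" by (metis abs_ge_zero dvd_imp_le_int abs_of_nat)
      then have "real n \<le> \<bar>real_of_int (d p)\<bar>" by linarith
      then have "a * n \<le> \<bar>real_of_int (d p) * a\<bar>" using a by (simp add: abs_mult mult.commute)
      then have "cosh (a * n) \<le> cosh \<bar>real_of_int (d p) * a\<bar>"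
        using a by (subst cosh_real_nonneg_le_iff) auto
      then show ?thesis using True by (simp add: cosh_real_abs)
    qed (auto simp: cosh_real_ge_1)
    then show "real (N choose p) * (if int n dvd d p \<and> d p \<noteq> 0 then 1 else 0) * (cosh (a * n) - 1)
       \<le> real (N choose p) * (cosh (real_of_int (d p) * a) - 1)"
      unfolding mult.assoc by (intro mult_left_mono) auto
  qed
  also have "\<dots> = (2 * cosh a) ^ N - 2 ^ N"
    unfolding two_cosh_power d_def right_diff_distrib sum_subtractf
    by (simp add: choose_row_sum flip: of_nat_sum of_nat_power)
  finally show "(av N - ig N) * (cosh (a * n) - 1) \<le> (2 * cosh a) ^ N - 2 ^ N" .
qed

lemma exp_sums: "(\<lambda>N. u ^ N / fact N * x ^ N) sums exp (u * x)" for u x :: real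
  using exp_converges[of "u * x"] by (simp add: power_mult_distrib field_simps)

text \<open>Termwise integration is justified by the Weierstrass test, with the series of exp (2
  |u|) as majorant.\<close>

lemma integral_exp_cos_sums:
  "(\<lambda>N. u ^ N / fact N * integral {-1/2..1/2} (\<lambda>y. (2 * cos (2 * pi * y)) ^ N)) 
    sums integral {-1/2..1/2} (\<lambda>y. exp (u * (2 * cos (2 * pi * y))))"
proof -
  let ?f = "\<lambda>N y. u ^ N / fact N * (2 * cos (2 * pi * y)) ^ N"
  have U: "uniform_limit {-1/2..1/2} (\<lambda>n y. \<Sum>N<n. ?f N y) (\<lambda>y. \<Sum>N. ?f N y) sequentially"
  proof (rule Weierstrass_m_test)
    show "summable (\<lambda>N. \<bar>u\<bar> ^ N / fact N * 2 ^ N)" using exp_sums[of "\<bar>u\<bar>" 2] by (rule sums_summable)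
    fix N and y :: real
    have "\<bar>2 * cos (2 * pi * y)\<bar> ^ N \<le> 2 ^ N"
      using abs_cos_le_one[of "2 * pi * y"] by (intro power_mono) (auto simp: abs_mult)
    then show "norm (?f N y) \<le> \<bar>u\<bar> ^ N / fact N * 2 ^ N"
      unfolding norm_mult[of "u ^ N / fact N"] norm_divide norm_power norm_fact
      unfolding real_norm_def
      by (intro mult_left_mono) auto
  qed
  have sumf: "(\<Sum>N. ?f N y) = exp (u * (2 * cos (2 * pi * y)))" for y
    using sums_unique[OF exp_sums] by metis
  have C: "continuous_on {-1/2..1/2} (\<lambda>y. \<Sum>N<n. ?f N y)" for n
    by (intro continuous_intros) auto
  obtain I J where IJ: "\<And>n. ((\<lambda>y. \<Sum>N<n. ?f N y) has_integral I n) {-1/2..1/2}" 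
      "((\<lambda>y. exp (u * (2 * cos (2 * pi * y)))) has_integral J) {-1/2..1/2}" "I \<longlonglongrightarrow> J"
    using uniform_limit_integral[OF U[unfolded sumf] C sequentially_bot] by blast
  have "I = (\<lambda>n. \<Sum>N<n. u ^ N / fact N * integral {-1/2..1/2} (\<lambda>y. (2 * cos (2 * pi * y)) ^ N))"
  proof (rule ext)
    fix n
    have "((\<lambda>y. \<Sum>N<n. ?f N y) has_integral (\<Sum>N<n. u ^ N / fact N * integral {-1/2..1/2} (\<lambda>y. (2 * cos (2 * pi * y)) ^ N))) {-1/2..1/2}"
      by (intro has_integral_sum has_integral_mult_right integrable_integral integrable_continuous_real continuous_intros) simp
    then show "I n = (\<Sum>N<n. u ^ N / fact N * integral {-1/2..1/2} (\<lambda>y. (2 * cos (2 * pi * y)) ^ N))"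
      using IJ(1) has_integral_unique by blast
  qed
  then show ?thesis using IJ(3) unfolding sums_def integral_unique[OF IJ(2)] by (simp only:)
qed

text \<open>
  Averaging over \<open>n\<close>-th roots of unity keeps the frequencies divisible by \<open>n\<close>, integration keeps the
  frequency 0 only. The frequencies \<open>d\<close> that make the difference are bounded by means of the weight
  \<open>cosh (a d) - 1 \<ge> cosh (a n) - 1\<close>.
\<close>

theorem disc_theta_alias:
  fixes a t u :: real and n :: nat
  assumes n: "n > 0" and u: "u \<ge> 0" and a: "a > 0" and tu: "t * (real n)\<^sup>2 = 4 * pi\<^sup>2 * u"
  shows "0 \<le> disc_theta n t - n * walk_return u"
    and "disc_theta n t - n * walk_return u \<le> n * (exp (2 * u * (cosh a - 1)) - 1) / (cosh (a * n) - 1)"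
proof -
  define av where "av N = (\<Sum>k\<in>{0..<int n}. (2 * cos (2 * pi * real_of_int k / n)) ^ N) / n" for N
  define ig where "ig N = integral {-1/2..1/2} (\<lambda>y. (2 * cos (2 * pi * y)) ^ N)" for N
  define A where "A = (\<Sum>k\<in>{0..<int n}. exp (u * (2 * cos (2 * pi * real_of_int k / n)))) / n"
  define B where "B = integral {-1/2..1/2} (\<lambda>y. exp (u * (2 * cos (2 * pi * y))))"
  note al = alias_cos_power[OF n a, folded av_def ig_def]
  have ch: "cosh (a * n) - 1 > 0" using a n cosh_real_nonneg_less_iff[of 0 "a * n"] by simp
  have Asums: "(\<lambda>N. u ^ N / fact N * av N) sums A"
  proof -
    have "(\<lambda>N. \<Sum>k\<in>{0..<int n}. u ^ N / fact N * (2 * cos (2 * pi * real_of_int k / n)) ^ N) sums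
          (\<Sum>k\<in>{0..<int n}. exp (u * (2 * cos (2 * pi * real_of_int k / n))))"
      by (intro sums_sum exp_sums)
    from sums_divide[OF this, of "real n"] show ?thesis
      by (simp add: A_def av_def sum_distrib_left)
  qed
  have ABsums: "(\<lambda>N. u ^ N / fact N * (av N - ig N)) sums (A - B)"
    using sums_diff[OF Asums integral_exp_cos_sums[of u, folded ig_def B_def]] by (simp add: right_diff_distrib)
  have 0: "0 \<le> A - B"
    by (rule sums_le[OF _ sums_zero ABsums]) (use al(1) u in auto)
  have "(A - B) * (cosh (a * n) - 1) \<le> exp (u * (2 * cosh a)) - exp (u * 2)"
  proof (rule sums_le[OF _ sums_mult2[OF ABsums] sums_diff[OF exp_sums exp_sums]])
    fix N
    have "u ^ N / fact N * ((av N - ig N) * (cosh (a * n) - 1)) \<le> u ^ N / fact N * ((2 * cosh a) ^ N - 2 ^ N)"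
      using u by (intro mult_left_mono al(2)) auto
    then show "u ^ N / fact N * (av N - ig N) * (cosh (a * n) - 1) \<le> u ^ N / fact N * (2 * cosh a) ^ N - u ^ N / fact N * 2 ^ N"
      by (simp only: mult.assoc right_diff_distrib[of "u ^ N / fact N", symmetric])
  qed
  then have 1: "A - B \<le> (exp (u * (2 * cosh a)) - exp (u * 2)) / (cosh (a * n) - 1)"
    by (simp only: pos_le_divide_eq[OF ch])
  \<comment> \<open>The series belong to exp (2 u cos); the factor \<open>exp (- (2 * u))\<close>
    turns this into the exponential of - u (2 - 2 cos), which is minus \<open>t\<close> times an
    eigenvalue.\<close>
  have th: "disc_theta n t = n * (exp (- (2 * u)) * A)"
  proof -
    have "exp (- t * ((real n)\<^sup>2 / pi\<^sup>2 * (sin (pi * real_of_int k / n))\<^sup>2)) 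
       = exp (- (2 * u)) * exp (u * (2 * cos (2 * pi * real_of_int k / n)))" for k
    proof -
      have "cos (2 * (pi * real_of_int k / n)) = 1 - 2 * (sin (pi * real_of_int k / n))\<^sup>2" by (rule cos_double_sin)
      then have c: "cos (2 * pi * real_of_int k / n) = 1 - 2 * (sin (pi * real_of_int k / n))\<^sup>2" by (simp only: mult.assoc times_divide_eq_right)
      have "t * ((real n)\<^sup>2 / pi\<^sup>2 * (sin (pi * real_of_int k / n))\<^sup>2) = (t * (real n)\<^sup>2) / pi\<^sup>2 * (sin (pi * real_of_int k / n))\<^sup>2"
        by simp
      also have "\<dots> = 4 * u * (sin (pi * real_of_int k / n))\<^sup>2" unfolding tu by simp
      finally have "- t * ((real n)\<^sup>2 / pi\<^sup>2 * (sin (pi * real_of_int k / n))\<^sup>2) = - (2 * u) + u * (2 * cos (2 * pi * real_of_int k / n))"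
        unfolding c by (simp add: algebra_simps)
      then show ?thesis by (simp only: exp_add)
    qed
    then have "disc_theta n t = exp (- (2 * u)) * (\<Sum>k\<in>{0..<int n}. exp (u * (2 * cos (2 * pi * real_of_int k / n))))"
      unfolding disc_theta_def sum_distrib_left by (rule sum.cong[OF refl])
    then show ?thesis unfolding A_def using n by simp
  qed
  have wr: "walk_return u = exp (- (2 * u)) * B"
    unfolding walk_return_def B_def integral_mult_right[symmetric]
    by (intro integral_cong) (simp add: exp_add[symmetric] algebra_simps)
  have eq: "disc_theta n t - n * walk_return u = n * (exp (- (2 * u)) * (A - B))"
    by (simp add: th wr algebra_simps)
  show "0 \<le> disc_theta n t - n * walk_return u" unfolding eq using 0 by simp
  have "n * (exp (- (2 * u)) * (A - B)) \<le> n * (exp (- (2 * u)) * ((exp (u * (2 * cosh a)) - exp (u * 2)) / (cosh (a * n) - 1)))"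
    using 1 by (intro mult_left_mono) auto
  also have "\<dots> = n * (exp (2 * u * (cosh a - 1)) - 1) / (cosh (a * n) - 1)"
    by (simp add: right_diff_distrib exp_add[symmetric] algebra_simps)
  finally show "disc_theta n t - n * walk_return u \<le> n * (exp (2 * u * (cosh a - 1)) - 1) / (cosh (a * n) - 1)"
    unfolding eq .
qed

section \<open>Heat traces and the theta function\<close>

definition theta :: "real \<Rightarrow> real" where
  "theta t = (\<Sum>\<^sub>\<infinity>k\<in>(UNIV :: int set). exp (- t * (real_of_int k)\<^sup>2))"

definition circle_symbol :: "nat \<Rightarrow> real \<Rightarrow> real" where
  "circle_symbol n x = (real n)\<^sup>2 / pi\<^sup>2 * (sin (pi * x / n))\<^sup>2"

text \<open>
  Cutting off at half a period makes \<open>disc_theta\<close> the sum and \<open>n * walk_return\<close> the integral of one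
  function, to be compared pointwise with the Gaussian.
\<close>

definition window_kernel :: "nat \<Rightarrow> real \<Rightarrow> real \<Rightarrow> real" where
  "window_kernel n t x = (if - real n < 2 * x \<and> 2 * x \<le> n then exp (- t * circle_symbol n x) else 0)"

text \<open>The first two bounds measure the distance from the Gaussian exponent, of relative order
  (x / n)^2. The third keeps Gaussian decay on the whole window, uniformly in \<open>n\<close>; its
  constant 1/4 comes from the cubic Taylor remainder of the sine.\<close>

lemma circle_symbol_bounds:
  assumes n: "n > 0"
  shows "circle_symbol n x \<le> x\<^sup>2" "x\<^sup>2 - circle_symbol n x \<le> pi\<^sup>2 * x ^ 4 / (3 * (real n)\<^sup>2)"
    and "\<bar>2 * x\<bar> \<le> n \<Longrightarrow> x\<^sup>2 / 4 \<le> circle_symbol n x"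
proof -
  define y where "y = pi * x / n"
  have x: "x = n / pi * y" using n by (simp add: y_def)
  have sy: "circle_symbol n x = (real n)\<^sup>2 / pi\<^sup>2 * (sin y)\<^sup>2" by (simp add: circle_symbol_def y_def)
  have xy: "x\<^sup>2 = (real n)\<^sup>2 / pi\<^sup>2 * y\<^sup>2" by (simp add: x power_divide power_mult_distrib)
  have s1: "\<bar>sin y\<bar> \<le> \<bar>y\<bar>" using abs_sin_x_le_abs_x by blast
  then have s2: "(sin y)\<^sup>2 \<le> y\<^sup>2" by (simp add: abs_le_square_iff)
  show "circle_symbol n x \<le> x\<^sup>2" unfolding sy xy using s2 by (intro mult_left_mono) auto
  have mac: "\<bar>sin y - y\<bar> \<le> \<bar>y\<bar> ^ 3 / 6"
    using Maclaurin_sin_bound[of y 3] by (simp add: sin_coeff_def numeral_3_eq_3 fact_numeral)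
  then have mac': "\<bar>y - sin y\<bar> \<le> \<bar>y\<bar> ^ 3 / 6" by (simp only: abs_minus_commute)
  have "y\<^sup>2 - (sin y)\<^sup>2 = (y - sin y) * (y + sin y)" by (simp add: power2_eq_square algebra_simps)
  also have "\<dots> \<le> \<bar>y - sin y\<bar> * \<bar>y + sin y\<bar>" by (metis abs_ge_self abs_mult)
  also have "\<dots> \<le> (\<bar>y\<bar> ^ 3 / 6) * (2 * \<bar>y\<bar>)"
    using mac' s1 by (intro mult_mono) auto
  also have "\<dots> = \<bar>y\<bar> ^ 4 / 3" by (simp add: numeral_eq_Suc)
  also have "\<dots> = y ^ 4 / 3" by simp
  finally have d: "y\<^sup>2 - (sin y)\<^sup>2 \<le> y ^ 4 / 3" .
  have "x\<^sup>2 - circle_symbol n x = (real n)\<^sup>2 / pi\<^sup>2 * (y\<^sup>2 - (sin y)\<^sup>2)"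
    unfolding sy xy by (simp add: right_diff_distrib)
  also have "\<dots> \<le> (real n)\<^sup>2 / pi\<^sup>2 * (y ^ 4 / 3)" using d by (intro mult_left_mono) auto
  also have "\<dots> = pi\<^sup>2 * x ^ 4 / (3 * (real n)\<^sup>2)"
    using n unfolding y_def by (simp add: field_simps power_divide power_mult_distrib)
  finally show "x\<^sup>2 - circle_symbol n x \<le> pi\<^sup>2 * x ^ 4 / (3 * (real n)\<^sup>2)" .
  show "x\<^sup>2 / 4 \<le> circle_symbol n x" if "\<bar>2 * x\<bar> \<le> n"
  proof -
    have "\<bar>x / n\<bar> \<le> 1 / 2" using that n by (simp add: field_simps)
    then have "pi * \<bar>x / n\<bar> \<le> pi * (1 / 2)" by (rule mult_left_mono) simp
    moreover have "\<bar>y\<bar> = pi * \<bar>x / n\<bar>" by (simp add: y_def abs_mult)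
    ultimately have "\<bar>y\<bar> \<le> pi / 2" by simp
    \<comment> \<open>1.65 lies above pi/2 and its square below 3, so the cubic remainder is at most
      half of |y|.\<close>
    then have "\<bar>y\<bar> \<le> 1.65" using pi_less_4 pi_approx by simp
    then have "\<bar>y\<bar> * \<bar>y\<bar> \<le> 1.65 * 1.65" by (intro mult_mono) auto
    then have yy: "y\<^sup>2 \<le> 3" by (simp add: power2_eq_square)
    have "\<bar>y\<bar> ^ 3 / 6 = \<bar>y\<bar> * (y\<^sup>2 / 6)" by (simp add: power3_eq_cube power2_eq_square mult.assoc)
    also have "\<dots> \<le> \<bar>y\<bar> * (1 / 2)" using yy by (intro mult_left_mono) auto
    finally have "\<bar>y\<bar> / 2 \<le> \<bar>sin y\<bar>" using mac by linarith
    then have "(\<bar>y\<bar> / 2)\<^sup>2 \<le> \<bar>sin y\<bar>\<^sup>2" by (intro power_mono) auto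
    then have "y\<^sup>2 / 4 \<le> (sin y)\<^sup>2" by (simp add: power_divide)
    then have "(real n)\<^sup>2 / pi\<^sup>2 * (y\<^sup>2 / 4) \<le> (real n)\<^sup>2 / pi\<^sup>2 * (sin y)\<^sup>2" by (intro mult_left_mono) auto
    then show ?thesis unfolding sy xy by simp
  qed
qed

text \<open>Half of the decay absorbs the polynomial factor; 128 = 2 * 8^2 comes from the quadratic
  Taylor term of \<open>exp (y / 8)\<close>.\<close>

lemma square_exp_bound:
  fixes y :: real
  assumes "y \<ge> 0" shows "y\<^sup>2 * exp (- y / 4) \<le> 128 * exp (- y / 8)"
proof -
  have "(y / 8)\<^sup>2 / 2 \<le> exp (y / 8)" using exp_lower_Taylor_quadratic[of "y / 8"] assms by simp
  then have "y\<^sup>2 \<le> 128 * exp (y / 8)" by (simp add: power_divide)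
  then have "y\<^sup>2 * exp (- y / 4) \<le> (128 * exp (y / 8)) * exp (- y / 4)" by (intro mult_right_mono) auto
  also have "\<dots> = 128 * exp (- y / 8)" by (simp add: mult.assoc exp_add[symmetric])
  finally show ?thesis .
qed

text \<open>Inside the window the exponents differ by a quartic term over n^2, which the decay
  absorbs; outside, the kernel is 0 and the Gaussian itself is small because |x| is at least n/2.
  The Gaussian factor kept in the bound lets it be summed or integrated.\<close>

lemma window_kernel_approx:
  assumes n: "n > 0" and t: "t > 0"
  shows "\<bar>window_kernel n t x - exp (- t * x\<^sup>2)\<bar> \<le> 512 / ((real n)\<^sup>2 * t) * exp (- t / 8 * x\<^sup>2)"
proof (cases "- real n < 2 * x \<and> 2 * x \<le> n")
  case True
  define \<phi> where "\<phi> = circle_symbol n x"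
  have b: "\<phi> \<le> x\<^sup>2" "x\<^sup>2 - \<phi> \<le> pi\<^sup>2 * x ^ 4 / (3 * (real n)\<^sup>2)" "x\<^sup>2 / 4 \<le> \<phi>"
    using circle_symbol_bounds[OF n, of x] True by (auto simp: \<phi>_def)
  have "exp (- t * \<phi>) - exp (- t * x\<^sup>2) = exp (- t * \<phi>) * (1 - exp (- (t * (x\<^sup>2 - \<phi>))))"
    by (simp add: right_diff_distrib exp_add[symmetric] algebra_simps)
  also have "\<dots> \<le> exp (- t * \<phi>) * (t * (x\<^sup>2 - \<phi>))"
    using exp_ge_add_one_self[of "- (t * (x\<^sup>2 - \<phi>))"] by (intro mult_left_mono) auto
  also have "\<dots> \<le> exp (- t * (x\<^sup>2 / 4)) * (t * (pi\<^sup>2 * x ^ 4 / (3 * (real n)\<^sup>2)))"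
    using b t by (intro mult_mono) (auto simp: mult_left_mono)
  also have "\<dots> = (pi\<^sup>2 / (3 * (real n)\<^sup>2 * t)) * ((t * x\<^sup>2)\<^sup>2 * exp (- (t * x\<^sup>2) / 4))"
    using t n by (simp add: field_simps power2_eq_square power4_eq_xxxx)
  also have "\<dots> \<le> (pi\<^sup>2 / (3 * (real n)\<^sup>2 * t)) * (128 * exp (- (t * x\<^sup>2) / 8))"
    using t by (intro mult_left_mono square_exp_bound) auto
  also have "\<dots> = (pi\<^sup>2 * 128 / 3) / ((real n)\<^sup>2 * t) * exp (- t / 8 * x\<^sup>2)"
    using t n by (simp add: field_simps)
  also have "\<dots> \<le> 512 / ((real n)\<^sup>2 * t) * exp (- t / 8 * x\<^sup>2)"
  proof -
    have "pi * pi \<le> 3.4 * 3.4" using pi_approx by (intro mult_mono) auto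
    then have "pi\<^sup>2 * 128 / 3 \<le> 512" by (simp add: power2_eq_square)
    then show ?thesis using t n by (intro mult_right_mono divide_right_mono) auto
  qed
  finally have "exp (- t * \<phi>) - exp (- t * x\<^sup>2) \<le> 512 / ((real n)\<^sup>2 * t) * exp (- t / 8 * x\<^sup>2)" .
  moreover have "exp (- t * \<phi>) - exp (- t * x\<^sup>2) \<ge> 0" using b t by simp
  ultimately show ?thesis using True by (simp add: window_kernel_def \<phi>_def)
next
  case False
  then have "real n \<le> \<bar>2 * x\<bar>" by auto
  then have "(real n)\<^sup>2 \<le> \<bar>2 * x\<bar>\<^sup>2" by (intro power_mono) auto
  then have nx: "(real n)\<^sup>2 \<le> 4 * x\<^sup>2" by (simp add: power_mult_distrib)
  have "x \<noteq> 0" using False n by auto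
  \<comment> \<open>Seven eighths of the exponent pay for the factor 1 / (n^2 t); the last eighth is
    the Gaussian in the bound.\<close>
  define z where "z = 7 / 8 * (t * x\<^sup>2)"
  have z: "z > 0" using t \<open>x \<noteq> 0\<close> by (simp add: z_def)
  have "z \<le> exp z" using exp_ge_add_one_self[of z] by linarith
  then have "z * exp (- z) \<le> 1" by (simp add: exp_minus field_simps)
  then have "exp (- z) \<le> 1 / z" using z by (simp add: field_simps)
  also have "\<dots> \<le> 512 / ((real n)\<^sup>2 * t)"
  proof -
    have "(real n)\<^sup>2 * t \<le> 4 * x\<^sup>2 * t" using nx t by (intro mult_right_mono) auto
    also have "\<dots> \<le> 512 * z" using t by (simp add: z_def)
    finally show ?thesis using z n t by (simp add: field_simps)
  qed
  finally have "exp (- z) * exp (- t / 8 * x\<^sup>2) \<le> 512 / ((real n)\<^sup>2 * t) * exp (- t / 8 * x\<^sup>2)"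
    by (intro mult_right_mono) auto
  moreover have "exp (- z) * exp (- t / 8 * x\<^sup>2) = exp (- t * x\<^sup>2)"
    unfolding exp_add[symmetric] z_def by (simp add: field_simps)
  ultimately show ?thesis using False by (auto simp: window_kernel_def)
qed

lemma has_sum_exp_abs:
  assumes t: "(t::real) > 0"
  shows "((\<lambda>k. exp (- t * \<bar>real_of_int k\<bar>)) has_sum (exp (- t) / (1 - exp (- t)))) {1..}"
    and "((\<lambda>k. exp (- t * \<bar>real_of_int k\<bar>)) has_sum (exp (- t) / (1 - exp (- t)))) {..-1}"
proof -
  have "(\<lambda>k. exp (- t) * exp (- t) ^ k) sums (exp (- t) * (1 / (1 - exp (- t))))"
    using t by (intro sums_mult geometric_sums) simp
  then have "((\<lambda>k. exp (- t) * exp (- t) ^ k) has_sum (exp (- t) / (1 - exp (- t)))) UNIV"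
    by (intro sums_nonneg_imp_has_sum) auto
  then have base: "((\<lambda>k::nat. exp (- t * (real k + 1))) has_sum (exp (- t) / (1 - exp (- t)))) UNIV"
    by (simp add: exp_of_nat_mult[symmetric] exp_add[symmetric] algebra_simps)
  have b1: "bij_betw (\<lambda>k::nat. int k + 1) UNIV {1..}"
    by (rule bij_betw_byWitness[where f' = "\<lambda>k. nat (k - 1)"]) auto
  have b2: "bij_betw (\<lambda>k::nat. - int k - 1) UNIV {..-1}"
    by (rule bij_betw_byWitness[where f' = "\<lambda>k. nat (- k - 1)"]) auto
  show "((\<lambda>k. exp (- t * \<bar>real_of_int k\<bar>)) has_sum (exp (- t) / (1 - exp (- t)))) {1..}"
    using base by (subst has_sum_reindex_bij_betw[OF b1, symmetric]) (simp add: add.commute)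
  have *: "\<bar>real_of_int (- int k - 1)\<bar> = real k + 1" for k by simp
  show "((\<lambda>k. exp (- t * \<bar>real_of_int k\<bar>)) has_sum (exp (- t) / (1 - exp (- t)))) {..-1}"
    using base by (subst has_sum_reindex_bij_betw[OF b2, symmetric]) (simp only: *)
qed

lemma int_minus_0_split: "UNIV - {0::int} = {1..} \<union> {..-1}" by auto

lemma exp_sq_le: "t > 0 \<Longrightarrow> exp (- t * (real_of_int k)\<^sup>2) \<le> exp (- t * \<bar>real_of_int k\<bar>)"
proof -
  assume t: "t > 0"
  have "\<bar>k\<bar> \<le> k\<^sup>2" using self_le_power[of "\<bar>k\<bar>" 2] by (cases "k = 0") auto
  then have "\<bar>real_of_int k\<bar> \<le> (real_of_int k)\<^sup>2" by (metis of_int_abs of_int_le_iff of_int_power)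
  then show ?thesis using t by simp
qed

lemma theta_summable:
  assumes t: "t > 0"
  shows "(\<lambda>k::int. exp (- t * (real_of_int k)\<^sup>2)) summable_on A"
proof (rule summable_on_subset_banach)
  have "((\<lambda>k. exp (- t * \<bar>real_of_int k\<bar>)) has_sum (exp (- t) / (1 - exp (- t)) + exp (- t) / (1 - exp (- t)))) ({1..} \<union> {..-1})"
    by (rule has_sum_Un_disjoint[OF has_sum_exp_abs[OF t]]) auto
  then have "(\<lambda>k. exp (- t * \<bar>real_of_int k\<bar>)) summable_on (UNIV - {0})"
    unfolding int_minus_0_split by (rule has_sum_imp_summable)
  then have "(\<lambda>k. exp (- t * (real_of_int k)\<^sup>2)) summable_on (UNIV - {0::int})"
    by (rule summable_on_comparison_test) (use exp_sq_le[OF t] in auto)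
  then have "(\<lambda>k. exp (- t * (real_of_int k)\<^sup>2)) summable_on insert (0::int) (UNIV - {0})"
    by (subst summable_on_insert_iff) simp
  then show "(\<lambda>k. exp (- t * (real_of_int k)\<^sup>2)) summable_on (UNIV :: int set)"
    by (simp add: insert_UNIV)
qed auto

lemma theta_has_sum:
  "t > 0 \<Longrightarrow> ((\<lambda>k::int. exp (- t * (real_of_int k)\<^sup>2)) has_sum theta t) UNIV"
  unfolding theta_def by (rule has_sum_infsum[OF theta_summable])

lemma theta_minus_1_has_sum:
  assumes "t > 0" shows "((\<lambda>k::int. exp (- t * (real_of_int k)\<^sup>2)) has_sum (theta t - 1)) (UNIV - {0})"
  using has_sum_Diff[OF theta_has_sum[OF assms] has_sum_finite[of "{0::int}"]] by simp

text \<open>Comparison with the geometric series in |k|. The second bound serves large times, the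
  third controls the growth at small ones.\<close>

lemma theta_minus_1_bounds:
  assumes t: "t > 0" shows "0 \<le> theta t - 1" "theta t - 1 \<le> 2 * exp (- t) / (1 - exp (- t))" "theta t - 1 \<le> 2 / t"
proof -
  show "0 \<le> theta t - 1"
    by (rule has_sum_nonneg[OF theta_minus_1_has_sum[OF t]]) auto
  have h: "((\<lambda>k. exp (- t * \<bar>real_of_int k\<bar>)) has_sum (exp (- t) / (1 - exp (- t)) + exp (- t) / (1 - exp (- t)))) ({1..} \<union> {..-1})"
    by (rule has_sum_Un_disjoint[OF has_sum_exp_abs[OF t]]) auto
  have "theta t - 1 \<le> exp (- t) / (1 - exp (- t)) + exp (- t) / (1 - exp (- t))"
    by (rule has_sum_mono[OF theta_minus_1_has_sum[OF t, unfolded int_minus_0_split] h]) (rule exp_sq_le[OF t])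
  then show *: "theta t - 1 \<le> 2 * exp (- t) / (1 - exp (- t))" by simp
  have "exp (- t) / (1 - exp (- t)) = 1 / (exp t - 1)" using t by (simp add: exp_minus field_simps)
  also have "\<dots> \<le> 1 / t"
  proof (rule divide_left_mono)
    show "t \<le> exp t - 1" using exp_ge_add_one_self[of t] by linarith
  qed (use t in auto)
  finally show "theta t - 1 \<le> 2 / t" using * by simp
qed

lemma circle_symbol_periodic: "n > 0 \<Longrightarrow> circle_symbol n (x + real n) = circle_symbol n x"
  by (simp add: circle_symbol_def distrib_left add_divide_distrib)

lemma disc_theta_window:
  assumes n: "n > 0"
  shows "((\<lambda>k::int. window_kernel n t (real_of_int k)) has_sum disc_theta n t) UNIV"
proof -
  \<comment> \<open>Strict on the left only: for even \<open>n\<close> the residue class of n/2 must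
    occur exactly once.\<close>
  define W where "W = {k::int. - int n < 2 * k \<and> 2 * k \<le> int n}"
  have fin: "finite W" by (rule finite_subset[of _ "{- int n..int n}"]) (auto simp: W_def)
  define f where "f k = exp (- t * circle_symbol n (real_of_int k))" for k
  have "((\<lambda>k::int. window_kernel n t (real_of_int k)) has_sum (\<Sum>k\<in>W. f k)) W"
    by (rule has_sum_finiteI[OF fin]) (auto simp: window_kernel_def W_def f_def intro!: sum.cong)
  then have "((\<lambda>k::int. window_kernel n t (real_of_int k)) has_sum (\<Sum>k\<in>W. f k)) UNIV"
    by (subst has_sum_cong_neutral[of W UNIV]) (auto simp: window_kernel_def W_def)
  moreover have "(\<Sum>k\<in>W. f k) = (\<Sum>k\<in>{0..<int n}. f k)"
  proof (rule sum.reindex_bij_witness[of _ "\<lambda>k. if 2 * k \<le> int n then k else k - int n" "\<lambda>k. if k < 0 then k + int n else k"])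
    fix k assume "k \<in> W"
    then show "f (if k < 0 then k + int n else k) = f k"
      using circle_symbol_periodic[OF n, of "real_of_int k"] by (auto simp: f_def)
  qed (use n in \<open>auto simp: W_def\<close>)
  ultimately show ?thesis by (simp add: disc_theta_def f_def circle_symbol_def)
qed

lemma abs_has_sum_le:
  fixes f g :: "'a \<Rightarrow> real"
  assumes "(f has_sum a) A" "(g has_sum b) A" "\<And>x. x \<in> A \<Longrightarrow> \<bar>f x\<bar> \<le> g x"
  shows "\<bar>a\<bar> \<le> b"
proof -
  have "a \<le> b" by (rule has_sum_mono[OF assms(1,2)]) (use assms(3) in fastforce)
  moreover have "((\<lambda>x. - f x) has_sum - a) A" using assms(1) by (simp add: has_sum_uminus)
  then have "- a \<le> b" by (rule has_sum_mono[OF _ assms(2)]) (use assms(3) in fastforce)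
  ultimately show ?thesis by linarith
qed

theorem disc_theta_approx:
  assumes n: "n > 0" and t: "t > 0"
  shows "\<bar>disc_theta n t - theta t\<bar> \<le> 512 / ((real n)\<^sup>2 * t) * (theta (t / 8) - 1)"
proof -
  have d: "((\<lambda>k::int. window_kernel n t (real_of_int k) - exp (- t * (real_of_int k)\<^sup>2)) has_sum (disc_theta n t - theta t)) UNIV"
    using has_sum_add[OF disc_theta_window[OF n] has_sum_uminus[THEN iffD2], of _ "- theta t" t] theta_has_sum[OF t] by simp
  \<comment> \<open>Both functions are 1 at frequency 0. Without this term the bound involves
    \<open>theta (t / 8) - 1\<close>, which is at most 16 / t, so the error is of order 1 / (n t)^2
    for all times.\<close>
  have d0: "((\<lambda>k::int. window_kernel n t (real_of_int k) - exp (- t * (real_of_int k)\<^sup>2)) has_sum (disc_theta n t - theta t)) (UNIV - {0})"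
    by (rule iffD1[OF has_sum_cong_neutral d]) (use n in \<open>auto simp: window_kernel_def circle_symbol_def\<close>)
  have b: "((\<lambda>k::int. 512 / ((real n)\<^sup>2 * t) * exp (- (t / 8) * (real_of_int k)\<^sup>2)) has_sum (512 / ((real n)\<^sup>2 * t) * (theta (t / 8) - 1))) (UNIV - {0})"
    using t by (intro has_sum_cmult_right theta_minus_1_has_sum) auto
  show ?thesis
    by (rule abs_has_sum_le[OF d0 b]) (use window_kernel_approx[OF n t] in auto)
qed

section \<open>Gaussian integrals in place of Gaussian sums\<close>

lemma gaussian_integral:
  assumes t: "t > 0"
  shows "integrable lborel (\<lambda>x. exp (- t * x\<^sup>2))" "(\<integral>x. exp (- t * x\<^sup>2) \<partial>lborel) = sqrt (pi / t)"
proof -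
  define \<sigma> where "\<sigma> = sqrt (1 / (2 * t))"
  have \<sigma>: "\<sigma> > 0" "\<sigma>\<^sup>2 = 1 / (2 * t)" using t by (auto simp: \<sigma>_def)
  have e: "normal_density 0 \<sigma> x * sqrt (pi / t) = exp (- t * x\<^sup>2)" for x
    using t by (simp add: normal_density_def \<sigma>(2) real_sqrt_divide field_simps)
  have "integrable lborel (\<lambda>x. normal_density 0 \<sigma> x * sqrt (pi / t))"
    using \<sigma> by (intro integrable_mult_left) simp
  then show "integrable lborel (\<lambda>x. exp (- t * x\<^sup>2))" by (simp only: e)
  have "(\<integral>x. normal_density 0 \<sigma> x * sqrt (pi / t) \<partial>lborel) = sqrt (pi / t)"
    using \<sigma> by simp
  then show "(\<integral>x. exp (- t * x\<^sup>2) \<partial>lborel) = sqrt (pi / t)" by (simp only: e)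
qed

text \<open>The substitution x = n y carries the unit period in \<open>walk_return\<close> to the
  window of length \<open>n\<close>.\<close>

lemma walk_return_window:
  assumes n: "n > 0" and tu: "t * (real n)\<^sup>2 = 4 * pi\<^sup>2 * u"
  shows "integrable lborel (window_kernel n t)" "(\<integral>x. window_kernel n t x \<partial>lborel) = n * walk_return u"
proof -
  define f where "f x = exp (- t * circle_symbol n x)" for x
  have cf: "continuous_on S f" for S unfolding f_def circle_symbol_def using n by (intro continuous_intros) auto
  have "(f has_integral n * walk_return u) {- real n / 2..real n / 2}"
  proof -
    have "exp (- u * (2 - 2 * cos (2 * pi * y))) = f (n * y)" for y :: real
    proof -
      have "cos (2 * (pi * y)) = 1 - 2 * (sin (pi * y))\<^sup>2" by (rule cos_double_sin)
      then have "u * (2 - 2 * cos (2 * pi * y)) = 4 * u * (sin (pi * y))\<^sup>2" by (simp add: mult.assoc)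
      moreover have "t * circle_symbol n (n * y) = 4 * u * (sin (pi * y))\<^sup>2"
        using tu n by (simp add: circle_symbol_def field_simps)
      ultimately show ?thesis by (simp add: f_def)
    qed
    then have wr: "walk_return u = integral {-1/2..1/2} (\<lambda>y. f (n * y))" by (simp add: walk_return_def)
    have "((\<lambda>y. f (n * y)) has_integral walk_return u) (cbox (-1/2) (1/2))"
      unfolding wr cbox_interval by (intro integrable_integral integrable_continuous_real continuous_on_compose2[OF cf] continuous_intros) auto
    then have "((\<lambda>y. f (n * ((1 / real n) * y + 0))) has_integral (1 / \<bar>1 / real n\<bar> ^ DIM(real)) *\<^sub>R walk_return u)
        ((\<lambda>x. (1 / (1 / real n)) *\<^sub>R x + - ((1 / (1 / real n)) *\<^sub>R 0)) ` cbox (-1/2) (1/2))"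
      using has_integral_affinity[of "\<lambda>y. f (n * y)" "walk_return u" "-1/2" "1/2" "1 / real n" 0] n by simp
    moreover have "(\<lambda>x. (1 / (1 / real n)) *\<^sub>R x + - ((1 / (1 / real n)) *\<^sub>R 0)) ` cbox (-1/2) (1/2) = {- real n / 2..real n / 2}"
      using n image_affinity_cbox[of "real n" 0 "-1/2" "1/2::real"] by simp
    ultimately show ?thesis using n by simp
  qed
  moreover have si: "set_integrable lborel {- real n / 2..real n / 2} f"
    by (rule borel_integrable_atLeastAtMost') (rule cf)
  ultimately have LI: "(LINT x:{- real n / 2..real n / 2}|lborel. f x) = n * walk_return u"
    using set_borel_integral_eq_integral(2) integral_unique by metis
  \<comment> \<open>Interval and window differ in the left end point.\<close>
  have ae: "AE x in lborel. indicator {- real n / 2..real n / 2} x *\<^sub>R f x = window_kernel n t x"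
    by (rule AE_I'[of "{- real n / 2}"]) (auto simp: window_kernel_def f_def indicator_def)
  have m: "window_kernel n t \<in> borel_measurable lborel"
    unfolding window_kernel_def circle_symbol_def by measurable
  have m2: "(\<lambda>x. indicator {- real n / 2..real n / 2} x *\<^sub>R f x) \<in> borel_measurable lborel"
    using si unfolding set_integrable_def by auto
  show "integrable lborel (window_kernel n t)"
    using integrable_cong_AE[OF m2 m ae] si unfolding set_integrable_def by simp
  show "(\<integral>x. window_kernel n t x \<partial>lborel) = n * walk_return u"
    using integral_cong_AE[OF m2 m ae] LI unfolding set_lebesgue_integral_def by simp
qed

theorem walk_return_approx:
  assumes n: "n > 0" and t: "t > 0" and tu: "t * (real n)\<^sup>2 = 4 * pi\<^sup>2 * u"
  shows "\<bar>n * walk_return u - sqrt (pi / t)\<bar> \<le> 512 / ((real n)\<^sup>2 * t) * sqrt (8 * pi / t)"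
proof -
  note W = walk_return_window[OF n tu] and G = gaussian_integral[OF t]
  have G8: "integrable lborel (\<lambda>x. exp (- t / 8 * x\<^sup>2))" "(\<integral>x. exp (- t / 8 * x\<^sup>2) \<partial>lborel) = sqrt (8 * pi / t)"
    using gaussian_integral[of "t / 8"] t by (auto simp: mult_ac)
  have "n * walk_return u - sqrt (pi / t) = (\<integral>x. window_kernel n t x - exp (- t * x\<^sup>2) \<partial>lborel)"
    by (subst Bochner_Integration.integral_diff[OF W(1) G(1)]) (simp only: W(2) G(2))
  also have "\<bar>\<dots>\<bar> \<le> (\<integral>x. \<bar>window_kernel n t x - exp (- t * x\<^sup>2)\<bar> \<partial>lborel)" by (rule integral_abs_bound)
  also have "\<dots> \<le> (\<integral>x. 512 / ((real n)\<^sup>2 * t) * exp (- t / 8 * x\<^sup>2) \<partial>lborel)"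
    using W(1) G(1) G8(1) by (intro integral_mono window_kernel_approx n t) auto
  also have "\<dots> = 512 / ((real n)\<^sup>2 * t) * sqrt (8 * pi / t)" using G8(2) by simp
  finally show ?thesis .
qed

section \<open>Uniform estimates for heat traces\<close>

definition plane_theta :: "nat \<Rightarrow> real \<Rightarrow> real" where
  "plane_theta n t = n * walk_return (t * (real n)\<^sup>2 / (4 * pi\<^sup>2))"

lemma plane_theta_arg: "t * (real n)\<^sup>2 = 4 * pi\<^sup>2 * (t * (real n)\<^sup>2 / (4 * pi\<^sup>2))"
  by simp

text \<open>Carries estimates from the circle to the m-fold torus. Division by \<open>M\<close>
  brings both numbers into the unit ball, where the power is Lipschitz with constant
  \<open>m\<close>.\<close>

lemma power_diff_le:
  fixes a b M :: real
  assumes "0 \<le> a" "a \<le> M" "0 \<le> b" "b \<le> M"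
  shows "\<bar>a ^ m - b ^ m\<bar> \<le> m * M ^ (m - 1) * \<bar>a - b\<bar>"
proof (cases "M = 0 \<or> m = 0")
  case True
  then show ?thesis using assms by auto
next
  case False
  then have M: "M > 0" using assms by auto
  have "\<bar>(a / M) ^ m - (b / M) ^ m\<bar> \<le> m * \<bar>a / M - b / M\<bar>"
    using norm_power_diff[of "a / M" "b / M" m] assms M by auto
  then have "M ^ m * \<bar>(a / M) ^ m - (b / M) ^ m\<bar> \<le> M ^ m * (m * \<bar>a / M - b / M\<bar>)"
    using M by (intro mult_left_mono) auto
  moreover have "M ^ m * \<bar>(a / M) ^ m - (b / M) ^ m\<bar> = \<bar>a ^ m - b ^ m\<bar>"
    using M by (simp add: power_divide diff_divide_distrib[symmetric])
  moreover have "M ^ m * (m * \<bar>a / M - b / M\<bar>) = m * M ^ (m - 1) * \<bar>a - b\<bar>"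
    using M False by (cases m) (simp_all add: diff_divide_distrib[symmetric])
  ultimately show ?thesis by simp
qed

lemma cosh_minus_1_le:
  assumes "0 \<le> a" "a \<le> (1::real)" shows "cosh a - 1 \<le> a\<^sup>2"
proof -
  have "exp a \<le> 1 + a + a\<^sup>2" using exp_bound assms by simp
  moreover have "exp (- a) \<le> 1 - a + a\<^sup>2"
  proof -
    have "exp (- a) \<le> 1 / (1 + a)" using exp_ge_add_one_self[of a] assms by (simp add: exp_minus field_simps)
    also have "\<dots> \<le> 1 - a + a\<^sup>2"
    proof -
      have "(1 - a + a\<^sup>2) * (1 + a) = 1 + a ^ 3" by (simp add: algebra_simps power2_eq_square power3_eq_cube)
      then have "1 \<le> (1 - a + a\<^sup>2) * (1 + a)" using assms by simp
      then show ?thesis using assms by (simp add: pos_divide_le_eq)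
    qed
    finally show ?thesis .
  qed
  ultimately have "exp a + exp (- a) \<le> (1 + a + a\<^sup>2) + (1 - a + a\<^sup>2)" by (rule add_mono)
  also have "\<dots> = 2 * (1 + a\<^sup>2)" by simp
  finally have "(exp a + exp (- a)) / 2 - 1 \<le> a\<^sup>2" by (simp add: field_simps)
  then show ?thesis by (simp only: cosh_field_def)
qed

lemma cosh_minus_1_ge:
  assumes "q \<ge> 1" shows "(A::real) ^ (2 * q) / fact (2 * q) \<le> cosh A - 1"
proof -
  have s: "(\<lambda>n. if even n then A ^ n /\<^sub>R fact n else 0) sums cosh A" by (rule cosh_converges)
  have "(\<Sum>n\<in>{0, 2 * q}. if even n then A ^ n /\<^sub>R fact n else 0) \<le> cosh A"
  proof (rule sum_le_suminf[where f = "\<lambda>n. if even n then A ^ n /\<^sub>R fact n else 0", unfolded sums_unique[OF s, symmetric]])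
    show "summable (\<lambda>n. if even n then A ^ n /\<^sub>R fact n else 0)" using s by (rule sums_summable)
  qed (auto simp: zero_le_even_power)
  then show ?thesis using assms by (simp add: divide_inverse mult.commute)
qed

text \<open>This is \<open>disc_theta_alias\<close> with \<open>a = A / n\<close>. The exponent in
  the numerator is of order A^2 t, so \<open>A\<close> may grow up to t^(-1/2), while
  \<open>cosh A - 1\<close> exceeds any power of \<open>A\<close> up to a constant. With A =
  t^(-1/2) the error is at most a constant times n t^q, for every \<open>q\<close>.\<close>

lemma disc_theta_plane_alias:
  assumes n: "n > 0" and t: "t > 0" and A: "A > 0" "A \<le> n" "A\<^sup>2 * t \<le> 1" and q: "q \<ge> 1"
  shows "0 \<le> disc_theta n t - plane_theta n t"
    and "disc_theta n t - plane_theta n t \<le> n * (A\<^sup>2 * t) * fact (2 * q) / A ^ (2 * q)"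
proof -
  define u where "u = t * (real n)\<^sup>2 / (4 * pi\<^sup>2)"
  have u: "u \<ge> 0" using t by (simp add: u_def)
  have pt: "plane_theta n t = n * walk_return u" by (simp add: plane_theta_def u_def)
  define a where "a = A / n"
  have a: "a > 0" "a \<le> 1" using A n by (auto simp: a_def)
  note al = disc_theta_alias[OF n u a(1) plane_theta_arg[of t n, folded u_def]]
  show "0 \<le> disc_theta n t - plane_theta n t" unfolding pt by (rule al(1))
  define y where "y = 2 * u * (cosh a - 1)"
  have an: "a * n = A" using n by (simp add: a_def)
  have y0: "y \<ge> 0" unfolding y_def using u cosh_real_ge_1[of a] by simp
  have "y \<le> 2 * u * a\<^sup>2" unfolding y_def using u a by (intro mult_left_mono cosh_minus_1_le) auto
  also have "\<dots> = A\<^sup>2 * t / (2 * pi\<^sup>2)" using n by (simp add: u_def a_def power_divide field_simps)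
  also have "\<dots> \<le> A\<^sup>2 * t / 2"
  proof -
    have "1 \<le> pi\<^sup>2" using pi_ge_two by (simp add: power2_eq_square) (metis mult_mono' one_le_numeral order_trans mult_1 zero_le_one)
    then show ?thesis using t by (intro divide_left_mono) auto
  qed
  finally have y: "y \<le> A\<^sup>2 * t / 2" .
  have y1: "y \<le> 1" using y A(3) by linarith
  have "exp y - 1 \<le> y + y\<^sup>2" using exp_bound[of y] y0 y1 by simp
  also have "\<dots> \<le> 2 * y" using y0 y1 by (simp add: power2_eq_square mult_left_le)
  also have "\<dots> \<le> A\<^sup>2 * t" using y by simp
  finally have ey: "exp y - 1 \<le> A\<^sup>2 * t" .
  have "disc_theta n t - plane_theta n t \<le> n * (exp y - 1) / (cosh A - 1)"
    using al(2) unfolding pt y_def an .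
  also have "\<dots> \<le> n * (A\<^sup>2 * t) / (A ^ (2 * q) / fact (2 * q))"
    using ey A y0 t n by (intro frac_le mult_left_mono cosh_minus_1_ge q) auto
  also have "\<dots> = n * (A\<^sup>2 * t) * fact (2 * q) / A ^ (2 * q)" by simp
  finally show "disc_theta n t - plane_theta n t \<le> n * (A\<^sup>2 * t) * fact (2 * q) / A ^ (2 * q)" .
qed

lemma walk_return_nonneg: "walk_return u \<ge> 0"
  unfolding walk_return_def by (rule integral_nonneg) (auto intro!: integrable_continuous_real continuous_intros)

lemma plane_theta_nonneg: "plane_theta n t \<ge> 0"
  by (simp add: plane_theta_def walk_return_nonneg)

lemma disc_theta_nonneg: "disc_theta n t \<ge> 0"
  by (simp add: disc_theta_def sum_nonneg)

lemma disc_theta_le_n: "t \<ge> 0 \<Longrightarrow> disc_theta n t \<le> n"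
  unfolding disc_theta_def by (rule order_trans[OF sum_bounded_above[where K = 1]]) auto

lemma plane_theta_le_disc:
  assumes n: "n > 0" and t: "t > 0"
  shows "plane_theta n t \<le> disc_theta n t"
proof -
  \<comment> \<open>The sign follows from any admissible \<open>A\<close>; this one stays at most 1,
    so that \<open>n\<close> = 1 is covered.\<close>
  define A where "A = (if t \<le> 1 then 1 else 1 / sqrt t)"
  have "A > 0" "A \<le> 1" "A\<^sup>2 * t \<le> 1" using t by (auto simp: A_def power_divide)
  moreover have "A \<le> n" using \<open>A \<le> 1\<close> n by simp
  ultimately show ?thesis using disc_theta_plane_alias(1)[OF n t, of A 1] by simp
qed

text \<open>A majorant independent of \<open>n\<close>, from the quadratic lower bound on the symbol
  over the window.\<close>

lemma disc_theta_le_theta: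
  assumes n: "n > 0" and t: "t > 0"
  shows "disc_theta n t \<le> theta (t / 4)"
proof (rule has_sum_mono[OF disc_theta_window[OF n] theta_has_sum])
  fix k :: int
  show "window_kernel n t (real_of_int k) \<le> exp (- (t / 4) * (real_of_int k)\<^sup>2)"
  proof (cases "\<bar>2 * real_of_int k\<bar> \<le> n")
    case True
    then have "t * ((real_of_int k)\<^sup>2 / 4) \<le> t * circle_symbol n (real_of_int k)"
      using circle_symbol_bounds(3)[OF n True] t by (intro mult_left_mono) auto
    then show ?thesis by (simp add: window_kernel_def)
  qed (auto simp: window_kernel_def)
qed (use t in simp)

lemma disc_theta_approx':
  assumes "n > 0" "t > 0"
  shows "\<bar>disc_theta n t - theta t\<bar> \<le> 8192 / ((real n)\<^sup>2 * t\<^sup>2)"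
proof -
  have "512 / ((real n)\<^sup>2 * t) * (theta (t / 8) - 1) \<le> 512 / ((real n)\<^sup>2 * t) * (2 / (t / 8))"
    using assms by (intro mult_left_mono theta_minus_1_bounds(3)) auto
  also have "\<dots> = 8192 / ((real n)\<^sup>2 * t\<^sup>2)" by (simp add: power2_eq_square mult_ac)
  finally show ?thesis using disc_theta_approx[OF assms] by linarith
qed

lemma plane_theta_approx:
  assumes "n > 0" "t > 0"
  shows "\<bar>plane_theta n t - sqrt (pi / t)\<bar> \<le> 512 / ((real n)\<^sup>2 * t) * sqrt (8 * pi / t)"
  unfolding plane_theta_def by (rule walk_return_approx[OF assms plane_theta_arg])

lemma sqrt_le_self: "x \<ge> 1 \<Longrightarrow> sqrt x \<le> x"
  using real_sqrt_le_mono[of x "x * x"] by (simp add: real_sqrt_mult)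

lemma sqrt_pi_le: "0 < t \<Longrightarrow> t \<le> 1 \<Longrightarrow> sqrt (pi / t) \<le> 4 / t"
proof -
  assume t: "0 < t" "t \<le> 1"
  have "t \<le> pi" using t(2) pi_gt3 by linarith
  then have "sqrt (pi / t) \<le> pi / t" using t by (intro sqrt_le_self) simp
  also have "\<dots> \<le> 4 / t" using t pi_less_4 by (intro divide_right_mono) auto
  finally show ?thesis .
qed

lemma plane_theta_approx':
  assumes "n > 0" "0 < t" "t \<le> 1"
  shows "\<bar>plane_theta n t - sqrt (pi / t)\<bar> \<le> 16384 / ((real n)\<^sup>2 * t\<^sup>2)"
proof -
  have "sqrt (8 * pi / t) = sqrt (pi / (t / 8))" by simp
  also have "\<dots> \<le> 4 / (t / 8)" using assms by (intro sqrt_pi_le) auto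
  finally have "512 / ((real n)\<^sup>2 * t) * sqrt (8 * pi / t) \<le> 512 / ((real n)\<^sup>2 * t) * (4 / (t / 8))"
    using assms by (intro mult_left_mono) auto
  then show ?thesis using plane_theta_approx[OF assms(1,2)] assms by (simp add: power2_eq_square mult_ac)
qed

theorem theta_small_time:
  fixes p :: nat
  obtains C where "C \<ge> 0" "\<And>t. 0 < t \<Longrightarrow> t \<le> 1 \<Longrightarrow> \<bar>theta t - sqrt (pi / t)\<bar> \<le> C * t ^ p"
proof
  \<comment> \<open>Since \<open>n\<close> is of order t^-(p+3) and the aliasing error of order n
    t^q, the exponent q = (p + 3) + p leaves t^p.\<close>
  define q where "q = 2 * p + 3"
  let ?C = "8192 + 16384 + 2 * fact (2 * q) :: real"
  show "?C \<ge> 0" by simp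
  fix t :: real assume t: "0 < t" "t \<le> 1"
  \<comment> \<open>large enough for the approximation errors, yet polynomial in \<open>1/t\<close>, so that the aliasing error stays negligible\<close>
  define n where "n = nat \<lceil>(1 / t) ^ (p + 3)\<rceil>"
  have inv1: "1 \<le> 1 / t" using t by simp
  have n1: "(1 / t) ^ (p + 3) \<le> real n" unfolding n_def by (rule real_nat_ceiling_ge)
  have one: "1 \<le> (1 / t) ^ (p + 3)" using inv1 by (rule one_le_power)
  have n2: "real n \<le> 2 * (1 / t) ^ (p + 3)" using one unfolding n_def by linarith
  have nge1: "1 \<le> real n" using one n1 by linarith
  then have n: "n > 0" by simp
  have "1 / real n \<le> 1 / (1 / t) ^ (p + 3)" using n1 t nge1 by (intro divide_left_mono mult_pos_pos zero_less_power) auto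
  then have in1: "1 / real n \<le> t ^ (p + 3)" by (simp add: power_one_over)
  have n2t: "1 / ((real n)\<^sup>2 * t\<^sup>2) \<le> t ^ p"
  proof -
    have "1 / ((real n)\<^sup>2 * t\<^sup>2) \<le> 1 / (real n * t\<^sup>2)"
      using nge1 t by (intro divide_left_mono mult_right_mono) (auto simp: power2_eq_square)
    also have "\<dots> = (1 / real n) * (1 / t\<^sup>2)" by simp
    also have "\<dots> \<le> t ^ (p + 3) * (1 / t\<^sup>2)" using in1 by (intro mult_right_mono) auto
    also have "\<dots> = t ^ p * t" using t by (simp add: power_add power2_eq_square power3_eq_cube)
    also have "\<dots> \<le> t ^ p" using t by (simp add: mult_left_le)
    finally show ?thesis .
  qed
  have a: "\<bar>disc_theta n t - theta t\<bar> \<le> 8192 * t ^ p"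
    using disc_theta_approx'[OF n t(1)] n2t by simp
  have b: "\<bar>plane_theta n t - sqrt (pi / t)\<bar> \<le> 16384 * t ^ p"
    using plane_theta_approx'[OF n t] n2t by simp
  \<comment> \<open>The largest value that the constraint \<open>A\<^sup>2 * t \<le> 1\<close>
    allows.\<close>
  define A where "A = 1 / sqrt t"
  have A: "A > 0" "A\<^sup>2 * t \<le> 1" and A2: "A\<^sup>2 = 1 / t" using t by (auto simp: A_def power_divide)
  have "A \<ge> 1" using t by (simp add: A_def)
  then have "A \<le> A\<^sup>2" by (intro self_le_power) auto
  also have "\<dots> \<le> (1 / t) ^ (p + 3)" unfolding A2 using inv1 self_le_power[of "1 / t" "p + 3"] by simp
  finally have An: "A \<le> n" using n1 by linarith
  have "disc_theta n t - plane_theta n t \<le> n * (A\<^sup>2 * t) * fact (2 * q) / A ^ (2 * q)"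
    by (rule disc_theta_plane_alias(2)[OF n t(1) A(1) An A(2)]) (simp add: q_def)
  also have "\<dots> = n * (fact (2 * q) * t ^ q)"
    unfolding power_mult A2 using t by (simp add: power_divide)
  also have "\<dots> \<le> (2 * (1 / t) ^ (p + 3)) * (fact (2 * q) * t ^ q)"
    by (rule mult_right_mono[OF n2]) (use t in simp)
  also have "\<dots> = 2 * fact (2 * q) * t ^ p"
  proof -
    have "q = (p + 3) + p" by (simp add: q_def)
    then have "t ^ q = t ^ (p + 3) * t ^ p" by (simp only: power_add)
    moreover have "(1 / t) ^ (p + 3) * t ^ (p + 3) = 1" using t by (simp only: power_mult_distrib[symmetric]) simp
    ultimately show ?thesis by simp
  qed
  finally have c: "disc_theta n t - plane_theta n t \<le> 2 * fact (2 * q) * t ^ p" .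
  show "\<bar>theta t - sqrt (pi / t)\<bar> \<le> ?C * t ^ p"
    using a b c plane_theta_le_disc[OF n t(1)] unfolding distrib_right by linarith
qed

lemma theta_le: "0 < t \<Longrightarrow> t \<le> 1 \<Longrightarrow> theta t \<le> 3 / t"
  using theta_minus_1_bounds(3)[of t] by (simp add: field_simps)

lemma disc_theta_le: "n > 0 \<Longrightarrow> 0 < t \<Longrightarrow> t \<le> 1 \<Longrightarrow> disc_theta n t \<le> 9 / t"
proof -
  assume n: "n > 0" and t: "0 < t" "t \<le> 1"
  have "disc_theta n t \<le> 1 + 2 / (t / 4)"
    using disc_theta_le_theta[OF n t(1)] theta_minus_1_bounds(3)[of "t / 4"] t by simp
  also have "\<dots> \<le> 9 / t" using t by (simp add: field_simps)
  finally show "disc_theta n t \<le> 9 / t" .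
qed

lemma theta_ge_1: "t > 0 \<Longrightarrow> theta t \<ge> 1"
  using theta_minus_1_bounds(1)[of t] by simp

text \<open>Meant for integration against dt/t: the factor \<open>t\<close> secures convergence at
  0, and 1/n is the rate. A direct comparison of the m-th powers has an error of order t^(-m-1) /
  n^2, which is of no use as t tends to 0.\<close>

theorem heat_trace_small_time:
  fixes m :: nat assumes m: "m \<ge> 1"
  obtains C where "C \<ge> 0" "\<And>n t. n > 0 \<Longrightarrow> 0 < t \<Longrightarrow> t \<le> 1 \<Longrightarrow>
    \<bar>(disc_theta n t ^ m - plane_theta n t ^ m) - (theta t ^ m - sqrt (pi / t) ^ m)\<bar> \<le> C * (t / n)"
proof -
  \<comment> \<open>The exponent is (m - 1) + 1 + (m + 2): m - 1 powers are lost in passing to the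
    m-th power of the trace, one gives the factor \<open>t\<close>, and t^(m+2) is below 1/n in the
    second case.\<close>
  obtain C0 where C0: "C0 \<ge> 0" "\<And>t. 0 < t \<Longrightarrow> t \<le> 1 \<Longrightarrow> \<bar>theta t - sqrt (pi / t)\<bar> \<le> C0 * t ^ (2 * m + 2)"
    using theta_small_time[of "2 * m + 2"] by blast
  \<comment> \<open>Chosen such that n t^q = (t / n^m) (n t^(m+2))^(m+1), whose last factor is at
    most 1 in the second case.\<close>
  define q where "q = (m + 2) * (m + 1) + 1"
  define CA where "CA = m * 9 ^ (m - 1) * 24576"
  define CB where "CB = m * (fact (2 * q) :: real)"
  define CH where "CH = m * 4 ^ (m - 1) * C0"
  have nn: "CA \<ge> 0" "CB \<ge> 0" "CH \<ge> 0" using C0 by (auto simp: CA_def CB_def CH_def)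
  have main: "\<bar>(disc_theta n t ^ m - plane_theta n t ^ m) - (theta t ^ m - sqrt (pi / t) ^ m)\<bar> \<le> (CA + CB + CH) * (t / n)"
    if n: "n > 0" and t: "0 < t" "t \<le> 1" for n t
  \<comment> \<open>If so, the discrete traces are close to their limits; otherwise \<open>t\<close> is so small that either difference is.\<close>
  proof (cases "1 \<le> n * t ^ (m + 2)")
    case True
    have "\<bar>disc_theta n t ^ m - theta t ^ m\<bar> \<le> m * (9 / t) ^ (m - 1) * \<bar>disc_theta n t - theta t\<bar>"
    proof (rule power_diff_le)
      have "3 / t \<le> 9 / t" using t by (intro divide_right_mono) auto
      then show "theta t \<le> 9 / t" using theta_le[OF t] by linarith
    qed (use disc_theta_le[OF n t] disc_theta_nonneg theta_ge_1[OF t(1)] in auto)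
    also have "\<dots> \<le> m * (9 / t) ^ (m - 1) * (8192 / ((real n)\<^sup>2 * t\<^sup>2))"
      using t by (intro mult_left_mono disc_theta_approx' n) auto
    finally have 1: "\<bar>disc_theta n t ^ m - theta t ^ m\<bar> \<le> m * (9 / t) ^ (m - 1) * (8192 / ((real n)\<^sup>2 * t\<^sup>2))" .
    have "\<bar>plane_theta n t ^ m - sqrt (pi / t) ^ m\<bar> \<le> m * (9 / t) ^ (m - 1) * \<bar>plane_theta n t - sqrt (pi / t)\<bar>"
    proof (rule power_diff_le)
      have "4 / t \<le> 9 / t" using t by (intro divide_right_mono) auto
      then show "sqrt (pi / t) \<le> 9 / t" using sqrt_pi_le[OF t] by linarith
      show "plane_theta n t \<le> 9 / t" using disc_theta_le[OF n t] plane_theta_le_disc[OF n t(1)] by linarith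
    qed (use plane_theta_nonneg t in auto)
    also have "\<dots> \<le> m * (9 / t) ^ (m - 1) * (16384 / ((real n)\<^sup>2 * t\<^sup>2))"
      using t by (intro mult_left_mono plane_theta_approx' n) auto
    finally have 2: "\<bar>plane_theta n t ^ m - sqrt (pi / t) ^ m\<bar> \<le> m * (9 / t) ^ (m - 1) * (16384 / ((real n)\<^sup>2 * t\<^sup>2))" .
    define X where "X = m * (9 / t) ^ (m - 1) * (1 / ((real n)\<^sup>2 * t\<^sup>2))"
    have 1: "\<bar>disc_theta n t ^ m - theta t ^ m\<bar> \<le> 8192 * X" using 1 by (simp add: X_def mult_ac)
    have 2: "\<bar>plane_theta n t ^ m - sqrt (pi / t) ^ m\<bar> \<le> 16384 * X" using 2 by (simp add: X_def mult_ac)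
    have "\<bar>(disc_theta n t ^ m - plane_theta n t ^ m) - (theta t ^ m - sqrt (pi / t) ^ m)\<bar> \<le> 8192 * X + 16384 * X"
      using 1 2 by linarith
    also have "\<dots> = 24576 * X" by simp
    also have "\<dots> = CA * ((t / n) * (1 / (n * t ^ (m + 2))))"
    proof -
      have "t ^ (m + 2) = t ^ (m - 1) * t * t\<^sup>2" using m by (cases m) (simp_all add: power_add power2_eq_square mult_ac)
      then show ?thesis using t n unfolding X_def CA_def
        by (simp add: power_divide power2_eq_square field_simps)
    qed
    also have "\<dots> \<le> CA * ((t / n) * 1)"
      using True t n nn by (intro mult_left_mono) (auto simp: divide_le_eq_1)
    also have "\<dots> \<le> (CA + CB + CH) * (t / n)" using nn t n by (simp add: divide_right_mono mult_right_mono)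
    finally show ?thesis .
  next
    case False
    have nge1: "1 \<le> real n" using n by simp
    \<comment> \<open>The parameter \<open>A\<close> is limited both by t^(-1/2) and by
      \<open>n\<close>; the case distinction takes the smaller of the two.\<close>
    have D: "disc_theta n t - plane_theta n t \<le> fact (2 * q) * (t / real n ^ m)"
    proof (cases "t * (real n)\<^sup>2 \<ge> 1")
      case True
      define A where "A = 1 / sqrt t"
      have A: "A > 0" "A\<^sup>2 * t \<le> 1" and A2: "A\<^sup>2 = 1 / t" using t by (auto simp: A_def power_divide)
      have "A\<^sup>2 \<le> (real n)\<^sup>2" unfolding A2 using True t by (simp add: field_simps)
      then have An: "A \<le> n" by (rule power2_le_imp_le) simp
      have "disc_theta n t - plane_theta n t \<le> n * (A\<^sup>2 * t) * fact (2 * q) / A ^ (2 * q)"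
        by (rule disc_theta_plane_alias(2)[OF n t(1) A(1) An A(2)]) (simp add: q_def)
      also have "\<dots> = n * (fact (2 * q) * t ^ q)"
        unfolding power_mult A2 using t by (simp add: power_divide)
      also have "\<dots> = fact (2 * q) * (t / real n ^ m) * ((real n * t ^ (m + 2)) ^ (m + 1))"
        using n unfolding q_def power_mult_distrib power_mult[symmetric] by (simp add: power_add field_simps)
      also have "\<dots> \<le> fact (2 * q) * (t / real n ^ m) * 1"
        using False t by (intro mult_left_mono power_le_one) auto
      finally show ?thesis by simp
    next
      case F: False
      have "disc_theta n t - plane_theta n t \<le> n * ((real n)\<^sup>2 * t) * fact (2 * q) / real n ^ (2 * q)"
        by (rule disc_theta_plane_alias(2)[OF n t(1)]) (use n F in \<open>auto simp: q_def mult.commute\<close>)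
      also have "\<dots> = fact (2 * q) * t * (real n ^ 3 / real n ^ (2 * q))" by (simp add: power2_eq_square power3_eq_cube)
      also have "real n ^ 3 / real n ^ (2 * q) \<le> 1 / real n ^ m"
      proof -
        have "m + 3 \<le> 2 * q" by (simp add: q_def)
        then have "real n ^ (m + 3) \<le> real n ^ (2 * q)" using nge1 by (rule power_increasing)
        then show ?thesis using n by (simp add: power_add field_simps)
      qed
      then have "fact (2 * q) * t * (real n ^ 3 / real n ^ (2 * q)) \<le> fact (2 * q) * t * (1 / real n ^ m)"
        using t by (intro mult_left_mono) auto
      finally show ?thesis by simp
    qed
    have "\<bar>disc_theta n t ^ m - plane_theta n t ^ m\<bar> \<le> m * real n ^ (m - 1) * \<bar>disc_theta n t - plane_theta n t\<bar>"
      using disc_theta_le_n[of t n] t disc_theta_nonneg plane_theta_nonneg plane_theta_le_disc[OF n t(1)] 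
      by (intro power_diff_le) (auto intro: order_trans)
    also have "\<dots> \<le> m * real n ^ (m - 1) * (fact (2 * q) * (t / real n ^ m))"
      using D plane_theta_le_disc[OF n t(1)] by (intro mult_left_mono) auto
    also have "\<dots> = CB * (t / n)"
      using n m unfolding CB_def by (cases m) (auto simp: field_simps)
    finally have 1: "\<bar>disc_theta n t ^ m - plane_theta n t ^ m\<bar> \<le> CB * (t / n)" .
    have "\<bar>theta t ^ m - sqrt (pi / t) ^ m\<bar> \<le> m * (4 / t) ^ (m - 1) * \<bar>theta t - sqrt (pi / t)\<bar>"
    proof (rule power_diff_le)
      have "3 / t \<le> 4 / t" using t by (intro divide_right_mono) auto
      then show "theta t \<le> 4 / t" using theta_le[OF t] by linarith
    qed (use sqrt_pi_le[OF t] theta_ge_1[OF t(1)] t in auto)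
    also have "\<dots> \<le> m * (4 / t) ^ (m - 1) * (C0 * t ^ (2 * m + 2))"
      using t by (intro mult_left_mono C0) auto
    also have "\<dots> = CH * (t * t ^ (m + 2))"
    proof -
      have "t ^ (2 * m + 2) = t ^ (m - 1) * (t * t ^ (m + 2))"
        unfolding power_Suc[symmetric] power_add[symmetric] using m by (intro arg_cong2[where f = power]) auto
      then show ?thesis using t by (simp add: CH_def power_divide)
    qed
    also have "\<dots> \<le> CH * (t * (1 / n))"
      using False n t nn by (intro mult_left_mono) (auto simp: field_simps)
    finally have 2: "\<bar>theta t ^ m - sqrt (pi / t) ^ m\<bar> \<le> CH * (t / n)" by simp
    have "CA * (t / n) \<ge> 0" using nn t by simp
    then show ?thesis using 1 2 unfolding distrib_right by linarith
  qed
  show ?thesis by (rule that[of "CA + CB + CH"]) (use nn main in auto)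
qed

text \<open>For t >= 1 all traces are bounded uniformly in \<open>n\<close>, so passing to m-th
  powers costs only a constant; the decay in \<open>t\<close> makes the errors integrable against
  dt/t.\<close>

theorem heat_trace_large_time:
  fixes m :: nat
  obtains C where "C \<ge> 0" "\<And>n t. n > 0 \<Longrightarrow> 1 \<le> t \<Longrightarrow> \<bar>disc_theta n t ^ m - theta t ^ m\<bar> \<le> C / (real n * t)"
    "\<And>n t. n > 0 \<Longrightarrow> 1 \<le> t \<Longrightarrow> \<bar>plane_theta n t ^ m - sqrt (pi / t) ^ m\<bar> \<le> C / (real n * t)"
proof -
  have b: "disc_theta n t \<le> 9" "theta t \<le> 9" "plane_theta n t \<le> 9" "sqrt (pi / t) \<le> 9" "sqrt (8 * pi / t) \<le> 16"
    "1 / ((real n)\<^sup>2 * t) \<le> 1 / (real n * t)" if n: "n > 0" and t: "1 \<le> t" for n t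
  proof -
    have "theta (t / 4) \<le> 1 + 2 / (t / 4)" using theta_minus_1_bounds(3)[of "t / 4"] t by simp
    also have "\<dots> \<le> 9" using t by (simp add: field_simps)
    finally show 1: "disc_theta n t \<le> 9" using disc_theta_le_theta[of n t] n t by simp
    have "theta t \<le> 1 + 2 / t" using theta_minus_1_bounds(3)[of t] t by simp
    also have "\<dots> \<le> 9" using t by (simp add: field_simps)
    finally show "theta t \<le> 9" .
    show "plane_theta n t \<le> 9" using 1 plane_theta_le_disc[of n t] n t by simp
    have "pi / t \<le> 81" using t pi_less_4 by (simp add: field_simps)
    then have "sqrt (pi / t) \<le> sqrt (9\<^sup>2)" by (intro real_sqrt_le_mono) simp
    then show "sqrt (pi / t) \<le> 9" by simp
    have "8 * pi / t \<le> 256" using t pi_less_4 by (simp add: field_simps)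
    then have "sqrt (8 * pi / t) \<le> sqrt (16\<^sup>2)" by (intro real_sqrt_le_mono) simp
    then show "sqrt (8 * pi / t) \<le> 16" by simp
    show "1 / ((real n)\<^sup>2 * t) \<le> 1 / (real n * t)"
      using n t by (intro divide_left_mono mult_right_mono) (auto simp: power2_eq_square)
  qed
  \<comment> \<open>8192 is the constant of \<open>disc_theta_approx'\<close> and also 512 * 16, the
    one for \<open>plane_theta\<close>, so a single \<open>C\<close> serves both.\<close>
  define C where "C = real m * 9 ^ (m - 1) * 8192"
  have C: "C \<ge> 0" by (simp add: C_def)
  have 1: "\<bar>disc_theta n t ^ m - theta t ^ m\<bar> \<le> C / (real n * t)" if n: "n > 0" and t: "1 \<le> t" for n t
  proof -
    have "\<bar>disc_theta n t ^ m - theta t ^ m\<bar> \<le> real m * 9 ^ (m - 1) * \<bar>disc_theta n t - theta t\<bar>"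
      using b[OF n t] disc_theta_nonneg theta_ge_1[of t] t by (intro power_diff_le) auto
    also have "\<dots> \<le> real m * 9 ^ (m - 1) * (8192 * (1 / ((real n)\<^sup>2 * t)))"
    proof (intro mult_left_mono)
      have "\<bar>disc_theta n t - theta t\<bar> \<le> 8192 / ((real n)\<^sup>2 * t\<^sup>2)" using disc_theta_approx'[of n t] n t by simp
      also have "\<dots> \<le> 8192 / ((real n)\<^sup>2 * t)" using n t
        by (intro divide_left_mono mult_left_mono) (auto simp: power2_eq_square)
      finally show "\<bar>disc_theta n t - theta t\<bar> \<le> 8192 * (1 / ((real n)\<^sup>2 * t))" by simp
    qed auto
    also have "\<dots> \<le> real m * 9 ^ (m - 1) * (8192 * (1 / (real n * t)))"
      using b(6)[OF n t] by (intro mult_left_mono) auto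
    finally show ?thesis by (simp add: C_def)
  qed
  have 2: "\<bar>plane_theta n t ^ m - sqrt (pi / t) ^ m\<bar> \<le> C / (real n * t)" if n: "n > 0" and t: "1 \<le> t" for n t
  proof -
    have "\<bar>plane_theta n t ^ m - sqrt (pi / t) ^ m\<bar> \<le> real m * 9 ^ (m - 1) * \<bar>plane_theta n t - sqrt (pi / t)\<bar>"
      using b[OF n t] plane_theta_nonneg t by (intro power_diff_le) auto
    also have "\<dots> \<le> real m * 9 ^ (m - 1) * (8192 * (1 / ((real n)\<^sup>2 * t)))"
    proof (intro mult_left_mono)
      have "\<bar>plane_theta n t - sqrt (pi / t)\<bar> \<le> 512 / ((real n)\<^sup>2 * t) * sqrt (8 * pi / t)" using plane_theta_approx[of n t] n t by simp
      also have "\<dots> \<le> 512 / ((real n)\<^sup>2 * t) * 16" using n t b(5)[OF n t] by (intro mult_left_mono) auto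
      finally show "\<bar>plane_theta n t - sqrt (pi / t)\<bar> \<le> 8192 * (1 / ((real n)\<^sup>2 * t))" by simp
    qed auto
    also have "\<dots> \<le> real m * 9 ^ (m - 1) * (8192 * (1 / (real n * t)))"
      using b(6)[OF n t] by (intro mult_left_mono) auto
    finally show ?thesis by (simp add: C_def)
  qed
  show ?thesis by (rule that[OF C 1 2])
qed

lemma theta_power_decay:
  obtains C where "C \<ge> 0" "\<And>t. 1 \<le> t \<Longrightarrow> \<bar>theta t ^ m - 1\<bar> \<le> C * exp (- t)"
proof
  show "real m * 3 ^ (m - 1) * 4 \<ge> 0" by simp
  fix t :: real assume t: "1 \<le> t"
  have "exp (- t) \<le> exp (- 1)" using t by simp
  also have "exp (- 1) \<le> (1::real) / 2" using exp_ge_add_one_self[of 1] by (simp add: exp_minus field_simps)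
  finally have e: "exp (- t) \<le> 1 / 2" .
  then have "1 / 2 \<le> 1 - exp (- t)" by linarith
  then have "2 * exp (- t) / (1 - exp (- t)) \<le> 2 * exp (- t) / (1 / 2)" using t by (intro divide_left_mono) auto
  then have b: "theta t - 1 \<le> 4 * exp (- t)" using theta_minus_1_bounds(2)[of t] t by simp
  have "\<bar>theta t ^ m - 1 ^ m\<bar> \<le> real m * 3 ^ (m - 1) * \<bar>theta t - 1\<bar>"
    using b e theta_ge_1[of t] t by (intro power_diff_le) auto
  also have "\<dots> \<le> real m * 3 ^ (m - 1) * (4 * exp (- t))"
    using b theta_ge_1[of t] t by (intro mult_left_mono) auto
  finally show "\<bar>theta t ^ m - 1\<bar> \<le> real m * 3 ^ (m - 1) * 4 * exp (- t)" by simp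
qed

text \<open>A limit of the finite sums \<open>disc_theta (Suc n)\<close>, uniform away from 0 by the
  rate in \<open>disc_theta_approx'\<close>.\<close>

lemma continuous_on_theta: "continuous_on {0<..} theta"
proof -
  have "isCont theta t" if t: "t > 0" for t
  proof -
    have "uniform_limit {t/2<..} (\<lambda>n. disc_theta (Suc n)) theta sequentially"
    proof (rule uniform_limitI)
      fix e :: real assume e: "e > 0"
      obtain N :: nat where N: "8192 / (e * (t/2)\<^sup>2) < N" using reals_Archimedean2 by blast
      show "\<forall>\<^sub>F n in sequentially. \<forall>x\<in>{t/2<..}. dist (disc_theta (Suc n) x) (theta x) < e"
        using eventually_ge_at_top[of N]
      proof eventually_elim
        case (elim n)
        show ?case
        proof
          fix x assume x: "x \<in> {t/2<..}"
          have "\<bar>disc_theta (Suc n) x - theta x\<bar> \<le> 8192 / ((real (Suc n))\<^sup>2 * x\<^sup>2)"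
            using x t by (intro disc_theta_approx') auto
          also have "\<dots> \<le> 8192 / (real (Suc n) * (t/2)\<^sup>2)"
            using x t by (intro divide_left_mono mult_mono power_mono) (auto simp: power2_eq_square)
          also have "\<dots> < e"
          proof -
            have "8192 < N * (e * (t/2)\<^sup>2)" using N e t by (simp add: pos_divide_less_eq)
            also have "\<dots> \<le> Suc n * (e * (t/2)\<^sup>2)" using elim e t by (intro mult_right_mono) auto
            finally show ?thesis using t by (simp add: pos_divide_less_eq mult_ac)
          qed
          finally show "dist (disc_theta (Suc n) x) (theta x) < e" by (simp add: dist_real_def)
        qed
      qed
    qed
    moreover have "\<forall>\<^sub>F n in sequentially. continuous_on {t/2<..} (disc_theta (Suc n))"
      unfolding disc_theta_def by (intro always_eventually allI continuous_intros)
    ultimately have "continuous_on {t/2<..} theta"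
      by (intro uniform_limit_theorem) auto
    then show ?thesis using t by (simp add: continuous_on_eq_continuous_at)
  qed
  then show ?thesis by (simp add: continuous_at_imp_continuous_on)
qed

lemma continuous_on_walk_return: "continuous_on UNIV walk_return"
proof -
  have "continuous_on (UNIV \<times> cbox (-1/2) (1/2)) (\<lambda>(u, y::real). exp (- u * (2 - 2 * cos (2 * pi * y))))"
    by (auto simp: split_beta intro!: continuous_intros)
  then have "continuous_on UNIV (\<lambda>u. integral (cbox (-1/2) (1/2)) (\<lambda>y. exp (- u * (2 - 2 * cos (2 * pi * y)))))"
    by (rule integral_continuous_on_param)
  then show ?thesis by (simp add: walk_return_def[abs_def] cbox_interval)
qed

section \<open>Mellin transforms\<close>

text \<open>The power t^(s-1) for t > 0, written with the real logarithm so that it is visibly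
  entire in \<open>s\<close>.\<close>

definition mellin_kernel :: "complex \<Rightarrow> real \<Rightarrow> complex" where
  "mellin_kernel s t = exp ((s - 1) * of_real (ln t))"

lemma norm_mellin_kernel: "t > 0 \<Longrightarrow> cmod (mellin_kernel s t) = t powr (Re s - 1)"
  by (simp add: mellin_kernel_def powr_def)

lemma mellin_kernel_measurable [measurable]: "mellin_kernel s \<in> borel_measurable borel"
  unfolding mellin_kernel_def by measurable

lemma mellin_kernel_add: "mellin_kernel (s + r) t = exp (r * of_real (ln t)) * mellin_kernel s t"
  by (simp add: mellin_kernel_def exp_add[symmetric] algebra_simps)

lemma continuous_on_mellin_kernel: "A \<subseteq> {0<..} \<Longrightarrow> continuous_on A (mellin_kernel s)"
  unfolding mellin_kernel_def by (intro continuous_intros) auto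

lemma set_borel_measurable_cont:
  fixes f :: "real \<Rightarrow> 'a::{second_countable_topology, real_normed_vector}"
  shows "S \<in> sets borel \<Longrightarrow> continuous_on S f \<Longrightarrow> set_borel_measurable lborel S f"
  using borel_measurable_continuous_on_indicator[of S f] by (simp add: set_borel_measurable_def)

lemma set_integrable_mellin:
  assumes J: "J \<in> sets borel" "J \<subseteq> {0<..}" and cont: "continuous_on J h"
    and int: "set_integrable lborel J (\<lambda>t. h t * t powr (Re s - 1))"
  shows "set_integrable lborel J (\<lambda>t. of_real (h t) * mellin_kernel s t)"
proof (rule set_integrable_bound[OF int])
  have "continuous_on J (\<lambda>t. of_real (h t) * mellin_kernel s t)"
    using J cont by (intro continuous_intros continuous_on_mellin_kernel)
  then show "set_borel_measurable lborel J (\<lambda>t. of_real (h t) * mellin_kernel s t)"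
    by (rule set_borel_measurable_cont[OF J(1)])
  show "AE t in lborel. t \<in> J \<longrightarrow> norm (of_real (h t) * mellin_kernel s t) \<le> norm (h t * t powr (Re s - 1))"
  proof (intro always_eventually allI impI)
    fix t assume "t \<in> J"
    then have "t > 0" using J(2) by auto
    then show "norm (of_real (h t) * mellin_kernel s t) \<le> norm (h t * t powr (Re s - 1))"
      by (simp add: norm_mult norm_mellin_kernel)
  qed
qed

text \<open>Over compact intervals one may differentiate under the integral. The intervals exhaust
  \<open>J\<close>, and one integrable function dominates for all \<open>s\<close> in a ball, so the
  limit is locally uniform and hence holomorphic.\<close>

lemma mellin_transform_entire:
  fixes h :: "real \<Rightarrow> real" and a b :: "nat \<Rightarrow> real"
  assumes J: "J = (\<Union>k. {a k..b k})" and inc: "incseq (\<lambda>k. {a k..b k})" and pos: "\<And>k. a k > 0"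
    and cont: "continuous_on J h"
    and int: "\<And>\<sigma>. set_integrable lborel J (\<lambda>t. h t * t powr \<sigma>)"
  shows "(\<lambda>s. LINT t:J|lborel. of_real (h t) * mellin_kernel s t) holomorphic_on UNIV"
proof -
  let ?u = "\<lambda>s t. of_real (h t) * mellin_kernel s t"
  define f where "f k s = (LINT t:{a k..b k}|lborel. ?u s t)" for k s
  have Jpos: "J \<subseteq> {0<..}" using pos unfolding J by (force intro: less_le_trans)
  have Jm: "J \<in> sets borel" unfolding J by auto
  have sub: "{a k..b k} \<subseteq> J" for k unfolding J by auto
  have subpos: "{a k..b k} \<subseteq> {0<..}" for k using sub Jpos by blast
  have ui: "set_integrable lborel J (?u s)" for s
    by (rule set_integrable_mellin[OF Jm Jpos cont int])
  have contk: "continuous_on {a k..b k} h" for k using cont sub continuous_on_subset by blast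
  have hol: "f k holomorphic_on UNIV" for k
  proof -
    have "f k s = integral (cbox (a k) (b k)) (?u s)" for s
      unfolding f_def cbox_interval
      by (rule set_borel_integral_eq_integral(2)) (rule set_integrable_subset[OF ui _ sub], simp)
    moreover have "(\<lambda>s. integral (cbox (a k) (b k)) (?u s)) holomorphic_on UNIV"
    proof (rule leibniz_rule_holomorphic)
      fix s t assume t: "t \<in> cbox (a k) (b k)"
      show "((\<lambda>s. ?u s t) has_field_derivative (of_real (h t) * (of_real (ln t) * mellin_kernel s t))) (at s within UNIV)"
        unfolding mellin_kernel_def by (auto intro!: derivative_eq_intros)
    next
      fix s
      show "?u s integrable_on cbox (a k) (b k)"
        unfolding cbox_interval
        by (intro integrable_continuous_real continuous_intros contk continuous_on_mellin_kernel subpos)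
    next
      have "continuous_on (UNIV \<times> {a k..b k}) (\<lambda>p. of_real (h (snd p)) * (of_real (ln (snd p)) * exp ((fst p - 1) * of_real (ln (snd p)))) :: complex)"
        using subpos[of k] by (intro continuous_intros continuous_on_compose2[OF contk]) force+
      then show "continuous_on (UNIV \<times> cbox (a k) (b k)) (\<lambda>(s, t). of_real (h t) * (of_real (ln t) * mellin_kernel s t))"
        by (simp add: split_beta mellin_kernel_def cbox_interval)
    qed simp
    ultimately show ?thesis by presburger
  qed
  show ?thesis
  proof (rule holomorphic_uniform_sequence[OF open_UNIV hol])
    fix x :: complex
    \<comment> \<open>All \<open>s\<close> in the unit ball about \<open>x\<close> have real part
      between - R and R; the power t^(R-1) dominates for t >= 1 and t^(-R-1) for t < 1.\<close>
    define R where "R = \<bar>Re x\<bar> + 1"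
    define w where "w t = norm (h t * t powr (R - 1)) + norm (h t * t powr (- R - 1))" for t
    have wi: "set_integrable lborel J w"
      unfolding w_def by (intro set_integral_add set_integrable_norm int)
    have uw: "norm (?u s t) \<le> w t" if "t \<in> J" "s \<in> cball x 1" for s t
    proof -
      have t: "t > 0" using that Jpos by auto
      have "\<bar>Re x - Re s\<bar> \<le> 1" using that abs_Re_le_cmod[of "x - s"] by (simp add: dist_norm)
      then have s: "- R \<le> Re s" "Re s \<le> R" unfolding R_def by linarith+
      have "t powr (Re s - 1) \<le> t powr (R - 1) + t powr (- R - 1)"
      proof (cases "t \<ge> 1")
        case True
        then have "t powr (Re s - 1) \<le> t powr (R - 1)" using s by (intro powr_mono) auto
        then show ?thesis by (simp add: add_increasing2)
      next
        case False
        then have "t powr (Re s - 1) \<le> t powr (- R - 1)" using s t by (intro powr_mono') auto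
        then show ?thesis by (simp add: add_increasing)
      qed
      then have "\<bar>h t\<bar> * t powr (Re s - 1) \<le> \<bar>h t\<bar> * (t powr (R - 1) + t powr (- R - 1))"
        by (intro mult_left_mono) auto
      then show ?thesis using t by (simp add: w_def norm_mult norm_mellin_kernel abs_mult distrib_left)
    qed
    have lim: "(\<lambda>k. LINT t:{a k..b k}|lborel. w t) \<longlonglongrightarrow> (LINT t:J|lborel. w t)"
      using set_integral_cont_up[of "\<lambda>k. {a k..b k}" lborel w] inc wi unfolding J by simp
    have bound: "norm ((LINT t:J|lborel. ?u s t) - f k s) \<le> (LINT t:J|lborel. w t) - (LINT t:{a k..b k}|lborel. w t)"
      if "s \<in> cball x 1" for s k
    proof -
      have ik: "set_integrable lborel {a k..b k} (?u s)" by (rule set_integrable_subset[OF ui _ sub]) simp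
      have wk: "set_integrable lborel {a k..b k} w" by (rule set_integrable_subset[OF wi _ sub]) simp
      note I = ui[of s, unfolded set_integrable_def] ik[unfolded set_integrable_def]
      note W = wi[unfolded set_integrable_def] wk[unfolded set_integrable_def]
      have "(LINT t:J|lborel. ?u s t) - f k s = (\<integral>t. indicator J t *\<^sub>R ?u s t - indicator {a k..b k} t *\<^sub>R ?u s t \<partial>lborel)"
        unfolding f_def set_lebesgue_integral_def by (rule Bochner_Integration.integral_diff[symmetric]) (rule I)+
      also have "norm \<dots> \<le> (\<integral>t. norm (indicator J t *\<^sub>R ?u s t - indicator {a k..b k} t *\<^sub>R ?u s t) \<partial>lborel)"
        by (rule integral_norm_bound)
      also have "\<dots> \<le> (\<integral>t. indicator J t *\<^sub>R w t - indicator {a k..b k} t *\<^sub>R w t \<partial>lborel)"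
      proof (rule integral_mono)
        show "integrable lborel (\<lambda>t. norm (indicator J t *\<^sub>R ?u s t - indicator {a k..b k} t *\<^sub>R ?u s t))"
          by (intro integrable_norm Bochner_Integration.integrable_diff I)
        show "integrable lborel (\<lambda>t. indicator J t *\<^sub>R w t - indicator {a k..b k} t *\<^sub>R w t)"
          by (intro Bochner_Integration.integrable_diff W)
        fix t
        show "norm (indicator J t *\<^sub>R ?u s t - indicator {a k..b k} t *\<^sub>R ?u s t) \<le> indicator J t *\<^sub>R w t - indicator {a k..b k} t *\<^sub>R w t"
          using uw[OF _ that, of t] sub[of k] by (auto simp: indicator_def)
      qed
      also have "\<dots> = (LINT t:J|lborel. w t) - (LINT t:{a k..b k}|lborel. w t)"
        unfolding set_lebesgue_integral_def by (rule Bochner_Integration.integral_diff) (rule W)+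
      finally show ?thesis .
    qed
    have "uniform_limit (cball x 1) f (\<lambda>s. LINT t:J|lborel. ?u s t) sequentially"
    proof (rule uniform_limitI)
      fix e :: real assume "e > 0"
      from tendstoD[OF lim this] 
      show "\<forall>\<^sub>F k in sequentially. \<forall>s\<in>cball x 1. dist (f k s) (LINT t:J|lborel. ?u s t) < e"
      proof eventually_elim
        case (elim k)
        then show ?case using bound[of _ k] by (force simp: dist_norm norm_minus_commute)
      qed
    qed
    then show "\<exists>d>0. cball x d \<subseteq> UNIV \<and> uniform_limit (cball x d) f (\<lambda>s. LINT t:J|lborel. ?u s t) sequentially"
      by (intro exI[of _ 1]) auto
  qed
qed

lemma set_integrable_lborel_iff_lebesgue:
  fixes f :: "real \<Rightarrow> 'a::{banach, second_countable_topology}"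
  assumes "set_borel_measurable borel S f"
  shows "set_integrable lborel S f \<longleftrightarrow> set_integrable lebesgue S f"
  using assms unfolding set_integrable_def set_borel_measurable_def
  by (subst integrable_completion) simp_all

lemma set_integrable_powr_0_1:
  assumes "p > -1" shows "set_integrable lborel {0<..<1::real} (\<lambda>t. t powr p)"
proof -
  have "(\<lambda>t. t powr p) absolutely_integrable_on {0..1}"
    using has_integral_powr_from_0[OF assms, of 1] by (intro nonnegative_absolutely_integrable_1) (auto simp: integrable_on_def)
  then have "set_integrable lebesgue {0<..<1} (\<lambda>t. t powr p)"
    by (rule set_integrable_subset) auto
  moreover have "set_borel_measurable borel {0<..<1} (\<lambda>t::real. t powr p)"
    unfolding set_borel_measurable_def by measurable
  ultimately show ?thesis using set_integrable_lborel_iff_lebesgue by blast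
qed

lemma gamma_kernel:
  assumes z: "Re z > 0" and N: "N > 0"
  shows "set_integrable lborel {0<..} (\<lambda>t. of_real (exp (- N * t)) * mellin_kernel z t)"
    and "(LINT t:{0<..}|lborel. of_real (exp (- N * t)) * mellin_kernel z t) = Gamma z * of_real N powr (- z)"
proof -
  have eq: "complex_of_real t powr (z - 1) / of_real (exp (N * t)) = of_real (exp (- N * t)) * mellin_kernel z t" 
    if "t \<in> {0<..}" for t N :: real
    using that by (simp add: mellin_kernel_def powr_def Ln_of_real exp_minus field_simps)
  have I: "set_integrable lborel {0<..} (\<lambda>t. of_real (exp (- N * t)) * mellin_kernel z t)" if N: "N > 0" for N
  proof -
    have "set_integrable lebesgue {0<..} (\<lambda>t. of_real (exp (- N * t)) * mellin_kernel z t)"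
      using absolutely_integrable_Gamma_integral[OF z N] 
      by (rule iffD1[OF set_integrable_cong, rotated -1]) (use eq in auto)
    moreover have "set_borel_measurable borel {0<..} (\<lambda>t. of_real (exp (- N * t)) * mellin_kernel z t)"
      unfolding set_borel_measurable_def by measurable
    ultimately show ?thesis using set_integrable_lborel_iff_lebesgue by blast
  qed
  show "set_integrable lborel {0<..} (\<lambda>t. of_real (exp (- N * t)) * mellin_kernel z t)" by (rule I[OF N])
  define f where "f t = indicator {0<..} t *\<^sub>R (of_real (exp (- 1 * t)) * mellin_kernel z t)" for t :: real
  have "(\<integral>t. f t \<partial>lborel) = Gamma z"
  proof -
    have "(\<integral>t. f t \<partial>lborel) = integral {0<..} (\<lambda>t. of_real (exp (- 1 * t)) * mellin_kernel z t)"
      unfolding f_def using set_borel_integral_eq_integral(2)[OF I[of 1]] by (simp add: set_lebesgue_integral_def)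
    also have "\<dots> = integral {0<..} (\<lambda>t. complex_of_real t powr (z - 1) / of_real (exp t))"
      using eq[of _ 1] by (intro integral_cong) auto
    finally show ?thesis using integral_unique[OF Gamma_integral_complex'[OF z]] by simp
  qed
  moreover have "(\<integral>t. f t \<partial>lborel) = \<bar>N\<bar> *\<^sub>R (\<integral>t. f (0 + N * t) \<partial>lborel)"
    using N by (intro lborel_integral_real_affine) simp
  moreover have "f (0 + N * t) = exp ((z - 1) * of_real (ln N)) * (indicator {0<..} t *\<^sub>R (of_real (exp (- N * t)) * mellin_kernel z t))" for t
    using N by (auto simp: f_def indicator_def zero_less_mult_iff mellin_kernel_def ln_mult distrib_left exp_add)
  ultimately have "Gamma z = of_real N * (exp ((z - 1) * of_real (ln N)) * (LINT t:{0<..}|lborel. of_real (exp (- N * t)) * mellin_kernel z t))"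
    using N by (simp add: set_lebesgue_integral_def scaleR_conv_of_real)
  moreover have "of_real N * exp ((z - 1) * of_real (ln N)) = exp (z * of_real (ln N))"
  proof -
    have "of_real N = exp (complex_of_real (ln N))" using N by (simp add: exp_of_real)
    then show ?thesis by (simp add: exp_add[symmetric] algebra_simps)
  qed
  ultimately have "Gamma z = exp (z * of_real (ln N)) * (LINT t:{0<..}|lborel. of_real (exp (- N * t)) * mellin_kernel z t)"
    by (simp only: mult.assoc[symmetric])
  then show "(LINT t:{0<..}|lborel. of_real (exp (- N * t)) * mellin_kernel z t) = Gamma z * of_real N powr (- z)"
    using N by (simp add: powr_def Ln_of_real exp_minus field_simps)
qed

lemma set_integrable_exp_powr:
  assumes "\<sigma> > 0" "N > 0"
  shows "set_integrable lborel {0<..} (\<lambda>t::real. exp (- N * t) * t powr (\<sigma> - 1))"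
proof -
  have "set_integrable lborel {0<..} (\<lambda>t. norm (of_real (exp (- N * t)) * mellin_kernel (of_real \<sigma>) t))"
    using assms by (intro set_integrable_norm gamma_kernel) auto
  then show ?thesis
    by (rule iffD1[OF set_integrable_cong, rotated -1]) (auto simp: norm_mult norm_mellin_kernel)
qed

lemma unit_interval_exhaustion:
  "incseq (\<lambda>k::nat. {1 / real (k + 2)..1 - 1 / real (k + 2)})"
  "{0<..<1} = (\<Union>k::nat. {1 / real (k + 2)..1 - 1 / real (k + 2)})"
proof -
  show "incseq (\<lambda>k::nat. {1 / real (k + 2)..1 - 1 / real (k + 2)})"
    by (auto simp: incseq_def frac_le intro: order_trans[rotated] order_trans)
  show "{0<..<1} = (\<Union>k::nat. {1 / real (k + 2)..1 - 1 / real (k + 2)})"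
  proof (intro equalityI subsetI)
    fix t :: real assume t: "t \<in> {0<..<1}"
    then obtain k where k: "1 / real (Suc k) < min t (1 - t)" using nat_approx_posE[of "min t (1 - t)"] by auto
    have "1 / real (k + 2) \<le> 1 / real (Suc k)" by (intro frac_le) auto
    with k have "t \<in> {1 / real (k + 2)..1 - 1 / real (k + 2)}" by auto
    then show "t \<in> (\<Union>k::nat. {1 / real (k + 2)..1 - 1 / real (k + 2)})" by blast
  next
    fix t assume "t \<in> (\<Union>k::nat. {1 / real (k + 2)..1 - 1 / real (k + 2)})"
    then obtain k :: nat where k: "1 / real (k + 2) \<le> t" "t \<le> 1 - 1 / real (k + 2)" by auto
    have "0 < 1 / real (k + 2)" by simp
    with k show "t \<in> {0<..<1}" unfolding greaterThanLessThan_iff by linarith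
  qed
qed

text \<open>The antiderivative is t^z / z, and \<open>Re z > 0\<close> makes it vanish at 0. These
  integrals are the source of the poles.\<close>

lemma unit_interval_kernel:
  assumes z: "Re z > 0"
  shows "set_integrable lborel {0<..<1} (mellin_kernel z)"
    and "(LINT t:{0<..<1}|lborel. mellin_kernel z t) = 1 / z"
proof -
  show I: "set_integrable lborel {0<..<1} (mellin_kernel z)"
    using set_integrable_mellin[of "{0<..<1}" "\<lambda>_. 1" z] set_integrable_powr_0_1[of "Re z - 1"] z by (simp add: subset_eq)
  define a where "a k = 1 / real (k + 2)" for k
  define b where "b k = 1 - a k" for k
  have ab: "0 < a k" "a k \<le> b k" "b k < 1" for k by (auto simp: a_def b_def field_simps)
  note inc = unit_interval_exhaustion(1)[folded a_def, folded b_def]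
    and un = unit_interval_exhaustion(2)[folded a_def, folded b_def, symmetric]
  have znz: "z \<noteq> 0" using z by auto
  have "(LINT t:{a k..b k}|lborel. mellin_kernel z t) = (exp (z * of_real (ln (b k))) - exp (z * of_real (ln (a k)))) / z" for k
  proof -
    have "(mellin_kernel z has_integral exp (z * of_real (ln (b k))) / z - exp (z * of_real (ln (a k))) / z) {a k..b k}"
    proof (rule fundamental_theorem_of_calculus[OF ab(2)])
      fix t assume t: "t \<in> {a k..b k}"
      then have t0: "t > 0" using ab(1)[of k] by auto
      have "of_real t = exp (complex_of_real (ln t))" using t0 by (simp add: exp_of_real)
      then have e: "mellin_kernel z t = exp (z * of_real (ln t)) / of_real t"
        by (simp add: mellin_kernel_def exp_diff[symmetric] algebra_simps)
      have "(ln has_real_derivative 1 / t) (at t)" by (rule DERIV_ln_divide[OF t0])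
      then have "((\<lambda>t. z * complex_of_real (ln t)) has_vector_derivative z * of_real (1 / t)) (at t)"
        by (intro has_vector_derivative_mult_right has_vector_derivative_of_real)
      from field_vector_diff_chain_at[OF this DERIV_exp]
      have "((\<lambda>t. exp (z * complex_of_real (ln t))) has_vector_derivative z * of_real (1 / t) * exp (z * of_real (ln t))) (at t)"
        by (simp add: o_def)
      then have "((\<lambda>t. exp (z * of_real (ln t)) / z) has_vector_derivative (z * of_real (1 / t) * exp (z * of_real (ln t))) / z) (at t)"
        by (rule has_vector_derivative_divide)
      moreover have "(z * of_real (1 / t) * exp (z * of_real (ln t))) / z = mellin_kernel z t"
        using znz unfolding e by simp
      ultimately have "((\<lambda>t. exp (z * of_real (ln t)) / z) has_vector_derivative mellin_kernel z t) (at t)"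
        by (simp only:)
      then show "((\<lambda>t. exp (z * of_real (ln t)) / z) has_vector_derivative mellin_kernel z t) (at t within {a k..b k})"
        by (rule has_vector_derivative_at_within)
    qed
    moreover have "set_integrable lborel {a k..b k} (mellin_kernel z)"
      using ab(1)[of k] by (intro borel_integrable_atLeastAtMost' continuous_on_mellin_kernel) auto
    ultimately show ?thesis
      by (simp add: set_borel_integral_eq_integral(2) integral_unique diff_divide_distrib)
  qed
  moreover have "(\<lambda>k. (exp (z * of_real (ln (b k))) - exp (z * of_real (ln (a k)))) / z) \<longlonglongrightarrow> (exp (z * of_real (ln 1)) - 0) / z"
  proof (intro tendsto_intros)
    show "b \<longlonglongrightarrow> 1" unfolding b_def a_def by real_asymp
    have "(\<lambda>k. exp (Re z * ln (a k))) \<longlonglongrightarrow> 0" unfolding a_def using z by real_asymp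
    then show "(\<lambda>k. exp (z * of_real (ln (a k)))) \<longlonglongrightarrow> 0"
      by (subst tendsto_norm_zero_iff[symmetric]) simp
  qed (use znz in auto)
  ultimately have "(\<lambda>k. LINT t:{a k..b k}|lborel. mellin_kernel z t) \<longlonglongrightarrow> 1 / z" by simp
  moreover have "(\<lambda>k. LINT t:{a k..b k}|lborel. mellin_kernel z t) \<longlonglongrightarrow> (LINT t:{0<..<1}|lborel. mellin_kernel z t)"
    using set_integral_cont_up[of "\<lambda>k. {a k..b k}" lborel "mellin_kernel z"] inc I unfolding un by simp
  ultimately show "(LINT t:{0<..<1}|lborel. mellin_kernel z t) = 1 / z" using LIMSEQ_unique by blast
qed

definition small_trace :: "nat \<Rightarrow> real \<Rightarrow> real" where
  "small_trace m t = theta t ^ m - sqrt (pi / t) ^ m"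

definition large_trace :: "nat \<Rightarrow> real \<Rightarrow> real" where
  "large_trace m t = theta t ^ m - 1"

text \<open>The entire part of Gamma(s) zeta(s): with the cut at t = 1, the first integrand is
  beyond all orders at 0 and the second decays exponentially, so no restriction on \<open>s\<close>
  remains.\<close>

definition mellin_part :: "nat \<Rightarrow> complex \<Rightarrow> complex" where
  "mellin_part m s = (LINT t:{0<..<1}|lborel. of_real (small_trace m t) * mellin_kernel s t)
     + (LINT t:{1..}|lborel. of_real (large_trace m t) * mellin_kernel s t)"

lemma continuous_on_small_trace: "A \<subseteq> {0<..} \<Longrightarrow> continuous_on A (small_trace m)"
  unfolding small_trace_def
  by (intro continuous_intros continuous_on_subset[OF continuous_on_theta]) auto

lemma continuous_on_large_trace: "A \<subseteq> {0<..} \<Longrightarrow> continuous_on A (large_trace m)"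
  unfolding large_trace_def
  by (intro continuous_intros continuous_on_subset[OF continuous_on_theta]) auto

lemma small_trace_bound:
  fixes p :: nat
  obtains C where "C \<ge> 0" "\<And>t. 0 < t \<Longrightarrow> t \<le> 1 \<Longrightarrow> \<bar>small_trace m t\<bar> \<le> C * t ^ p"
proof -
  \<comment> \<open>The additional m - 1 powers make up for those lost in passing to m-th
    powers.\<close>
  obtain C0 where C0: "C0 \<ge> 0" "\<And>t. 0 < t \<Longrightarrow> t \<le> 1 \<Longrightarrow> \<bar>theta t - sqrt (pi / t)\<bar> \<le> C0 * t ^ (p + (m - 1))"
    using theta_small_time[of "p + (m - 1)"] by blast
  have "\<bar>small_trace m t\<bar> \<le> (real m * 4 ^ (m - 1) * C0) * t ^ p" if t: "0 < t" "t \<le> 1" for t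
  proof -
    have "\<bar>small_trace m t\<bar> \<le> real m * (4 / t) ^ (m - 1) * \<bar>theta t - sqrt (pi / t)\<bar>"
      unfolding small_trace_def
    proof (rule power_diff_le)
      have "3 / t \<le> 4 / t" using t by (intro divide_right_mono) auto
      then show "theta t \<le> 4 / t" using theta_le[OF t] by linarith
    qed (use sqrt_pi_le[OF t] theta_ge_1[OF t(1)] t in auto)
    also have "\<dots> \<le> real m * (4 / t) ^ (m - 1) * (C0 * t ^ (p + (m - 1)))"
      using t by (intro mult_left_mono C0) auto
    also have "\<dots> = (real m * 4 ^ (m - 1) * C0) * t ^ p"
      using t by (simp add: power_divide power_add)
    finally show ?thesis .
  qed
  then show ?thesis using C0(1) that[of "real m * 4 ^ (m - 1) * C0"] by simp
qed

lemma set_integrable_small_trace: "set_integrable lborel {0<..<1} (\<lambda>t. small_trace m t * t powr \<sigma>)"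
proof -
  obtain p :: nat where p: "- \<sigma> \<le> p" using real_arch_simple by blast
  obtain C where C: "C \<ge> 0" "\<And>t. 0 < t \<Longrightarrow> t \<le> 1 \<Longrightarrow> \<bar>small_trace m t\<bar> \<le> C * t ^ p"
    using small_trace_bound by blast
  have "set_integrable lborel {0<..<1::real} (\<lambda>_. C)"
    unfolding set_integrable_def by simp
  then show ?thesis
  proof (rule set_integrable_bound)
    show "set_borel_measurable lborel {0<..<1} (\<lambda>t. small_trace m t * t powr \<sigma>)"
      by (intro set_borel_measurable_cont continuous_intros continuous_on_small_trace) auto
    show "AE t in lborel. t \<in> {0<..<1} \<longrightarrow> norm (small_trace m t * t powr \<sigma>) \<le> norm C"
    proof (intro always_eventually allI impI)
      fix t :: real assume t: "t \<in> {0<..<1}"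
      have "\<bar>small_trace m t\<bar> * t powr \<sigma> \<le> C * t ^ p * t powr \<sigma>"
        using t by (intro mult_right_mono C) auto
      also have "\<dots> = C * t powr (p + \<sigma>)" using t by (simp add: powr_add powr_realpow)
      also have "\<dots> \<le> C * t powr 0" using t p C(1) by (intro mult_left_mono powr_mono') auto
      finally show "norm (small_trace m t * t powr \<sigma>) \<le> norm C" using t C(1) by (simp add: abs_mult)
    qed
  qed
qed

lemma set_integrable_large_trace: "set_integrable lborel {1..} (\<lambda>t. large_trace m t * t powr \<sigma>)"
proof -
  obtain C where C: "C \<ge> 0" "\<And>t. 1 \<le> t \<Longrightarrow> \<bar>theta t ^ m - 1\<bar> \<le> C * exp (- t)"
    using theta_power_decay by blast
  have "set_integrable lborel {0<..} (\<lambda>t::real. exp (- 1 * t) * t powr ((\<bar>\<sigma>\<bar> + 1) - 1))"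
    by (rule set_integrable_exp_powr) auto
  then have "set_integrable lborel {1..} (\<lambda>t::real. exp (- 1 * t) * t powr ((\<bar>\<sigma>\<bar> + 1) - 1))"
    by (rule set_integrable_subset) auto
  then have "set_integrable lborel {1..} (\<lambda>t::real. C * (exp (- 1 * t) * t powr ((\<bar>\<sigma>\<bar> + 1) - 1)))"
    by (intro set_integrable_mult_right) auto
  then show ?thesis
  proof (rule set_integrable_bound)
    show "set_borel_measurable lborel {1..} (\<lambda>t. large_trace m t * t powr \<sigma>)"
      by (intro set_borel_measurable_cont continuous_intros continuous_on_large_trace) auto
    show "AE t in lborel. t \<in> {1..} \<longrightarrow> norm (large_trace m t * t powr \<sigma>) \<le> norm (C * (exp (- 1 * t) * t powr ((\<bar>\<sigma>\<bar> + 1) - 1)))"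
    proof (intro always_eventually allI impI)
      fix t :: real assume t: "t \<in> {1..}"
      have "\<bar>large_trace m t\<bar> * t powr \<sigma> \<le> (C * exp (- t)) * t powr \<bar>\<sigma>\<bar>"
        using t C unfolding large_trace_def by (intro mult_mono powr_mono) auto
      then show "norm (large_trace m t * t powr \<sigma>) \<le> norm (C * (exp (- 1 * t) * t powr ((\<bar>\<sigma>\<bar> + 1) - 1)))"
        using C(1) by (simp add: abs_mult)
    qed
  qed
qed

lemma mellin_part_entire: "mellin_part m holomorphic_on UNIV"
proof -
  define a where "a k = 1 / real (k + 2)" for k
  note un = unit_interval_exhaustion(2)[folded a_def] and inc = unit_interval_exhaustion(1)[folded a_def]
  have 1: "(\<lambda>s. LINT t:{0<..<1}|lborel. of_real (small_trace m t) * mellin_kernel s t) holomorphic_on UNIV"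
    by (rule mellin_transform_entire[OF un inc]) (auto simp: a_def intro!: set_integrable_small_trace continuous_on_small_trace)
  have un2: "{1..} = (\<Union>k. {1::real..real k})"
    using real_arch_simple by auto
  have 2: "(\<lambda>s. LINT t:{1..}|lborel. of_real (large_trace m t) * mellin_kernel s t) holomorphic_on UNIV"
    by (rule mellin_transform_entire[OF un2]) (auto simp: incseq_def intro!: set_integrable_large_trace continuous_on_large_trace)
  show ?thesis unfolding mellin_part_def[abs_def] by (intro holomorphic_intros 1 2)
qed

section \<open>The spectral zeta function of the torus\<close>

lemma theta_power_has_sum:
  assumes t: "t > 0"
  shows "((\<lambda>k :: 'm::finite \<Rightarrow> int. exp (- t * real_of_int (int_normsq k))) has_sum (theta t ^ CARD('m))) UNIV"
proof -
  let ?f = "\<lambda>k :: 'm \<Rightarrow> int. exp (- t * real_of_int (int_normsq k))"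
  have P: "?f k = (\<Prod>i\<in>UNIV. exp (- t * (real_of_int (k i))\<^sup>2))" for k
    by (simp add: int_normsq_def exp_sum sum_distrib_left sum_negf[symmetric])
  have "infsum ?f UNIV = infsum (\<lambda>k :: 'm \<Rightarrow> int. \<Prod>i\<in>UNIV. exp (- t * (real_of_int (k i))\<^sup>2)) (PiE UNIV (\<lambda>_. UNIV))"
    by (simp only: P PiE_UNIV_domain Pi_UNIV)
  also have "\<dots> = (\<Prod>i\<in>(UNIV::'m set). \<Sum>\<^sub>\<infinity>k\<in>UNIV. exp (- t * (real_of_int k)\<^sup>2))"
    by (rule infsum_prod_PiE_abs) (use theta_summable[OF t] in auto)
  finally have inf: "infsum ?f UNIV = theta t ^ CARD('m)" by (simp add: theta_def)
  \<comment> \<open>\<open>infsum\<close> is 0 for a family that is not summable, so a non-zero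
    value proves summability.\<close>
  moreover have "theta t ^ CARD('m) \<noteq> 0" using theta_ge_1[OF t] by simp
  ultimately have "?f summable_on UNIV" using infsum_not_exists[of ?f UNIV] by force
  then show ?thesis using has_sum_infsum inf by metis
qed

lemma large_trace_has_sum:
  assumes t: "t > 0"
  shows "((\<lambda>k :: 'm::finite \<Rightarrow> int. exp (- t * real_of_int (int_normsq k))) has_sum large_trace CARD('m) t) (- {\<lambda>_. 0})"
  using has_sum_Diff[OF theta_power_has_sum[OF t] has_sum_finite[of "{\<lambda>_::'m. 0::int}"]]
  by (simp add: large_trace_def Compl_eq_Diff_UNIV)

text \<open>Below the cut, \<open>large_trace m t\<close> is \<open>small_trace m t\<close> plus
  (pi/t)^(m/2) minus 1; the last two terms have explicit transforms, with poles at m/2 and at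
  0.\<close>

lemma large_trace_mellin:
  fixes s :: complex
  assumes s: "Re s > real m / 2" "Re s > 0"
  shows "set_integrable lborel {0<..} (\<lambda>t. of_real (large_trace m t) * mellin_kernel s t)"
    and "(LINT t:{0<..}|lborel. of_real (large_trace m t) * mellin_kernel s t) =
       mellin_part m s + of_real (sqrt pi ^ m) / (s - of_nat m / 2) - 1 / s"
proof -
  have s': "Re (s - of_nat m / 2) > 0" using s by simp
  let ?S = "\<lambda>t. of_real (small_trace m t) * mellin_kernel s t"
  let ?L = "\<lambda>t. of_real (large_trace m t) * mellin_kernel s t"
  let ?W = "\<lambda>t. of_real (sqrt pi ^ m) * mellin_kernel (s - of_nat m / 2) t"
  have eq: "?L t = ?S t + ?W t - mellin_kernel s t" if t: "t \<in> {0<..<1}" for t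
  proof -
    have "sqrt (pi / t) ^ m = sqrt pi ^ m * exp (- (real m / 2) * ln t)"
    proof -
      have "ln (sqrt t) = ln t / 2" using t by (intro ln_sqrt) simp
      then have "exp (- (1 / 2) * ln t) = exp (- ln (sqrt t))" by simp
      also have "\<dots> = 1 / sqrt t" using t by (simp add: exp_minus divide_inverse)
      finally have "1 / sqrt t = exp (- (1 / 2) * ln t)" by (rule sym)
      moreover have "sqrt (pi / t) = sqrt pi * (1 / sqrt t)" by (simp add: real_sqrt_divide)
      ultimately have "sqrt (pi / t) = sqrt pi * exp (- (1 / 2) * ln t)" by (simp only:)
      then show ?thesis by (simp add: power_mult_distrib exp_of_nat_mult[symmetric])
    qed
    then have "of_real (sqrt (pi / t) ^ m) * mellin_kernel s t = of_real (sqrt pi ^ m) * (exp (- (of_nat m / 2) * of_real (ln t)) * mellin_kernel s t)"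
      by (simp add: exp_of_real[symmetric] mult.assoc del: of_real_power)
    also have "exp (- (of_nat m / 2) * of_real (ln t)) * mellin_kernel s t = mellin_kernel (s - of_nat m / 2) t"
      using mellin_kernel_add[of s "- (of_nat m / 2)" t] by simp
    finally have "of_real (sqrt (pi / t) ^ m) * mellin_kernel s t = ?W t" .
    moreover have "large_trace m t = small_trace m t + sqrt (pi / t) ^ m - 1" by (simp add: large_trace_def small_trace_def)
    then have "complex_of_real (large_trace m t) = of_real (small_trace m t) + of_real (sqrt (pi / t) ^ m) - 1"
      by (simp only: of_real_add of_real_diff of_real_1)
    ultimately show ?thesis by (simp only: left_diff_distrib distrib_right mult_1)
  qed
  have iS: "set_integrable lborel {0<..<1} ?S"
    by (rule set_integrable_mellin) (auto intro!: continuous_on_small_trace set_integrable_small_trace)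
  have iW: "set_integrable lborel {0<..<1} ?W"
    by (intro set_integrable_mult_right unit_interval_kernel s')
  have iM: "set_integrable lborel {0<..<1} (mellin_kernel s)" by (intro unit_interval_kernel s)
  have i1: "set_integrable lborel {0<..<1} (\<lambda>t. ?S t + ?W t - mellin_kernel s t)"
    by (intro set_integral_diff set_integral_add iS iW iM)
  have iL1: "set_integrable lborel {0<..<1} ?L"
    using i1 by (rule iffD2[OF set_integrable_cong, rotated -1]) (use eq in auto)
  have iL2: "set_integrable lborel {1..} ?L"
    by (rule set_integrable_mellin) (auto intro!: continuous_on_large_trace set_integrable_large_trace)
  have U: "{0<..} = {0<..<1} \<union> {1::real..}" by auto
  show "set_integrable lborel {0<..} ?L"
    unfolding U by (rule set_integrable_Un[OF iL1 iL2]) auto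
  have "(LINT t:{0<..}|lborel. ?L t) = (LINT t:{0<..<1}|lborel. ?L t) + (LINT t:{1..}|lborel. ?L t)"
    unfolding U by (rule set_integral_Un[OF _ iL1 iL2]) auto
  also have "(LINT t:{0<..<1}|lborel. ?L t) = (LINT t:{0<..<1}|lborel. ?S t + ?W t - mellin_kernel s t)"
    by (rule set_lebesgue_integral_cong) (use eq in auto)
  also have "\<dots> = (LINT t:{0<..<1}|lborel. ?S t) + of_real (sqrt pi ^ m) * (1 / (s - of_nat m / 2)) - 1 / s"
    by (subst set_integral_diff(2)[OF set_integral_add(1)[OF iS iW] iM], subst set_integral_add(2)[OF iS iW])
       (simp only: set_integral_mult_right unit_interval_kernel(2)[OF s'] unit_interval_kernel(2)[OF s(2)])
  finally show "(LINT t:{0<..}|lborel. ?L t) = mellin_part m s + of_real (sqrt pi ^ m) / (s - of_nat m / 2) - 1 / s"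
    by (simp add: mellin_part_def)
qed

text \<open>Termwise Mellin transform of the heat trace. The exponentials are positive, so the norms
  add up to the trace times t^(Re s - 1), already known to be integrable. This justifies the
  interchange and also gives absolute convergence of the lattice sum.\<close>

theorem epstein_zeta_mellin:
  fixes s :: complex
  assumes s: "Re s > real CARD('m::finite) / 2"
  shows "((\<lambda>k :: 'm \<Rightarrow> int. complex_of_real (int_normsq k) powr (- s)) has_sum
     (rGamma s * (LINT t:{0<..}|lborel. of_real (large_trace CARD('m) t) * mellin_kernel s t))) (- {\<lambda>_. 0})"
proof -
  let ?m = "CARD('m)"
  let ?K = "- {\<lambda>_. 0} :: ('m \<Rightarrow> int) set"
  have sp: "Re s > 0" using s by (meson less_le_trans divide_nonneg_nonneg of_nat_0_le_iff zero_le_numeral order.strict_trans1)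
  have inf: "infinite ?K"
  proof
    assume "finite ?K"
    then have "finite ((\<lambda>n _. int n + 1) ` (UNIV::nat set) :: ('m \<Rightarrow> int) set)"
      by (rule finite_subset[rotated]) (auto simp: fun_eq_iff)
    moreover have "inj (\<lambda>n (_::'m). int n + 1)" by (auto simp: inj_on_def fun_eq_iff)
    ultimately show False using finite_imageD infinite_UNIV_nat by blast
  qed
  have "countable ?K" by (rule countableI_type)
  \<comment> \<open>The lattice points are enumerated because the interchange is for series over the
    naturals.\<close>
  then have bij: "bij_betw (from_nat_into ?K) UNIV ?K" using inf by (rule bij_betw_from_nat_into)
  define N where "N i = real_of_int (int_normsq (from_nat_into ?K i))" for i
  have Npos: "N i > 0" for i
  proof -
    have "from_nat_into ?K i \<in> ?K" using bij by (auto simp: bij_betw_def)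
    then have "int_normsq (from_nat_into ?K i) \<noteq> 0" by simp
    then show ?thesis unfolding N_def using int_normsq_nonneg[of "from_nat_into ?K i"] by linarith
  qed
  have hs: "((\<lambda>i. exp (- N i * t)) has_sum large_trace ?m t) UNIV" if "t > 0" for t
    using large_trace_has_sum[OF that, where 'm = 'm] has_sum_reindex_bij_betw[OF bij, of "\<lambda>k. exp (- t * real_of_int (int_normsq k))"]
    by (simp add: N_def mult.commute)
  then have sums: "(\<lambda>i. exp (- N i * t)) sums large_trace ?m t" if "t > 0" for t
    using that has_sum_imp_sums by blast
  define f where "f i t = indicator {0<..} t *\<^sub>R (of_real (exp (- N i * t)) * mellin_kernel s t)" for i t
  have int_f: "integrable lborel (f i)" for i
    using gamma_kernel(1)[OF sp Npos] unfolding f_def set_integrable_def by blast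
  have val_f: "(\<integral>t. f i t \<partial>lborel) = Gamma s * of_real (N i) powr (- s)" for i
    using gamma_kernel(2)[OF sp Npos] unfolding f_def set_lebesgue_integral_def by blast
  have f_sums: "(\<lambda>i. f i t) sums (indicator {0<..} t *\<^sub>R (of_real (large_trace ?m t) * mellin_kernel s t))" for t
  proof (cases "t > 0")
    case True
    then show ?thesis using sums_mult2[OF sums_of_real[OF sums[OF True]], of "mellin_kernel s t"] by (simp add: f_def)
  qed (simp add: f_def)
  have nf: "norm (f i t) = indicator {0<..} t * (exp (- N i * t) * cmod (mellin_kernel s t))" for i t
    by (simp add: f_def norm_mult indicator_def)
  have nf_sums: "(\<lambda>i. norm (f i t)) sums (indicator {0<..} t * (large_trace ?m t * cmod (mellin_kernel s t)))" for t
  proof (cases "t > 0")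
    case True
    then show ?thesis using sums_mult2[OF sums[OF True], of "cmod (mellin_kernel s t)"] by (simp add: nf)
  qed (simp add: nf)
  have iLn: "integrable lborel (\<lambda>t. indicator {0<..} t * (large_trace ?m t * cmod (mellin_kernel s t)))"
  proof -
    have "set_integrable lborel {0<..} (\<lambda>t. norm (of_real (large_trace ?m t) * mellin_kernel s t))"
      by (intro set_integrable_norm large_trace_mellin s sp)
    moreover have "indicator {0<..} t *\<^sub>R norm (of_real (large_trace ?m t) * mellin_kernel s t) = indicator {0<..} t * (large_trace ?m t * cmod (mellin_kernel s t))" for t
    proof (cases "t > 0")
      case True
      have "large_trace ?m t \<ge> 0" unfolding large_trace_def using one_le_power[OF theta_ge_1[OF True]] by simp
      then show ?thesis by (simp add: norm_mult)
    qed simp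
    ultimately show ?thesis unfolding set_integrable_def by (simp only:)
  qed
  have sum_norm: "summable (\<lambda>i. \<integral>t. norm (f i t) \<partial>lborel)"
  proof (rule summableI_nonneg_bounded)
    fix n
    have "(\<Sum>i<n. \<integral>t. norm (f i t) \<partial>lborel) = (\<integral>t. (\<Sum>i<n. norm (f i t)) \<partial>lborel)"
      by (rule Bochner_Integration.integral_sum[symmetric]) (intro integrable_norm int_f)
    also have "\<dots> \<le> (\<integral>t. indicator {0<..} t * (large_trace ?m t * cmod (mellin_kernel s t)) \<partial>lborel)"
      using int_f iLn sum_le_suminf[OF sums_summable[OF nf_sums], unfolded sums_unique[OF nf_sums, symmetric]]
      by (intro integral_mono Bochner_Integration.integrable_sum integrable_norm) auto
    finally show "(\<Sum>i<n. \<integral>t. norm (f i t) \<partial>lborel) \<le> (\<integral>t. indicator {0<..} t * (large_trace ?m t * cmod (mellin_kernel s t)) \<partial>lborel)" .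
  qed (simp add: integral_nonneg_AE)
  have "(\<lambda>i. \<integral>t. f i t \<partial>lborel) sums (\<integral>t. (\<Sum>i. f i t) \<partial>lborel)"
    by (rule sums_integral[OF int_f _ sum_norm]) (use nf_sums sums_summable in blast)
  then have S1: "(\<lambda>i. Gamma s * of_real (N i) powr (- s)) sums (LINT t:{0<..}|lborel. of_real (large_trace ?m t) * mellin_kernel s t)"
    by (simp only: val_f sums_unique[OF f_sums, symmetric] set_lebesgue_integral_def)
  have Gs: "rGamma s * Gamma s = 1"
  proof -
    have "s \<notin> \<int>\<^sub>\<le>\<^sub>0" using sp by (auto elim!: nonpos_Ints_cases)
    then show ?thesis by (simp add: rGamma_inverse_Gamma Gamma_eq_zero_iff)
  qed
  have S: "(\<lambda>i. of_real (N i) powr (- s)) sums (rGamma s * (LINT t:{0<..}|lborel. of_real (large_trace ?m t) * mellin_kernel s t))"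
    using sums_mult[OF S1, of "rGamma s"] Gs by (simp add: mult.assoc[symmetric])
  \<comment> \<open>The norm of each integral is at most the integral of the norm. Absolute
    summability turns the ordered sum into an unordered one.\<close>
  have "summable (\<lambda>i. norm (Gamma s * of_real (N i) powr (- s)))"
    by (rule summable_comparison_test'[OF sum_norm, of 0]) (simp flip: val_f add: integral_norm_bound)
  then have "summable (\<lambda>i. norm (rGamma s * (Gamma s * of_real (N i) powr (- s))))"
    unfolding norm_mult[of "rGamma s"] by (rule summable_mult)
  then have "summable (\<lambda>i. norm (complex_of_real (N i) powr (- s)))"
    using Gs by (simp only: mult.assoc[symmetric] mult_1)
  from norm_summable_imp_has_sum[OF this S]
  show ?thesis
    using has_sum_reindex_bij_betw[OF bij, of "\<lambda>k. complex_of_real (int_normsq k) powr (- s)"] by (simp add: N_def)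
qed

text \<open>The transform of \<open>large_trace_mellin\<close> divided by Gamma(s). From s Gamma(s)
  = Gamma(s+1), the quotient of \<open>rGamma s\<close> by \<open>s\<close> is the entire function
  \<open>rGamma (s + 1)\<close>, which removes the pole at 0; the remaining one lies at m/2.\<close>

definition zeta_cont :: "nat \<Rightarrow> complex \<Rightarrow> complex" where
  "zeta_cont m s = rGamma s * (mellin_part m s + of_real (sqrt pi ^ m) / (s - of_nat m / 2)) - rGamma (s + 1)"

lemma torus_zeta_eq_zeta_cont:
  assumes s: "Re s > real CARD('m::finite) / 2"
  shows "torus_zeta TYPE('m) s = zeta_cont CARD('m) s"
proof -
  have sp: "Re s > 0" using s by (meson less_le_trans divide_nonneg_nonneg of_nat_0_le_iff zero_le_numeral order.strict_trans1)
  note H = epstein_zeta_mellin[OF s]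
  have "torus_zeta TYPE('m) s = (\<Sum>\<^sub>\<infinity>k\<in>- {\<lambda>_::'m. 0}. complex_of_real (int_normsq k) powr (- s))"
    by (rule torus_zeta_eq_infsum) (rule has_sum_imp_summable[OF H])
  also have "\<dots> = rGamma s * (mellin_part CARD('m) s + of_real (sqrt pi ^ CARD('m)) / (s - of_nat CARD('m) / 2) - 1 / s)"
    using infsumI[OF H] large_trace_mellin(2)[OF s sp] by simp
  also have "rGamma s * (1 / s) = rGamma (s + 1)"
  proof -
    have "s \<noteq> 0" using sp by auto
    then show ?thesis unfolding rGamma_plus1[of s, symmetric] by simp
  qed
  then have "rGamma s * (mellin_part CARD('m) s + of_real (sqrt pi ^ CARD('m)) / (s - of_nat CARD('m) / 2) - 1 / s) = zeta_cont CARD('m) s"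
    by (simp add: zeta_cont_def right_diff_distrib)
  finally show ?thesis .
qed

lemma mellin_part_analytic [analytic_intros]: "f analytic_on A \<Longrightarrow> (\<lambda>s. mellin_part m (f s)) analytic_on A"
proof -
  assume f: "f analytic_on A"
  have "mellin_part m analytic_on UNIV" using mellin_part_entire by (simp add: analytic_on_open)
  then have "mellin_part m analytic_on f ` A" by (rule analytic_on_subset) auto
  from analytic_on_compose[OF f this] show ?thesis by (simp add: o_def)
qed

lemma zeta_cont_mero: "zeta_cont m meromorphic_on UNIV"
proof -
  have "mellin_part m meromorphic_on UNIV" "rGamma meromorphic_on (UNIV :: complex set)" "(\<lambda>s::complex. rGamma (s + 1)) meromorphic_on UNIV"
    by (intro analytic_on_imp_meromorphic_on analytic_intros; simp)+
  then show ?thesis unfolding zeta_cont_def[abs_def] by (intro meromorphic_intros)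
qed

lemma zeta_cont_analytic_0: "m \<noteq> 0 \<Longrightarrow> zeta_cont m analytic_on {0}"
  unfolding zeta_cont_def[abs_def] by (intro analytic_intros) auto

text \<open>\<open>rGamma\<close> has a simple zero with derivative 1 at 0, so the product with
  \<open>g\<close> has derivative \<open>g 0\<close>; the last term contributes the derivative of
  \<open>rGamma\<close> at 1, the Euler constant.\<close>

lemma zeta_cont_deriv_0:
  assumes m: "m \<noteq> 0"
  shows "(zeta_cont m has_field_derivative (mellin_part m 0 - of_real (2 * sqrt pi ^ m / m) - euler_mascheroni)) (at 0)"
proof -
  define g where "g s = mellin_part m s + of_real (sqrt pi ^ m) / (s - of_nat m / 2)" for s
  have "g analytic_on {0}" unfolding g_def using m by (intro analytic_intros) auto
  then obtain g' where g': "(g has_field_derivative g') (at 0)"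
    using analytic_on_imp_differentiable_at[of g "{0}" 0] by (auto simp: field_differentiable_def)
  have r0: "(rGamma has_field_derivative 1) (at (0::complex))"
    using has_field_derivative_rGamma_nonpos_int[of 0 "UNIV :: complex set"] by simp
  have r1: "(rGamma has_field_derivative euler_mascheroni) (at (0 + 1::complex))"
    using has_field_derivative_rGamma_no_nonpos_int[of "1::complex" UNIV] by simp
  have r1': "((\<lambda>s. rGamma (s + 1)) has_field_derivative euler_mascheroni) (at (0::complex))"
    using r1 DERIV_shift[of rGamma euler_mascheroni 0 "1::complex"] by simp
  have "((\<lambda>s. rGamma s * g s - rGamma (s + 1)) has_field_derivative (1 * g 0 + g' * rGamma 0 - euler_mascheroni)) (at 0)"
    by (intro DERIV_diff DERIV_mult r0 g' r1')
  moreover have "1 * g 0 + g' * rGamma 0 - euler_mascheroni = mellin_part m 0 - of_real (2 * sqrt pi ^ m / m) - euler_mascheroni"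
    by (simp add: g_def)
  ultimately show ?thesis by (simp add: zeta_cont_def[abs_def] g_def mult.commute)
qed

text \<open>The continuation in the definition is an arbitrary choice. Its difference from
  \<open>zeta_cont\<close> is meromorphic and vanishes on a half plane, hence off a sparse
  set.\<close>

theorem log_det_zeta_torus_eq:
  "log_det_zeta_torus TYPE('m::finite) = 
     of_real (2 * sqrt pi ^ CARD('m) / CARD('m)) + euler_mascheroni - mellin_part CARD('m) 0"
proof -
  let ?m = "CARD('m)"
  have m: "?m \<noteq> 0" by simp
  define Z where "Z = (SOME Z. torus_zeta_continuation TYPE('m) Z)"
  have "torus_zeta_continuation TYPE('m) (zeta_cont ?m)"
    unfolding torus_zeta_continuation_def
    using zeta_cont_mero zeta_cont_analytic_0[OF m] torus_zeta_eq_zeta_cont[where 'm = 'm] by auto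
  then have Z: "torus_zeta_continuation TYPE('m) Z" unfolding Z_def by (rule someI[of "torus_zeta_continuation TYPE('m)"])
  define D where "D s = Z s - zeta_cont ?m s" for s
  have Dm: "D meromorphic_on UNIV" unfolding D_def[abs_def]
    using Z zeta_cont_mero by (auto simp: torus_zeta_continuation_def intro!: meromorphic_intros)
  have Da: "D analytic_on {0}" unfolding D_def[abs_def]
    using Z zeta_cont_analytic_0[OF m] by (auto simp: torus_zeta_continuation_def intro!: analytic_intros)
  have D0: "D s = 0" if "Re s > real ?m / 2" for s
    using Z that torus_zeta_eq_zeta_cont[OF that] by (auto simp: torus_zeta_continuation_def D_def)
  have "\<not> (\<forall>\<^sub>F z in cosparse UNIV. D z \<noteq> 0)"
  proof
    assume "\<forall>\<^sub>F z in cosparse UNIV. D z \<noteq> 0"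
    \<comment> \<open>The point \<open>m\<close> is a witness inside the half plane Re s >
      m/2.\<close>
    then have ev: "\<forall>\<^sub>F z in at (of_nat ?m). D z \<noteq> 0" by (auto simp: eventually_cosparse_open_eq)
    have "open {z. Re z > real ?m / 2}" by (rule open_halfspace_Re_gt)
    then have "\<forall>\<^sub>F z in nhds (of_nat ?m). z \<in> {z. Re z > real ?m / 2}" by (rule eventually_nhds_in_open) simp
    then have "\<forall>\<^sub>F z in at (of_nat ?m :: complex). D z = 0"
      unfolding eventually_at_filter by eventually_elim (use D0 in auto)
    with ev have "\<forall>\<^sub>F z in at (of_nat ?m :: complex). False" by eventually_elim simp
    then show False by simp
  qed
  then have "\<forall>\<^sub>F z in cosparse UNIV. D z = 0"
    using meromorphic_imp_constant_or_avoid[OF Dm, of 0] by auto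
  then have at0: "\<forall>\<^sub>F z in at 0. D z = 0" by (auto simp: eventually_cosparse_open_eq)
  \<comment> \<open>Equality off a sparse set leaves the value at 0 itself open; continuity of
    \<open>D\<close> settles it.\<close>
  have "isCont D 0" using Da by (rule analytic_at_imp_isCont)
  then have "(D \<longlongrightarrow> D 0) (at 0)" by (simp add: isCont_def)
  moreover have "(D \<longlongrightarrow> 0) (at 0)" by (rule tendsto_eventually[OF at0])
  ultimately have D00: "D 0 = 0" by (rule tendsto_unique[OF trivial_limit_at])
  have nh: "\<forall>\<^sub>F z in nhds 0. Z z = zeta_cont ?m z"
    using at0 unfolding eventually_at_filter by (rule eventually_mono) (use D00 in \<open>auto simp: D_def\<close>)
  have "deriv Z 0 = deriv (zeta_cont ?m) 0" by (rule deriv_cong_ev[OF nh refl])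
  also have "\<dots> = mellin_part ?m 0 - of_real (2 * sqrt pi ^ ?m / ?m) - euler_mascheroni"
    by (rule DERIV_imp_deriv[OF zeta_cont_deriv_0[OF m]])
  finally show ?thesis by (simp add: log_det_zeta_torus_def Z_def)
qed

section \<open>Asymptotics of the discrete determinant\<close>

lemma set_integrable_bounded_unit:
  fixes f :: "real \<Rightarrow> real"
  assumes "continuous_on {0<..<1} f" "\<And>t. 0 < t \<Longrightarrow> t < 1 \<Longrightarrow> \<bar>f t\<bar> \<le> C"
  shows "set_integrable lborel {0<..<1} f"
proof (rule set_integrable_bound)
  show "set_integrable lborel {0<..<1::real} (\<lambda>_. C)" unfolding set_integrable_def by simp
  show "set_borel_measurable lborel {0<..<1} f" by (rule set_borel_measurable_cont[OF _ assms(1)]) simp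
  show "AE t in lborel. t \<in> {0<..<1} \<longrightarrow> norm (f t) \<le> norm C"
    using assms(2) by (intro always_eventually allI impI) (force intro: order_trans[OF _ abs_ge_self])
qed

lemma power_tail_integral:
  fixes p :: real
  assumes p: "p < -1"
  shows "set_integrable lborel {1..} (\<lambda>t. t powr p)" "(LINT t:{1..}|lborel. t powr p) = - 1 / (p + 1)"
proof -
  have H: "((\<lambda>t. t powr p) has_integral - (1 powr (p + 1)) / (p + 1)) {1..}"
    using p by (intro has_integral_powr_to_inf) auto
  then have "(\<lambda>t. t powr p) absolutely_integrable_on {1..}"
    by (intro nonnegative_absolutely_integrable_1) (auto simp: integrable_on_def)
  moreover have "set_borel_measurable borel {1..} (\<lambda>t::real. t powr p)"
    unfolding set_borel_measurable_def by measurable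
  ultimately show I: "set_integrable lborel {1..} (\<lambda>t. t powr p)"
    using set_integrable_lborel_iff_lebesgue by blast
  show "(LINT t:{1..}|lborel. t powr p) = - 1 / (p + 1)"
    using set_borel_integral_eq_integral(2)[OF I] integral_unique[OF H] by simp
qed

lemma set_integrable_power_tail:
  fixes f :: "real \<Rightarrow> real"
  assumes "p < -1" "continuous_on {1..} f" "\<And>t. 1 \<le> t \<Longrightarrow> \<bar>f t\<bar> \<le> C * t powr p"
  shows "set_integrable lborel {1..} f"
proof (rule set_integrable_bound)
  show "set_integrable lborel {1..} (\<lambda>t. C * t powr p)"
    by (intro set_integrable_mult_right power_tail_integral assms)
  show "set_borel_measurable lborel {1..} f" by (rule set_borel_measurable_cont[OF _ assms(2)]) simp
  show "AE t in lborel. t \<in> {1..} \<longrightarrow> norm (f t) \<le> norm (C * t powr p)"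
    using assms(3) by (intro always_eventually allI impI) (force intro: order_trans[OF _ abs_ge_self])
qed

lemma set_integral_sum:
  fixes f :: "'k \<Rightarrow> real \<Rightarrow> real"
  assumes "\<And>k. k \<in> K \<Longrightarrow> set_integrable lborel S (f k)"
  shows "(LINT t:S|lborel. (\<Sum>k\<in>K. f k t)) = (\<Sum>k\<in>K. LINT t:S|lborel. f k t)"
  unfolding set_lebesgue_integral_def scaleR_sum_right
  by (rule Bochner_Integration.integral_sum) (use assms in \<open>auto simp: set_integrable_def\<close>)

lemma one_minus_exp_bounds:
  fixes x :: real assumes "x \<ge> 0" shows "0 \<le> 1 - exp (- x)" "1 - exp (- x) \<le> x"
  using assms exp_ge_add_one_self[of "- x"] by auto

lemma log_integrals_integrable:
  fixes \<mu> :: real assumes l: "\<mu> > 0"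
  shows "set_integrable lborel {0<..<1} (\<lambda>t. (1 - exp (- \<mu> * t)) / t)"
    and "set_integrable lborel {1..} (\<lambda>t. exp (- \<mu> * t) / t)"
proof -
  show "set_integrable lborel {0<..<1} (\<lambda>t. (1 - exp (- \<mu> * t)) / t)"
  proof (rule set_integrable_bounded_unit)
    show "continuous_on {0<..<1} (\<lambda>t. (1 - exp (- \<mu> * t)) / t)" by (intro continuous_intros) auto
    fix t :: real assume "0 < t" "t < 1"
    then have "0 \<le> (1 - exp (- \<mu> * t)) / t" "(1 - exp (- \<mu> * t)) / t \<le> \<mu>"
      using one_minus_exp_bounds[of "\<mu> * t"] l by (simp_all add: pos_divide_le_eq)
    then show "\<bar>(1 - exp (- \<mu> * t)) / t\<bar> \<le> \<mu>" by linarith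
  qed
  have "set_integrable lborel {1..} (\<lambda>t::real. exp (- \<mu> * t) * t powr (1 - 1))"
    by (rule set_integrable_subset[OF set_integrable_exp_powr[of 1 \<mu>]]) (use l in auto)
  then show "set_integrable lborel {1..} (\<lambda>t. exp (- \<mu> * t) / t)"
  proof (rule set_integrable_bound)
    show "set_borel_measurable lborel {1..} (\<lambda>t. exp (- \<mu> * t) / t)"
      by (intro set_borel_measurable_cont continuous_intros) auto
    show "AE t in lborel. t \<in> {1..} \<longrightarrow> norm (exp (- \<mu> * t) / t) \<le> norm (exp (- \<mu> * t) * t powr (1 - 1))"
    proof (intro always_eventually allI impI)
      fix t :: real assume "t \<in> {1..}"
      then show "norm (exp (- \<mu> * t) / t) \<le> norm (exp (- \<mu> * t) * t powr (1 - 1))" by (simp add: divide_le_eq)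
    qed
  qed
qed

text \<open>Subtracting 1/\<sigma>, the integral of t^(\<sigma>-1) over the unit interval, removes
  the divergence at \<sigma> = 0; both integrals on the right have limits there.\<close>

lemma real_gamma_split:
  fixes \<mu> \<sigma> :: real assumes l: "\<mu> > 0" and \<sigma>: "\<sigma> > 0"
  shows "Gamma \<sigma> * \<mu> powr (- \<sigma>) - 1 / \<sigma> = 
    (LINT t:{1..}|lborel. exp (- \<mu> * t) * t powr (\<sigma> - 1)) - (LINT t:{0<..<1}|lborel. (1 - exp (- \<mu> * t)) * t powr (\<sigma> - 1))"
proof -
  let ?f = "\<lambda>t. exp (- \<mu> * t) * t powr (\<sigma> - 1)"
  have i: "set_integrable lborel {0<..} ?f" by (rule set_integrable_exp_powr[OF \<sigma> l])
  have mk: "mellin_kernel (of_real \<sigma>) t = of_real (t powr (\<sigma> - 1))" if "t > 0" for t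
    using that by (simp add: mellin_kernel_def powr_def exp_of_real[symmetric])
  have "complex_of_real (LINT t:{0<..}|lborel. ?f t) = (LINT t:{0<..}|lborel. of_real (exp (- \<mu> * t)) * mellin_kernel (of_real \<sigma>) t)"
    unfolding set_integral_complex_of_real[symmetric]
    by (rule set_lebesgue_integral_cong) (auto simp: mk)
  also have "\<dots> = Gamma (of_real \<sigma>) * of_real \<mu> powr (- of_real \<sigma>)"
    using \<sigma> l by (intro gamma_kernel(2)) auto
  also have "\<dots> = complex_of_real (Gamma \<sigma> * \<mu> powr (- \<sigma>))"
    using l by (simp add: Gamma_complex_of_real powr_of_real[symmetric] flip: of_real_minus)
  finally have G: "(LINT t:{0<..}|lborel. ?f t) = Gamma \<sigma> * \<mu> powr (- \<sigma>)"
    using of_real_eq_iff by blast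
  have U: "{0<..} = {0<..<1} \<union> {1::real..}" by auto
  have i1: "set_integrable lborel {0<..<1} ?f" and i2: "set_integrable lborel {1..} ?f"
    by (rule set_integrable_subset[OF i]; auto)+
  have pw: "set_integrable lborel {0<..<1::real} (\<lambda>t. t powr (\<sigma> - 1))" using \<sigma> by (intro set_integrable_powr_0_1) simp
  have "(LINT t:{0<..<1}|lborel. t powr (\<sigma> - 1)) = 1 / \<sigma>"
  proof -
    have "complex_of_real (LINT t:{0<..<1}|lborel. t powr (\<sigma> - 1)) = (LINT t:{0<..<1}|lborel. mellin_kernel (of_real \<sigma>) t)"
      unfolding set_integral_complex_of_real[symmetric]
      by (rule set_lebesgue_integral_cong) (auto simp: mk)
    also have "\<dots> = of_real (1 / \<sigma>)" using unit_interval_kernel(2)[of "of_real \<sigma>"] \<sigma> by simp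
    finally show ?thesis using of_real_eq_iff by blast
  qed
  moreover have "(LINT t:{0<..<1}|lborel. (1 - exp (- \<mu> * t)) * t powr (\<sigma> - 1)) = 
      (LINT t:{0<..<1}|lborel. t powr (\<sigma> - 1)) - (LINT t:{0<..<1}|lborel. ?f t)"
    unfolding left_diff_distrib mult_1 by (rule set_integral_diff(2)[OF pw i1])
  moreover have "(LINT t:{0<..}|lborel. ?f t) = (LINT t:{0<..<1}|lborel. ?f t) + (LINT t:{1..}|lborel. ?f t)"
    unfolding U by (rule set_integral_Un[OF _ i1 i2]) auto
  ultimately show ?thesis using G by simp
qed

text \<open>The limit of \<open>real_gamma_split\<close> as \<sigma> tends to 0. The left side is
  the difference quotient at 0 of Gamma(x+1) \<mu>^(-x), whose derivative there is - gamma - ln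
  \<mu>; the right side converges by domination.\<close>

theorem ln_integral_formula:
  fixes \<mu> :: real assumes l: "\<mu> > 0"
  shows "ln \<mu> + euler_mascheroni = (LINT t:{0<..<1}|lborel. (1 - exp (- \<mu> * t)) / t) - (LINT t:{1..}|lborel. exp (- \<mu> * t) / t)"
proof -
  define \<sigma> where "\<sigma> k = 1 / real (Suc k)" for k
  have \<sigma>: "0 < \<sigma> k" "\<sigma> k \<le> 1" for k by (auto simp: \<sigma>_def)
  have \<sigma>0: "\<sigma> \<longlonglongrightarrow> 0" unfolding \<sigma>_def by real_asymp
  have pt: "(\<lambda>k. t powr (\<sigma> k - 1)) \<longlonglongrightarrow> 1 / t" if t: "t > 0" for t
  proof -
    have "(\<lambda>k. t powr (\<sigma> k - 1)) \<longlonglongrightarrow> t powr (0 - 1)" using t by (intro tendsto_intros \<sigma>0) auto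
    then show ?thesis using t by (simp add: powr_minus_divide)
  qed
  have meas: "set_borel_measurable lborel {0<..<1} (\<lambda>t. (1 - exp (- \<mu> * t)) * t powr p)"
     "set_borel_measurable lborel {1..} (\<lambda>t. exp (- \<mu> * t) * t powr p)" for p :: real
    by (intro set_borel_measurable_cont continuous_intros; auto)+
  have L1: "(\<lambda>k. LINT t:{0<..<1}|lborel. (1 - exp (- \<mu> * t)) * t powr (\<sigma> k - 1)) \<longlonglongrightarrow> (LINT t:{0<..<1}|lborel. (1 - exp (- \<mu> * t)) / t)"
    unfolding set_lebesgue_integral_def
  proof (rule integral_dominated_convergence[where w = "\<lambda>t. indicator {0<..<1} t *\<^sub>R \<mu>"])
    show "(\<lambda>t. indicator {0<..<1} t *\<^sub>R ((1 - exp (- \<mu> * t)) / t)) \<in> borel_measurable lborel"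
      using log_integrals_integrable(1)[OF l] unfolding set_integrable_def by auto
    show "(\<lambda>t. indicator {0<..<1} t *\<^sub>R ((1 - exp (- \<mu> * t)) * t powr (\<sigma> k - 1))) \<in> borel_measurable lborel" for k
      using meas(1) unfolding set_borel_measurable_def by blast
    show "AE t in lborel. (\<lambda>k. indicator {0<..<1} t *\<^sub>R ((1 - exp (- \<mu> * t)) * t powr (\<sigma> k - 1))) \<longlonglongrightarrow> indicator {0<..<1} t *\<^sub>R ((1 - exp (- \<mu> * t)) / t)"
    proof (intro always_eventually allI)
      fix t :: real
      show "(\<lambda>k. indicator {0<..<1} t *\<^sub>R ((1 - exp (- \<mu> * t)) * t powr (\<sigma> k - 1))) \<longlonglongrightarrow> indicator {0<..<1} t *\<^sub>R ((1 - exp (- \<mu> * t)) / t)"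
        using tendsto_mult_left[OF pt, of t "1 - exp (- \<mu> * t)"] by (cases "t \<in> {0<..<1}") auto
    qed
    show "AE t in lborel. norm (indicator {0<..<1} t *\<^sub>R ((1 - exp (- \<mu> * t)) * t powr (\<sigma> k - 1))) \<le> indicator {0<..<1} t *\<^sub>R \<mu>" for k
    proof (intro always_eventually allI)
      fix t :: real
      show "norm (indicator {0<..<1} t *\<^sub>R ((1 - exp (- \<mu> * t)) * t powr (\<sigma> k - 1))) \<le> indicator {0<..<1} t *\<^sub>R \<mu>"
      proof (cases "t \<in> {0<..<1}")
        case True
        have e: "0 \<le> 1 - exp (- \<mu> * t)" "1 - exp (- \<mu> * t) \<le> \<mu> * t" using one_minus_exp_bounds[of "\<mu> * t"] l True by auto
        have "t powr (\<sigma> k - 1) \<le> t powr (- 1)" using True \<sigma>[of k] by (intro powr_mono') auto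
        then have "(1 - exp (- \<mu> * t)) * t powr (\<sigma> k - 1) \<le> (\<mu> * t) * t powr (- 1)"
          using e True l by (intro mult_mono) auto
        also have "\<dots> = \<mu>" using True by (simp add: powr_minus_divide)
        finally show ?thesis using True e by simp
      qed simp
    qed
  qed simp
  have L2: "(\<lambda>k. LINT t:{1..}|lborel. exp (- \<mu> * t) * t powr (\<sigma> k - 1)) \<longlonglongrightarrow> (LINT t:{1..}|lborel. exp (- \<mu> * t) / t)"
    unfolding set_lebesgue_integral_def
  proof (rule integral_dominated_convergence[where w = "\<lambda>t. indicator {1..} t *\<^sub>R (exp (- \<mu> * t) * t powr (1 - 1))"])
    show "(\<lambda>t. indicator {1..} t *\<^sub>R (exp (- \<mu> * t) / t)) \<in> borel_measurable lborel"
      using log_integrals_integrable(2)[OF l] unfolding set_integrable_def by auto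
    show "(\<lambda>t. indicator {1..} t *\<^sub>R (exp (- \<mu> * t) * t powr (\<sigma> k - 1))) \<in> borel_measurable lborel" for k
      using meas(2) unfolding set_borel_measurable_def by blast
    have "set_integrable lborel {1..} (\<lambda>t::real. exp (- \<mu> * t) * t powr (1 - 1))"
      by (rule set_integrable_subset[OF set_integrable_exp_powr[of 1 \<mu>]]) (use l in auto)
    then show "integrable lborel (\<lambda>t. indicator {1..} t *\<^sub>R (exp (- \<mu> * t) * t powr (1 - 1)))"
      unfolding set_integrable_def .
    show "AE t in lborel. (\<lambda>k. indicator {1..} t *\<^sub>R (exp (- \<mu> * t) * t powr (\<sigma> k - 1))) \<longlonglongrightarrow> indicator {1..} t *\<^sub>R (exp (- \<mu> * t) / t)"
    proof (intro always_eventually allI)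
      fix t :: real
      show "(\<lambda>k. indicator {1..} t *\<^sub>R (exp (- \<mu> * t) * t powr (\<sigma> k - 1))) \<longlonglongrightarrow> indicator {1..} t *\<^sub>R (exp (- \<mu> * t) / t)"
        using tendsto_mult_left[OF pt, of t "exp (- \<mu> * t)"] by (cases "t \<in> {1..}") auto
    qed
    show "AE t in lborel. norm (indicator {1..} t *\<^sub>R (exp (- \<mu> * t) * t powr (\<sigma> k - 1))) \<le> indicator {1..} t *\<^sub>R (exp (- \<mu> * t) * t powr (1 - 1))" for k
    proof (intro always_eventually allI)
      fix t :: real
      show "norm (indicator {1..} t *\<^sub>R (exp (- \<mu> * t) * t powr (\<sigma> k - 1))) \<le> indicator {1..} t *\<^sub>R (exp (- \<mu> * t) * t powr (1 - 1))"
      proof (cases "t \<in> {1..}")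
        case True
        then have "t powr (\<sigma> k - 1) \<le> t powr (1 - 1)" using \<sigma>[of k] by (intro powr_mono) auto
        then show ?thesis using True by simp
      qed simp
    qed
  qed
  have d: "((\<lambda>x. Gamma (x + 1) * \<mu> powr (- x)) has_real_derivative (- euler_mascheroni - ln \<mu>)) (at 0)"
    using l by (auto intro!: derivative_eq_intros)
  then have "((\<lambda>h. (Gamma (h + 1) * \<mu> powr (- h) - 1) / h) \<longlongrightarrow> - euler_mascheroni - ln \<mu>) (at 0)"
    using d[unfolded DERIV_def] l by simp
  then have "((\<lambda>k. (Gamma (\<sigma> k + 1) * \<mu> powr (- \<sigma> k) - 1) / \<sigma> k) \<longlonglongrightarrow> - euler_mascheroni - ln \<mu>)"
    by (rule filterlim_compose) (use \<sigma>0 \<sigma>(1) in \<open>auto simp: filterlim_at intro!: always_eventually less_imp_neq[symmetric]\<close>)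
  moreover have "(Gamma (\<sigma> k + 1) * \<mu> powr (- \<sigma> k) - 1) / \<sigma> k = Gamma (\<sigma> k) * \<mu> powr (- \<sigma> k) - 1 / \<sigma> k" for k
  proof -
    have "\<sigma> k \<notin> \<int>\<^sub>\<le>\<^sub>0" using \<sigma>(1)[of k] by (auto elim!: nonpos_Ints_cases)
    then show ?thesis using Gamma_plus1[of "\<sigma> k"] \<sigma>(1)[of k] by (simp add: field_simps)
  qed
  ultimately have "(\<lambda>k. (LINT t:{1..}|lborel. exp (- \<mu> * t) * t powr (\<sigma> k - 1)) - (LINT t:{0<..<1}|lborel. (1 - exp (- \<mu> * t)) * t powr (\<sigma> k - 1))) 
     \<longlonglongrightarrow> - euler_mascheroni - ln \<mu>"
    using real_gamma_split[OF l \<sigma>(1)] by simp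
  from LIMSEQ_unique[OF this tendsto_diff[OF L2 L1]] show ?thesis by simp
qed

section \<open>The discrete determinant as an integral of the heat trace\<close>

lemma disc_heat_trace:
  fixes n :: nat
  assumes "n > 0"
  shows "(\<Sum>k\<in>grid n - {\<lambda>_::'m::finite. 0}. exp (- disc_eigenvalue n k * t)) = disc_theta n t ^ CARD('m) - 1"
proof -
  have "(\<Sum>k\<in>(grid n :: ('m \<Rightarrow> int) set). exp (- disc_eigenvalue n k * t))
     = (\<Sum>k\<in>(grid n :: ('m \<Rightarrow> int) set). \<Prod>i\<in>UNIV. exp (- t * ((real n)\<^sup>2 / pi\<^sup>2 * (sin (pi * real_of_int (k i) / n))\<^sup>2)))"
    by (intro sum.cong refl) (simp add: disc_eigenvalue_def exp_sum[symmetric] sum_distrib_left sum_negf mult.commute)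
  also have "\<dots> = disc_theta n t ^ CARD('m)"
    unfolding grid_def by (subst prod_sum_PiE[symmetric]) (auto simp: disc_theta_def)
  finally have "(\<Sum>k\<in>(grid n :: ('m \<Rightarrow> int) set). exp (- disc_eigenvalue n k * t)) = disc_theta n t ^ CARD('m)" .
  moreover have "(\<lambda>_::'m. 0) \<in> grid n" using assms by (auto simp: grid_def)
  ultimately show ?thesis by (subst sum_diff1) (auto simp: disc_eigenvalue_def)
qed

lemma card_grid: "card (grid n :: ('m::finite \<Rightarrow> int) set) = n ^ CARD('m)"
  by (simp add: grid_def card_PiE)

text \<open>\<open>ln_integral_formula\<close> summed over the non-zero eigenvalues. In the first
  integral the zero eigenvalue would add 1 - 1 = 0, so the full trace stands against
  \<open>real n ^ m\<close>; in the second it is subtracted.\<close>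

theorem ln_det_discrete_integral:
  fixes n :: nat
  assumes n: "n > 0"
  defines "m \<equiv> CARD('m::finite)"
  shows "set_integrable lborel {0<..<1} (\<lambda>t. (real n ^ m - disc_theta n t ^ m) / t)"
    and "set_integrable lborel {1..} (\<lambda>t. (disc_theta n t ^ m - 1) / t)"
    and "ln (det_discrete_laplacian TYPE('m) n) + (real n ^ m - 1) * euler_mascheroni =
      (LINT t:{0<..<1}|lborel. (real n ^ m - disc_theta n t ^ m) / t) - (LINT t:{1..}|lborel. (disc_theta n t ^ m - 1) / t)"
proof -
  let ?K = "grid n - {\<lambda>_::'m. 0}"
  have fin: "finite ?K" by simp
  have pos: "disc_eigenvalue n k > 0" if "k \<in> ?K" for k using disc_eigenvalue_pos[OF n] that by auto
  have cardK: "real (card ?K) = real n ^ m - 1"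
  proof -
    have "(\<lambda>_::'m. 0) \<in> grid n" using n by (auto simp: grid_def)
    moreover have "n ^ m \<ge> 1" using n by simp
    ultimately show ?thesis by (simp add: card_grid m_def of_nat_diff)
  qed
  have e2: "(\<Sum>k\<in>?K. exp (- disc_eigenvalue n k * t) / t) = (disc_theta n t ^ m - 1) / t" for t
    using disc_heat_trace[OF n, where 'm = 'm, of t] by (simp add: sum_divide_distrib[symmetric] m_def)
  have e1: "(\<Sum>k\<in>?K. (1 - exp (- disc_eigenvalue n k * t)) / t) = (real n ^ m - disc_theta n t ^ m) / t" for t
    unfolding sum_divide_distrib[symmetric] sum_subtractf disc_heat_trace[OF n, where 'm = 'm] using cardK by (simp add: m_def)
  have i1: "set_integrable lborel {0<..<1} (\<lambda>t. (1 - exp (- disc_eigenvalue n k * t)) / t)" if "k \<in> ?K" for k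
    by (rule log_integrals_integrable(1)[OF pos[OF that]])
  have i2: "set_integrable lborel {1..} (\<lambda>t. exp (- disc_eigenvalue n k * t) / t)" if "k \<in> ?K" for k
    by (rule log_integrals_integrable(2)[OF pos[OF that]])
  show "set_integrable lborel {0<..<1} (\<lambda>t. (real n ^ m - disc_theta n t ^ m) / t)"
    unfolding e1[symmetric] using i1 unfolding set_integrable_def scaleR_sum_right by (intro Bochner_Integration.integrable_sum)
  show "set_integrable lborel {1..} (\<lambda>t. (disc_theta n t ^ m - 1) / t)"
    unfolding e2[symmetric] using i2 unfolding set_integrable_def scaleR_sum_right by (intro Bochner_Integration.integrable_sum)
  have S1: "(\<Sum>k\<in>?K. LINT t:{0<..<1}|lborel. (1 - exp (- disc_eigenvalue n k * t)) / t) = 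
      (LINT t:{0<..<1}|lborel. (real n ^ m - disc_theta n t ^ m) / t)"
    unfolding e1[symmetric] by (rule set_integral_sum[OF i1, symmetric])
  have S2: "(\<Sum>k\<in>?K. LINT t:{1..}|lborel. exp (- disc_eigenvalue n k * t) / t) = 
      (LINT t:{1..}|lborel. (disc_theta n t ^ m - 1) / t)"
    unfolding e2[symmetric] by (rule set_integral_sum[OF i2, symmetric])
  have "ln (det_discrete_laplacian TYPE('m) n) = (\<Sum>k\<in>?K. ln (disc_eigenvalue n k))"
    unfolding det_discrete_laplacian_eq[OF n] by (rule ln_prod[OF fin]) (metis pos less_irrefl)
  then have "ln (det_discrete_laplacian TYPE('m) n) + (real n ^ m - 1) * euler_mascheroni 
      = (\<Sum>k\<in>?K. ln (disc_eigenvalue n k) + euler_mascheroni)"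
    using cardK by (simp add: sum.distrib)
  also have "\<dots> = (\<Sum>k\<in>?K. (LINT t:{0<..<1}|lborel. (1 - exp (- disc_eigenvalue n k * t)) / t) - (LINT t:{1..}|lborel. exp (- disc_eigenvalue n k * t) / t))"
    by (intro sum.cong refl ln_integral_formula pos)
  also have "\<dots> = (LINT t:{0<..<1}|lborel. (real n ^ m - disc_theta n t ^ m) / t) - (LINT t:{1..}|lborel. (disc_theta n t ^ m - 1) / t)"
    by (simp only: sum_subtractf S1 S2)
  finally show "ln (det_discrete_laplacian TYPE('m) n) + (real n ^ m - 1) * euler_mascheroni =
      (LINT t:{0<..<1}|lborel. (real n ^ m - disc_theta n t ^ m) / t) - (LINT t:{1..}|lborel. (disc_theta n t ^ m - 1) / t)" .
qed


section \<open>The infinite lattice and the scale invariance of dt/t\<close>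

lemma set_integral_scale:
  fixes f :: "real \<Rightarrow> real"
  assumes c: "c > 0" and S: "\<And>t. t \<in> S \<longleftrightarrow> c * t \<in> S'"
  shows "set_integrable lborel S (\<lambda>t. f (c * t) / t) \<longleftrightarrow> set_integrable lborel S' (\<lambda>u. f u / u)"
    and "(LINT t:S|lborel. f (c * t) / t) = (LINT u:S'|lborel. f u / u)"
proof -
  define F where "F u = indicator S' u *\<^sub>R (f u / u)" for u
  have e: "c * F (0 + c * t) = indicator S t *\<^sub>R (f (c * t) / t)" for t
    using c S[of t] by (auto simp: F_def indicator_def)
  have "integrable lborel (\<lambda>t. c * F (0 + c * t)) \<longleftrightarrow> integrable lborel F"
    using c lborel_integrable_real_affine_iff[of c F 0] by simp
  then show "set_integrable lborel S (\<lambda>t. f (c * t) / t) \<longleftrightarrow> set_integrable lborel S' (\<lambda>u. f u / u)"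
    unfolding e unfolding F_def set_integrable_def .
  have "(\<integral>u. F u \<partial>lborel) = \<bar>c\<bar> *\<^sub>R (\<integral>t. F (0 + c * t) \<partial>lborel)"
    using c by (intro lborel_integral_real_affine) simp
  also have "\<dots> = (\<integral>t. c * F (0 + c * t) \<partial>lborel)" using c by simp
  finally show "(LINT t:S|lborel. f (c * t) / t) = (LINT u:S'|lborel. f u / u)"
    unfolding e unfolding F_def set_lebesgue_integral_def by simp
qed

text \<open>The second bound gives convergence of the integrals in \<open>walk_constant\<close> at
  0, the third at infinity. The third is the Gaussian bound on the window for \<open>n\<close> = 1,
  where t = 4 pi^2 u.\<close>

lemma walk_return_bounds:
  assumes u: "u \<ge> 0"
  shows "walk_return u \<le> 1" "1 - walk_return u \<le> 4 * u" "u > 0 \<Longrightarrow> walk_return u \<le> u powr (- (1 / 2))"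
proof -
  have i: "(\<lambda>y. exp (- u * (2 - 2 * cos (2 * pi * y)))) integrable_on {-1/2..1/2}"
    by (intro integrable_continuous_real continuous_intros)
  have "walk_return u \<le> integral {-1/2..1/2::real} (\<lambda>_. 1)"
    unfolding walk_return_def using u by (intro integral_le i) auto
  then show "walk_return u \<le> 1" by simp
  have "integral {-1/2..1/2::real} (\<lambda>_. 1 - 4 * u) \<le> walk_return u"
    unfolding walk_return_def
  proof (intro integral_le i)
    fix y :: real
    have "2 - 2 * cos (2 * pi * y) \<le> 4" using cos_ge_minus_one[of "2 * pi * y"] by linarith
    then have "u * (2 - 2 * cos (2 * pi * y)) \<le> u * 4" using u by (rule mult_left_mono)
    then show "1 - 4 * u \<le> exp (- u * (2 - 2 * cos (2 * pi * y)))"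
      using exp_ge_add_one_self[of "- u * (2 - 2 * cos (2 * pi * y))"] by linarith
  qed auto
  then show "1 - walk_return u \<le> 4 * u" by simp
  show "walk_return u \<le> u powr (- (1 / 2))" if u: "u > 0"
  proof -
    define t where "t = 4 * pi\<^sup>2 * u"
    have t: "t > 0" using u by (simp add: t_def)
    note W = walk_return_window[of 1 t u, unfolded t_def, folded t_def, simplified]
    have "walk_return u = (\<integral>x. window_kernel 1 t x \<partial>lborel)" using W(2) by (simp add: t_def)
    also have "\<dots> \<le> (\<integral>x. exp (- (t / 4) * x\<^sup>2) \<partial>lborel)"
    proof (rule integral_mono)
      show "integrable lborel (window_kernel 1 t)" using W(1) by (simp add: t_def)
      show "integrable lborel (\<lambda>x. exp (- (t / 4) * x\<^sup>2))" using t by (intro gaussian_integral) auto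
      fix x :: real
      show "window_kernel 1 t x \<le> exp (- (t / 4) * x\<^sup>2)"
      proof (cases "\<bar>2 * x\<bar> \<le> real 1")
        case True
        then have "t * (x\<^sup>2 / 4) \<le> t * circle_symbol 1 x"
          using circle_symbol_bounds(3)[of 1 x] t by (intro mult_left_mono) auto
        then show ?thesis by (simp add: window_kernel_def)
      qed (auto simp: window_kernel_def)
    qed
    also have "\<dots> = sqrt (pi / (t / 4))" using t by (intro gaussian_integral) auto
    also have "\<dots> = sqrt ((1 / pi) * (1 / u))" unfolding t_def by (simp add: power2_eq_square)
    also have "\<dots> \<le> sqrt (1 * (1 / u))"
      using u pi_gt3 by (intro real_sqrt_le_mono mult_right_mono) auto
    also have "\<dots> = inverse (sqrt u)" by (simp add: real_sqrt_inverse divide_inverse)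
    also have "\<dots> = u powr (- (1 / 2))" using u powr_half_sqrt[of u] by (simp only: powr_minus less_imp_le)
    finally show ?thesis .
  qed
qed

lemma walk_integrable:
  fixes m :: nat assumes m: "m \<ge> 1"
  shows "set_integrable lborel {0<..<1} (\<lambda>u. (1 - walk_return u ^ m) / u)"
    and "set_integrable lborel {1..} (\<lambda>u. walk_return u ^ m / u)"
proof -
  have cw: "continuous_on S walk_return" for S using continuous_on_walk_return continuous_on_subset by blast
  show "set_integrable lborel {0<..<1} (\<lambda>u. (1 - walk_return u ^ m) / u)"
  proof (rule set_integrable_bounded_unit)
    show "continuous_on {0<..<1} (\<lambda>u. (1 - walk_return u ^ m) / u)" by (intro continuous_intros cw) auto
    fix u :: real assume u: "0 < u" "u < 1"
    have "\<bar>1 ^ m - walk_return u ^ m\<bar> \<le> real m * 1 ^ (m - 1) * \<bar>1 - walk_return u\<bar>"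
      using walk_return_bounds[of u] walk_return_nonneg u by (intro power_diff_le) auto
    also have "\<dots> \<le> real m * (4 * u)"
      using walk_return_bounds(1,2)[of u] u by (auto intro!: mult_left_mono)
    finally show "\<bar>(1 - walk_return u ^ m) / u\<bar> \<le> 4 * m"
      using u by (simp add: pos_divide_le_eq mult_ac)
  qed
  show "set_integrable lborel {1..} (\<lambda>u. walk_return u ^ m / u)"
  proof (rule set_integrable_power_tail[of "- (3 / 2)"])
    show "continuous_on {1..} (\<lambda>u. walk_return u ^ m / u)" by (intro continuous_intros cw) auto
    fix u :: real assume u: "1 \<le> u"
    have "walk_return u ^ m \<le> walk_return u ^ 1"
      using walk_return_bounds(1)[of u] walk_return_nonneg u m by (intro power_decreasing) auto
    also have "\<dots> \<le> u powr (- (1 / 2))" using walk_return_bounds(3)[of u] u by simp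
    finally have "walk_return u ^ m / u \<le> u powr (- (1 / 2)) / u" using u by (intro divide_right_mono) auto
    also have "\<dots> = u powr (- (3 / 2))"
    proof -
      have "u powr (- (1 / 2)) = u powr (- (3 / 2)) * u powr 1" unfolding powr_add[symmetric] by simp
      then show ?thesis using u by simp
    qed
    finally show "\<bar>walk_return u ^ m / u\<bar> \<le> 1 * u powr (- (3 / 2))"
      using walk_return_nonneg[of u] u by simp
  qed simp
qed

text \<open>Formally the Euler constant plus the mean of the logarithm of the lattice symbol, the
  sum over i of 2 - 2 cos (2 pi y_i): the logarithm of the determinant per site. It becomes part of
  the coefficient of n^m.\<close>

definition walk_constant :: "nat \<Rightarrow> real" where
  "walk_constant m = (LINT u:{0<..<1}|lborel. (1 - walk_return u ^ m) / u) - (LINT u:{1..}|lborel. walk_return u ^ m / u)"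

text \<open>Substituting u = c t moves the cut from 1 to \<open>c\<close>. Between the two, the
  integrands (1 - w^m) / u and - w^m / u differ by 1 / u, which yields \<open>ln c\<close>; this is
  where ln n comes from.\<close>

lemma walk_scaling:
  fixes m :: nat assumes m: "m \<ge> 1" and c: "c \<ge> 1"
  shows "set_integrable lborel {0<..<1} (\<lambda>t. (1 - walk_return (c * t) ^ m) / t)"
    and "set_integrable lborel {1..} (\<lambda>t. walk_return (c * t) ^ m / t)"
    and "(LINT t:{0<..<1}|lborel. (1 - walk_return (c * t) ^ m) / t) - (LINT t:{1..}|lborel. walk_return (c * t) ^ m / t)
        = walk_constant m + ln c"
proof -
  let ?w = "\<lambda>u. walk_return u ^ m"
  have c0: "c > 0" using c by simp
  have cw: "continuous_on S walk_return" for S using continuous_on_walk_return continuous_on_subset by blast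
  note I = walk_integrable[OF m]
  have S1: "t \<in> {0<..<1} \<longleftrightarrow> c * t \<in> {0<..<c}" for t
    using c0 mult_less_cancel_left_pos[of c t 1] by (auto simp: zero_less_mult_iff)
  have S2: "t \<in> {1..} \<longleftrightarrow> c * t \<in> {c..}" for t
    using c0 mult_le_cancel_left_pos[of c 1 t] by auto
  have iw: "set_integrable lborel {1..<c} (\<lambda>u. ?w u / u)" by (rule set_integrable_subset[OF I(2)]) auto
  have iw2: "set_integrable lborel {c..} (\<lambda>u. ?w u / u)" by (rule set_integrable_subset[OF I(2)]) (use c in auto)
  have ii: "set_integrable lborel {1..c} (\<lambda>u. 1 / u)" by (intro borel_integrable_atLeastAtMost' continuous_intros) auto
  then have i1: "set_integrable lborel {1..<c} (\<lambda>u. 1 / u)" by (rule set_integrable_subset) auto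
  have ln: "(LINT u:{1..<c}|lborel. 1 / u) = ln c"
  proof -
    have "((\<lambda>u. 1 / u) has_integral ln c - ln 1) {1..c}"
    proof (rule fundamental_theorem_of_calculus[OF c])
      fix u :: real assume "u \<in> {1..c}"
      then have "(ln has_real_derivative 1 / u) (at u)" by (intro DERIV_ln_divide) auto
      then have "(ln has_vector_derivative 1 / u) (at u)" unfolding has_real_derivative_iff_has_vector_derivative .
      then show "(ln has_vector_derivative 1 / u) (at u within {1..c})" by (rule has_vector_derivative_at_within)
    qed
    from integral_unique[OF this] have "(LINT u:{1..c}|lborel. 1 / u) = ln c"
      unfolding set_borel_integral_eq_integral(2)[OF ii] by simp
    moreover have "(LINT u:{1..<c}|lborel. 1 / u) = (LINT u:{1..c}|lborel. 1 / u)"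
      unfolding set_lebesgue_integral_def
    proof (rule integral_cong_AE)
      show "AE u in lborel. indicator {1..<c} u *\<^sub>R (1 / u) = indicator {1..c} u *\<^sub>R (1 / u)"
        using AE_lborel_singleton[of c] by eventually_elim (auto simp: indicator_def)
    qed (use i1 ii in \<open>auto simp: set_integrable_def\<close>)
    ultimately show ?thesis by simp
  qed
  have id: "set_integrable lborel {1..<c} (\<lambda>u. (1 - ?w u) / u)"
    unfolding diff_divide_distrib by (intro set_integral_diff i1 iw)
  have U: "{0<..<c} = {0<..<1} \<union> {1..<c}" using c by auto
  have U2: "{1..} = {1..<c} \<union> {c..}" using c by auto
  have ic: "set_integrable lborel {0<..<c} (\<lambda>u. (1 - ?w u) / u)"
    unfolding U by (rule set_integrable_Un[OF I(1) id]) auto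
  show "set_integrable lborel {0<..<1} (\<lambda>t. (1 - ?w (c * t)) / t)"
    using set_integral_scale(1)[OF c0 S1, of "\<lambda>u. 1 - ?w u"] ic by simp
  show "set_integrable lborel {1..} (\<lambda>t. ?w (c * t) / t)"
    using set_integral_scale(1)[OF c0 S2, of ?w] iw2 by simp
  have "(LINT t:{0<..<1}|lborel. (1 - ?w (c * t)) / t) = (LINT u:{0<..<c}|lborel. (1 - ?w u) / u)"
    by (rule set_integral_scale(2)[OF c0 S1, of "\<lambda>u. 1 - ?w u"])
  also have "\<dots> = (LINT u:{0<..<1}|lborel. (1 - ?w u) / u) + (LINT u:{1..<c}|lborel. (1 - ?w u) / u)"
    unfolding U by (rule set_integral_Un[OF _ I(1) id]) auto
  also have "(LINT u:{1..<c}|lborel. (1 - ?w u) / u) = ln c - (LINT u:{1..<c}|lborel. ?w u / u)"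
    unfolding diff_divide_distrib ln[symmetric] by (rule set_integral_diff(2)[OF i1 iw])
  finally have 1: "(LINT t:{0<..<1}|lborel. (1 - ?w (c * t)) / t) = 
     (LINT u:{0<..<1}|lborel. (1 - ?w u) / u) + (ln c - (LINT u:{1..<c}|lborel. ?w u / u))" .
  have 2: "(LINT t:{1..}|lborel. ?w (c * t) / t) = (LINT u:{c..}|lborel. ?w u / u)"
    by (rule set_integral_scale(2)[OF c0 S2, of ?w])
  have 3: "(LINT u:{1..}|lborel. ?w u / u) = (LINT u:{1..<c}|lborel. ?w u / u) + (LINT u:{c..}|lborel. ?w u / u)"
    unfolding U2 by (rule set_integral_Un[OF _ iw iw2]) auto
  show "(LINT t:{0<..<1}|lborel. (1 - ?w (c * t)) / t) - (LINT t:{1..}|lborel. ?w (c * t) / t) = walk_constant m + ln c"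
    unfolding walk_constant_def 1 2 3 by simp
qed

definition mellin_value :: "nat \<Rightarrow> real" where
  "mellin_value m = (LINT t:{0<..<1}|lborel. small_trace m t / t) + (LINT t:{1..}|lborel. large_trace m t / t)"

lemma trace_over_t_integrable:
  "set_integrable lborel {0<..<1} (\<lambda>t. small_trace m t / t)"
  "set_integrable lborel {1..} (\<lambda>t. large_trace m t / t)"
proof -
  have "set_integrable lborel {0<..<1} (\<lambda>t. small_trace m t * t powr (- 1))" by (rule set_integrable_small_trace)
  then show "set_integrable lborel {0<..<1} (\<lambda>t. small_trace m t / t)"
    by (rule iffD1[OF set_integrable_cong, rotated -1]) (auto simp: powr_minus_divide)
  have "set_integrable lborel {1..} (\<lambda>t. large_trace m t * t powr (- 1))" by (rule set_integrable_large_trace)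
  then show "set_integrable lborel {1..} (\<lambda>t. large_trace m t / t)"
    by (rule iffD1[OF set_integrable_cong, rotated -1]) (auto simp: powr_minus_divide)
qed

lemma mellin_part_0: "mellin_part m 0 = of_real (mellin_value m)"
proof -
  have k: "mellin_kernel 0 t = of_real (1 / t)" if "t > 0" for t
  proof -
    have "mellin_kernel 0 t = exp (of_real (- ln t))" by (simp add: mellin_kernel_def)
    also have "\<dots> = of_real (1 / t)" using that by (simp only: exp_of_real exp_minus exp_ln) (simp add: divide_inverse)
    finally show ?thesis .
  qed
  have "(LINT t:S|lborel. of_real (h t) * mellin_kernel 0 t) = complex_of_real (LINT t:S|lborel. h t / t)"
    if "S \<in> sets borel" "S \<subseteq> {0<..}" for S h
    unfolding set_integral_complex_of_real[symmetric]
    by (rule set_lebesgue_integral_cong) (use that k in auto)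
  then show ?thesis unfolding mellin_part_def mellin_value_def by (simp add: subset_eq)
qed

lemma plane_theta_power: "n > 0 \<Longrightarrow> plane_theta n t ^ m = real n ^ m * walk_return ((real n)\<^sup>2 / (4 * pi\<^sup>2) * t) ^ m"
  by (simp add: plane_theta_def power_mult_distrib mult_ac)

text \<open>The bound \<open>n \<ge> 7\<close> ensures \<open>n\<^sup>2 / (4 * pi\<^sup>2) \<ge> 1\<close>, as needed for \<open>walk_scaling\<close>.\<close>

theorem ln_det_discrete_asymptotics:
  obtains C where "\<And>n. n \<ge> 7 \<Longrightarrow>
    \<bar>ln (det_discrete_laplacian TYPE('m::finite) n)
      - (real n ^ CARD('m) * (walk_constant CARD('m) + ln ((real n)\<^sup>2 / (4 * pi\<^sup>2)) - euler_mascheroni)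
         + (euler_mascheroni + 2 * sqrt pi ^ CARD('m) / CARD('m) - mellin_value CARD('m)))\<bar> \<le> C / n"
proof -
  define m where "m = CARD('m)"
  have m: "m \<ge> 1" unfolding m_def by (simp add: Suc_leI)
  obtain C1 where C1: "C1 \<ge> 0" "\<And>n t. n > 0 \<Longrightarrow> 0 < t \<Longrightarrow> t \<le> 1 \<Longrightarrow>
    \<bar>(disc_theta n t ^ m - plane_theta n t ^ m) - (theta t ^ m - sqrt (pi / t) ^ m)\<bar> \<le> C1 * (t / n)"
    using heat_trace_small_time[OF m] by blast
  obtain C2 where C2: "C2 \<ge> 0" "\<And>n t. n > 0 \<Longrightarrow> 1 \<le> t \<Longrightarrow> \<bar>disc_theta n t ^ m - theta t ^ m\<bar> \<le> C2 / (real n * t)"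
    "\<And>n t. n > 0 \<Longrightarrow> 1 \<le> t \<Longrightarrow> \<bar>plane_theta n t ^ m - sqrt (pi / t) ^ m\<bar> \<le> C2 / (real n * t)"
    using heat_trace_large_time[of m] by blast
  have main: "\<bar>ln (det_discrete_laplacian TYPE('m) n)
      - (real n ^ m * (walk_constant m + ln ((real n)\<^sup>2 / (4 * pi\<^sup>2)) - euler_mascheroni)
         + (euler_mascheroni + 2 * sqrt pi ^ m / m - mellin_value m))\<bar> \<le> (C1 + 2 * C2) / n" if n7: "n \<ge> 7" for n
  proof -
    have n: "n > 0" using n7 by simp
    define c where "c = (real n)\<^sup>2 / (4 * pi\<^sup>2)"
    have c: "c \<ge> 1"
    proof -
      have "2 * pi \<le> real n" using n7 pi_less_4 pi_approx by simp
      then have "(2 * pi)\<^sup>2 \<le> (real n)\<^sup>2" by (intro power_mono) auto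
      then show ?thesis by (simp add: c_def power_mult_distrib)
    qed
    let ?d = "\<lambda>t. disc_theta n t ^ m" and ?p = "\<lambda>t. plane_theta n t ^ m"
    have pw: "?p t = real n ^ m * walk_return (c * t) ^ m" for t using plane_theta_power[OF n] by (simp add: c_def)
    note D = ln_det_discrete_integral[OF n, where 'm = 'm, folded m_def]
    note W = walk_scaling[OF m c]
    have ip1: "set_integrable lborel {0<..<1} (\<lambda>t. (real n ^ m - ?p t) / t)"
      using set_integrable_mult_right[of "real n ^ m", OF W(1)] by (simp add: pw right_diff_distrib)
    have ip2: "set_integrable lborel {1..} (\<lambda>t. ?p t / t)"
      using set_integrable_mult_right[of "real n ^ m", OF W(2)] by (simp add: pw)
    have P: "(LINT t:{0<..<1}|lborel. (real n ^ m - ?p t) / t) - (LINT t:{1..}|lborel. ?p t / t) = real n ^ m * (walk_constant m + ln c)"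
    proof -
      have "(LINT t:{0<..<1}|lborel. (real n ^ m - ?p t) / t) = (LINT t:{0<..<1}|lborel. real n ^ m * ((1 - walk_return (c * t) ^ m) / t))"
        by (simp add: pw right_diff_distrib)
      moreover have "(LINT t:{1..}|lborel. ?p t / t) = (LINT t:{1..}|lborel. real n ^ m * (walk_return (c * t) ^ m / t))"
        by (simp add: pw)
      ultimately show ?thesis unfolding W(3)[symmetric] by (simp only: set_integral_mult_right right_diff_distrib)
    qed
    have iS: "set_integrable lborel {0<..<1} (\<lambda>t. small_trace m t / t)" and iL: "set_integrable lborel {1..} (\<lambda>t. large_trace m t / t)"
      by (rule trace_over_t_integrable)+
    have q: "sqrt (pi / t) ^ m / t = sqrt pi ^ m * t powr (- (real m / 2) - 1)" if t: "t > 0" for t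
    proof -
      have "sqrt t ^ m = (t powr (1 / 2)) ^ m" using t by (simp only: powr_half_sqrt less_imp_le)
      also have "\<dots> = (t powr (1 / 2)) powr real m" using t by (subst powr_realpow) auto
      also have "\<dots> = t powr (real m / 2)" by (simp only: powr_powr) simp
      finally have st: "sqrt t ^ m = t powr (real m / 2)" .
      have t1: "t powr 1 = t" using t by simp
      have "sqrt (pi / t) ^ m / t = sqrt pi ^ m * (inverse (sqrt t ^ m) * inverse t)"
        unfolding real_sqrt_divide power_divide by (simp only: divide_inverse mult.assoc)
      also have "\<dots> = sqrt pi ^ m * (inverse (t powr (real m / 2)) * inverse (t powr 1))"
        by (simp only: st t1)
      also have "inverse (t powr (real m / 2)) * inverse (t powr 1) = t powr (- (real m / 2) - 1)"
        unfolding powr_minus[symmetric] powr_add[symmetric] by simp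
      finally show ?thesis .
    qed
    have mm: "- (real m / 2) - 1 < -1" using m by simp
    have iQ': "set_integrable lborel {1..} (\<lambda>t. sqrt pi ^ m * t powr (- (real m / 2) - 1))"
      by (intro set_integrable_mult_right power_tail_integral mm)
    have iQ: "set_integrable lborel {1..} (\<lambda>t. sqrt (pi / t) ^ m / t)"
      using iQ' by (rule iffD2[OF set_integrable_cong, rotated -1]) (use q in auto)
    \<comment> \<open>Minus the value at s = 0 of the pole term in \<open>zeta_cont\<close>, hence
      the same summand as in \<open>log_det_zeta_torus_eq\<close>.\<close>
    have Q: "(LINT t:{1..}|lborel. sqrt (pi / t) ^ m / t) = 2 * sqrt pi ^ m / m"
    proof -
      have "(LINT t:{1..}|lborel. sqrt (pi / t) ^ m / t) = (LINT t:{1..}|lborel. sqrt pi ^ m * t powr (- (real m / 2) - 1))"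
        by (rule set_lebesgue_integral_cong) (use q in auto)
      also have "\<dots> = sqrt pi ^ m * (- 1 / (- (real m / 2) - 1 + 1))"
        by (simp only: set_integral_mult_right power_tail_integral(2)[OF mm])
      finally show ?thesis by simp
    qed
    \<comment> \<open>Grouped so that \<open>real n ^ m\<close> cancels and each group tends to 0:
      below the cut, discrete minus lattice trace against its limit; above it, the two traces
      separately, each against its own limit.\<close>
    define R1 where "R1 t = ((real n ^ m - ?p t) / t - (real n ^ m - ?d t) / t) - small_trace m t / t" for t
    define R2 where "R2 t = (?d t - 1) / t - large_trace m t / t" for t
    define R3 where "R3 t = ?p t / t - sqrt (pi / t) ^ m / t" for t
    have I0: "set_integrable lborel {0<..<1} (\<lambda>t. (real n ^ m - ?p t) / t - (real n ^ m - ?d t) / t)"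
      by (rule set_integral_diff(1)[OF ip1 D(1)])
    have I1: "set_integrable lborel {0<..<1} R1" "(LINT t:{0<..<1}|lborel. R1 t) = 
       (LINT t:{0<..<1}|lborel. (real n ^ m - ?p t) / t) - (LINT t:{0<..<1}|lborel. (real n ^ m - ?d t) / t) - (LINT t:{0<..<1}|lborel. small_trace m t / t)"
      unfolding R1_def set_integral_diff(2)[OF I0 iS] set_integral_diff(2)[OF ip1 D(1)]
      by (rule set_integral_diff(1)[OF I0 iS], rule refl)
    have I2: "set_integrable lborel {1..} R2" "(LINT t:{1..}|lborel. R2 t) = (LINT t:{1..}|lborel. (?d t - 1) / t) - (LINT t:{1..}|lborel. large_trace m t / t)"
      unfolding R2_def by (rule set_integral_diff[OF D(2) iL])+
    have I3: "set_integrable lborel {1..} R3" "(LINT t:{1..}|lborel. R3 t) = (LINT t:{1..}|lborel. ?p t / t) - (LINT t:{1..}|lborel. sqrt (pi / t) ^ m / t)"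
      unfolding R3_def by (rule set_integral_diff[OF ip2 iQ])+
    have B1: "\<bar>LINT t:{0<..<1}|lborel. R1 t\<bar> \<le> C1 / n"
    proof -
      have "\<bar>LINT t:{0<..<1}|lborel. R1 t\<bar> \<le> (LINT t:{0<..<1::real}|lborel. C1 / n)"
        unfolding set_lebesgue_integral_def real_norm_def[symmetric]
      proof (rule order_trans[OF integral_norm_bound integral_mono])
        show "integrable lborel (\<lambda>t. norm (indicator {0<..<1} t *\<^sub>R R1 t))" using I1(1) unfolding set_integrable_def by (rule integrable_norm)
        show "integrable lborel (\<lambda>t. indicator {0<..<1::real} t *\<^sub>R (C1 / n))" by simp
        fix t :: real
        show "norm (indicator {0<..<1} t *\<^sub>R R1 t) \<le> indicator {0<..<1} t *\<^sub>R (C1 / n)"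
        proof (cases "t \<in> {0<..<1}")
          case True
          have "R1 t = ((?d t - ?p t) - (theta t ^ m - sqrt (pi / t) ^ m)) / t"
            by (simp add: R1_def small_trace_def diff_divide_distrib)
          then have "\<bar>R1 t\<bar> = \<bar>(?d t - ?p t) - (theta t ^ m - sqrt (pi / t) ^ m)\<bar> / t" using True by simp
          also have "\<dots> \<le> C1 * (t / n) / t" using C1(2)[OF n, of t] True by (intro divide_right_mono) auto
          also have "\<dots> = C1 / n" using True by simp
          finally show ?thesis using True by simp
        qed simp
      qed
      also have "\<dots> = C1 / n" by (simp add: set_lebesgue_integral_def)
      finally show ?thesis .
    qed
    have tail: "\<bar>LINT t:{1..}|lborel. R t\<bar> \<le> C2 / n" if iR: "set_integrable lborel {1..} R" and bR: "\<And>t. 1 \<le> t \<Longrightarrow> \<bar>R t\<bar> \<le> C2 / (real n * t) / t" for R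
    proof -
      have t2: "t powr (- 2) = 1 / (t * t)" if "t \<ge> 1" for t :: real
        using that by (simp add: powr_minus power2_eq_square divide_inverse flip: powr_realpow)
      have "\<bar>LINT t:{1..}|lborel. R t\<bar> \<le> (LINT t:{1..}|lborel. (C2 / n) * t powr (- 2))"
        unfolding set_lebesgue_integral_def real_norm_def[symmetric]
      proof (rule order_trans[OF integral_norm_bound integral_mono])
        show "integrable lborel (\<lambda>t. norm (indicator {1..} t *\<^sub>R R t))" using iR unfolding set_integrable_def by (rule integrable_norm)
        have "set_integrable lborel {1..} (\<lambda>t. (C2 / n) * t powr (- 2))"
          by (intro set_integrable_mult_right power_tail_integral) simp
        then show "integrable lborel (\<lambda>t. indicator {1..} t *\<^sub>R ((C2 / n) * t powr (- 2)))" unfolding set_integrable_def .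
        fix t :: real
        show "norm (indicator {1..} t *\<^sub>R R t) \<le> indicator {1..} t *\<^sub>R ((C2 / n) * t powr (- 2))"
        proof (cases "1 \<le> t")
          case True
          then show ?thesis using bR[OF True] t2[OF True] by (simp add: mult.assoc)
        qed simp
      qed
      also have "\<dots> = C2 / n" using power_tail_integral(2)[of "- 2"] by (simp only: set_integral_mult_right) simp
      finally show ?thesis .
    qed
    have B2: "\<bar>LINT t:{1..}|lborel. R2 t\<bar> \<le> C2 / n"
    proof (rule tail[OF I2(1)])
      fix t :: real assume t: "1 \<le> t"
      have "R2 t = (?d t - theta t ^ m) / t" by (simp add: R2_def large_trace_def diff_divide_distrib)
      then have "\<bar>R2 t\<bar> = \<bar>?d t - theta t ^ m\<bar> / t" using t by simp
      also have "\<dots> \<le> C2 / (real n * t) / t" using t by (intro divide_right_mono C2(2) n) auto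
      finally show "\<bar>R2 t\<bar> \<le> C2 / (real n * t) / t" .
    qed
    have B3: "\<bar>LINT t:{1..}|lborel. R3 t\<bar> \<le> C2 / n"
    proof (rule tail[OF I3(1)])
      fix t :: real assume t: "1 \<le> t"
      have "R3 t = (?p t - sqrt (pi / t) ^ m) / t" by (simp add: R3_def diff_divide_distrib)
      then have "\<bar>R3 t\<bar> = \<bar>?p t - sqrt (pi / t) ^ m\<bar> / t" using t by simp
      also have "\<dots> \<le> C2 / (real n * t) / t" using t by (intro divide_right_mono C2(3) n) auto
      finally show "\<bar>R3 t\<bar> \<le> C2 / (real n * t) / t" .
    qed
    have "ln (det_discrete_laplacian TYPE('m) n)
      - (real n ^ m * (walk_constant m + ln c - euler_mascheroni) + (euler_mascheroni + 2 * sqrt pi ^ m / m - mellin_value m))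
      = - (LINT t:{0<..<1}|lborel. R1 t) - (LINT t:{1..}|lborel. R2 t) + (LINT t:{1..}|lborel. R3 t)"
      using D(3) P unfolding I1(2) I2(2) I3(2) Q mellin_value_def by (simp add: algebra_simps)
    moreover have "(C1 + 2 * C2) / n = C1 / n + C2 / n + C2 / n" by (simp add: add_divide_distrib)
    ultimately show ?thesis using B1 B2 B3 unfolding c_def by linarith
  qed
  show ?thesis by (rule that[of "C1 + 2 * C2"]) (use main in \<open>simp add: m_def\<close>)
qed

theorem theorem1p6:
  shows "has_regularized_limit
           (\<lambda>n. complex_of_real (ln (det_discrete_laplacian TYPE('m::finite) n)))
           (log_det_zeta_torus TYPE('m))"
proof -
  define m where "m = CARD('m)"
  have m: "m \<ge> 1" unfolding m_def by (simp add: Suc_leI)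
  define L where "L = euler_mascheroni + 2 * sqrt pi ^ m / m - mellin_value m"
  define B where "B = walk_constant m - ln (4 * pi\<^sup>2) - euler_mascheroni"
  obtain C where C: "\<And>n. n \<ge> 7 \<Longrightarrow> \<bar>ln (det_discrete_laplacian TYPE('m) n) - 
      (real n ^ m * (walk_constant m + ln ((real n)\<^sup>2 / (4 * pi\<^sup>2)) - euler_mascheroni) + L)\<bar> \<le> C / n"
    using ln_det_discrete_asymptotics[where 'm = 'm] unfolding m_def L_def by blast
  \<comment> \<open>Exponent \<open>m\<close> carries the growing terms. The error is O(1/n), and
    any real exponent strictly between -1 and 0 in the last place turns this into the required
    little-o; - 1/2 is one of these.\<close>
  define \<alpha> where "\<alpha> j = (if j = (1::nat) then of_nat m else - (1 / 2) :: complex)" for j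
  \<comment> \<open>The factor of n^m is B + 2 ln n, because ln (n^2 / (4 pi^2)) = 2 ln n - ln (4
    pi^2).\<close>
  define a where "a j k = complex_of_real (if j = (0::nat) then L else if k = (0::nat) then B else 2)" for j k
  define M where "M j = (if j = (1::nat) then 1 else 0 :: nat)" for j
  have L: "log_det_zeta_torus TYPE('m) = a 0 0"
    unfolding log_det_zeta_torus_eq mellin_part_0 by (simp add: a_def L_def m_def)
  let ?r = "\<lambda>n. complex_of_real (ln (det_discrete_laplacian TYPE('m) n))
            - ((\<Sum>j = 1..<2. \<Sum>k = 0..M j. a j k * of_nat n powr \<alpha> j * of_real (ln (real n)) ^ k)
               + (\<Sum>k = 0..M 0. a 0 k * of_real (ln (real n)) ^ k))"
  have r: "cmod (?r n) \<le> C / n" if n: "n \<ge> 7" for n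
  proof -
    have n0: "n > 0" using n by simp
    have pw: "(of_nat n :: complex) powr of_nat m = of_real (real n ^ m)"
      using n0 m by (subst powr_nat') auto
    have lnc: "ln ((real n)\<^sup>2 / (4 * pi\<^sup>2)) = 2 * ln (real n) - ln (4 * pi\<^sup>2)"
      using n0 by (simp add: ln_div ln_realpow)
    have eq: "real n ^ m * (walk_constant m + ln ((real n)\<^sup>2 / (4 * pi\<^sup>2)) - euler_mascheroni) + L
       = B * real n ^ m + 2 * real n ^ m * ln (real n) + L"
      unfolding lnc by (simp add: B_def algebra_simps)
    have "{1..<2} = {1::nat}" by auto
    then have "?r n = complex_of_real (ln (det_discrete_laplacian TYPE('m) n) - (B * real n ^ m + 2 * real n ^ m * ln (real n) + L))"
      by (simp add: M_def a_def \<alpha>_def pw)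
    then have "cmod (?r n) = \<bar>ln (det_discrete_laplacian TYPE('m) n) - (B * real n ^ m + 2 * real n ^ m * ln (real n) + L)\<bar>"
      by (simp only: norm_of_real)
    then show ?thesis using C[OF n] unfolding eq by simp
  qed
  have small: "?r \<in> o(\<lambda>n. of_nat n powr \<alpha> 2 * of_real (ln (real n)) ^ M 2)"
  proof (rule landau_o.smallI)
    fix e :: real assume e: "e > 0"
    have "(\<lambda>n. C / real n / (real n powr (- (1 / 2)))) \<longlonglongrightarrow> 0" by real_asymp
    then have "\<forall>\<^sub>F n in sequentially. C / real n / (real n powr (- (1 / 2))) < e" using e by (rule order_tendstoD)
    then show "\<forall>\<^sub>F n in sequentially. cmod (?r n) \<le> e * cmod (of_nat n powr \<alpha> 2 * of_real (ln (real n)) ^ M 2)"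
      using eventually_ge_at_top[of 7]
    proof eventually_elim
      case (elim n)
      have "cmod (of_nat n powr \<alpha> 2) = real n powr (- (1 / 2))"
        using elim(2) by (simp add: \<alpha>_def norm_powr_real_powr)
      moreover have "real n powr (- (1 / 2)) > 0" using elim(2) by simp
      from elim(1)[unfolded pos_divide_less_eq[OF this]] have "C / n \<le> e * real n powr (- (1 / 2))"
        by (rule less_imp_le)
      ultimately show ?case using r[OF elim(2)] by (simp add: M_def)
    qed
  qed
  show ?thesis
    unfolding has_regularized_limit_def
  proof (intro exI conjI)
    show "(2::nat) \<ge> 1" by simp
    show "\<forall>j\<in>{1..2}. \<alpha> j \<noteq> 0" using m by (auto simp: \<alpha>_def)
    show "\<forall>i\<in>{1..2}. \<forall>j\<in>{1..2}. i \<le> j \<longrightarrow> Re (\<alpha> j) \<le> Re (\<alpha> i)" by (auto simp: \<alpha>_def)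
    show "Re (\<alpha> 2) < 0" by (simp add: \<alpha>_def)
    show "?r \<in> o(\<lambda>n. of_nat n powr \<alpha> 2 * of_real (ln (real n)) ^ M 2)" by (rule small)
    show "log_det_zeta_torus TYPE('m) = a 0 0" by (rule L)
  qed
qed

end
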